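(* There exists a set of permutation patterns $\mathcal F \subset S_{80}$ such that the sequence $\{C_n(\mathcal F)\}_{n\ge 1}$ is not P-recursive. In particular, the Noonan--Zeilberger conjecture (that $\{C_n(\mathcal F)\}$ is P-recursive for every fixed finite set of patterns $\mathcal F\subset S_k$) is false.
   Context: For $\sigma\in S_n$ and $\omega\in S_k$, $\sigma$ contains the pattern $\omega$ if there is a subset $X\subseteq\{1,\dots,n\}$ with $|X|=k$ such that $\sigma|_X$ has the same relative order as $\omega$; otherwise $\sigma$ avoids $\omega$. For a set of patterns $\mathcal F\subset S_k$, $C_n(\mathcal F)$ is the number of permutations $\sigma\in S_n$ avoiding every $\omega\in\mathcal F$. An integer sequence $\{a_n\}$ is P-recursive if it satisfies a nontrivial linear recurrence $q_0(n)a_n+q_1(n)a_{n-1}+\dots+q_k(n)a_{n-k}=0$ for all sufficiently large $n$, with polynomials $q_i\in\mathbb Z[x]$ not all zero. *)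

theory Defs
  imports "HOL-Computational_Algebra.Polynomial"
begin

text \<open>Permutations in S_n are represented in one-line notation as lists
  \<sigma> = [\<sigma>(1), ..., \<sigma>(n)] with entries a rearrangement of 1..n.\<close>

definition is_perm :: "nat \<Rightarrow> nat list \<Rightarrow> bool" where
  "is_perm n \<sigma> \<longleftrightarrow> length \<sigma> = n \<and> distinct \<sigma> \<and> set \<sigma> = {1..n}"

definition contains :: "nat list \<Rightarrow> nat list \<Rightarrow> bool" where
  "contains \<sigma> \<omega> \<longleftrightarrow> (\<exists>idx :: nat \<Rightarrow> nat.
      strict_mono_on {..<length \<omega>} idx \<and>
      (\<forall>j<length \<omega>. idx j < length \<sigma>) \<and>
      (\<forall>a<length \<omega>. \<forall>b<length \<omega>. (\<sigma> ! idx a < \<sigma> ! idx b) \<longleftrightarrow> (\<omega> ! a < \<omega> ! b)))"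

definition avoids :: "nat list \<Rightarrow> nat list \<Rightarrow> bool" where
  "avoids \<sigma> \<omega> \<longleftrightarrow> \<not> contains \<sigma> \<omega>"

definition C :: "nat \<Rightarrow> nat list set \<Rightarrow> nat" where
  "C n F = card {\<sigma>. is_perm n \<sigma> \<and> (\<forall>\<omega>\<in>F. avoids \<sigma> \<omega>)}"

definition P_recursive :: "(nat \<Rightarrow> int) \<Rightarrow> bool" where
  "P_recursive a \<longleftrightarrow> (\<exists>(k::nat) (q :: nat \<Rightarrow> int poly) (N::nat).
      (\<exists>i\<le>k. q i \<noteq> 0) \<and>
      (\<forall>n\<ge>N. n \<ge> k \<longrightarrow> (\<Sum>i\<le>k. poly (q i) (int n) * a (n - i)) = 0))"

end

theory Submission
  imports Defs
begin

text \<open>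
If \<open>a\<close> is P-recursive and \<open>2 ^ E\<close> is the largest power of 2 dividing all values of all its coefficient
polynomials, then along some arithmetic progression \<open>a\<close> satisfies, modulo 2, a fixed nontrivial linear
relation. This is impossible if \<open>a n\<close> is odd exactly for \<open>n = 9 * T - 2\<close> with \<open>T\<close> triangular: these
numbers have growing gaps and meet every residue class modulo every power of 2.

To realise such parities, four simple permutations of length 7 (and their reversals, the primed
versions) serve as letters; forbidding every occurrence that is not an interval makes letters movable
as units. Every kind of letter has a need: a configuration of neighbours that it should have. A primed
letter is forbidden when its need is met. Hence reversing a letter whose need is not met is an
involution, and modulo 2 only two kinds of permutations count: those without letters, which cancel under
reversal, and those in which all needs are met.

In the latter the letters \<open>b 1, \<dots>, b N\<close> increase. A linker to the right of \<open>b (j + 1)\<close> and below \<open>b j\<close>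
certifies, by a bounded pattern, that these two letters are consecutive. A pointer between the columns of
\<open>b i\<close> and \<open>b (i + 1)\<close> and between the rows of two later consecutive letters copies the label of \<open>b i\<close>
upwards. The pointers increase and skip the row just below each special letter, so the word of labels is
built from laps \<open>S\<close>, \<open>NS\<close>, \<open>NNS\<close>, \<dots> of growing length (with first letter P and last letter Q instead of
S). So \<open>N\<close> is triangular and everything else is forced.
\<close>

section \<open>Blocks and letters\<close>

text \<open>Avoidance can forbid configurations but never demand one; the needs supply the missing
  existence statements, because a letter lacking its configuration can be turned around freely and
  its permutation cancels modulo 2. The price is that every rule and every need must be insensitive
  to reversing any letter. Hence letters are simple and occur only as intervals, which keeps
  occurrences disjoint and lets no new one arise, and configurations speak of whole letters in
  either orientation and of points whose horizontal order no reversal can disturb. What remains is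
  at most one permutation of each length. With \<open>N\<close> letters it consists of 7 * N points
  in letters, \<open>N - 1\<close> linkers and \<open>N - 1\<close> pointers, whence the length 9 *
  N - 2. A configuration has at most 8 items of at most 7 points each, so every violation involves
  at most 56 points and can be padded to a pattern of length 80. The equivalence of avoidance and
  goodness thus holds from length 80 on, and P-recursiveness only concerns large indices
  anyway.\<close>

datatype lab = LP | LN | LS | LQ

text \<open>What matters about the four words: they are distinct and simple, the first entry lies
  below the last, so that no word is order-isomorphic to the reversal of one of them, and each word
  as well as each reversal contains 4321.\<close>

fun blk :: "lab \<Rightarrow> nat list" where
  "blk LP = [2,4,7,5,3,1,6]"
| "blk LN = [2,7,3,6,4,1,5]"
| "blk LS = [2,7,5,3,1,4,6]"
| "blk LQ = [3,7,4,2,5,1,6]"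

lemma length_blk [simp]: "length (blk x) = 7"
  by (cases x) auto

lemma set_blk: "set (blk x) = {1..7}"
proof -
  have "{1..7::nat} = {1,2,3,4,5,6,7}" by auto
  then show ?thesis by (cases x) auto
qed

lemma distinct_blk: "distinct (blk x)"
  by (cases x) auto

text \<open>An occurrence is recorded as its set of positions, which determines the increasing
  \<open>f\<close>. Positions are arbitrary naturals, so nothing has to be renumbered when a
  permutation is restricted to some of its points.\<close>

definition pat :: "(nat \<Rightarrow> nat) \<Rightarrow> nat set \<Rightarrow> nat list \<Rightarrow> bool" where
  "pat v A \<beta> \<longleftrightarrow> (\<exists>f. strict_mono_on {..<length \<beta>} f \<and> A = f ` {..<length \<beta>} \<and>
     (\<forall>i<length \<beta>. \<forall>j<length \<beta>. v (f i) < v (f j) \<longleftrightarrow> \<beta> ! i < \<beta> ! j))"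

lemma pat_image:
  assumes "pat v A \<beta>" and mono: "\<And>y z. y \<in> A \<Longrightarrow> z \<in> A \<Longrightarrow> y < z \<Longrightarrow> h y < h z"
    and val: "\<And>y z. y \<in> A \<Longrightarrow> z \<in> A \<Longrightarrow> u (h y) < u (h z) \<longleftrightarrow> v y < v z"
  shows "pat u (h ` A) \<beta>"
proof -
  obtain f where f: "strict_mono_on {..<length \<beta>} f" "A = f ` {..<length \<beta>}"
     "\<forall>i<length \<beta>. \<forall>j<length \<beta>. v (f i) < v (f j) \<longleftrightarrow> \<beta> ! i < \<beta> ! j"
    using assms(1) unfolding pat_def by blast
  have fA: "f i \<in> A" if "i < length \<beta>" for i using that f(2) by blast
  have "strict_mono_on {..<length \<beta>} (h \<circ> f)"
    using mono fA strict_mono_onD[OF f(1)] by (auto intro!: strict_mono_onI)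
  moreover have "h ` A = (h \<circ> f) ` {..<length \<beta>}" using f(2) by (simp add: image_comp)
  ultimately show ?thesis using f(3) val fA unfolding pat_def by (intro exI[of _ "h \<circ> f"]) simp
qed

lemma pat_image_rev:
  assumes "pat v A \<beta>" and anti: "\<And>y z. y \<in> A \<Longrightarrow> z \<in> A \<Longrightarrow> y < z \<Longrightarrow> h z < h y"
    and val: "\<And>y z. y \<in> A \<Longrightarrow> z \<in> A \<Longrightarrow> u (h y) < u (h z) \<longleftrightarrow> v y < v z"
  shows "pat u (h ` A) (rev \<beta>)"
proof -
  obtain f where f: "strict_mono_on {..<length \<beta>} f" "A = f ` {..<length \<beta>}"
     "\<forall>i<length \<beta>. \<forall>j<length \<beta>. v (f i) < v (f j) \<longleftrightarrow> \<beta> ! i < \<beta> ! j"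
    using assms(1) unfolding pat_def by blast
  let ?n = "length \<beta>"
  let ?g = "\<lambda>i. h (f (?n - Suc i))"
  have fA: "f i \<in> A" if "i < ?n" for i using that f(2) by blast
  have "strict_mono_on {..<?n} ?g"
  proof (rule strict_mono_onI)
    fix i j assume ij: "i \<in> {..<?n}" "j \<in> {..<?n}" "i < j"
    then have "f (?n - Suc j) < f (?n - Suc i)" by (intro strict_mono_onD[OF f(1)]) auto
    then show "?g i < ?g j" using anti[OF fA fA] ij by auto
  qed
  moreover have "h ` A = ?g ` {..<?n}"
  proof -
    have "i \<in> (\<lambda>i. ?n - Suc i) ` {..<?n}" if "i < ?n" for i
      using that by (intro image_eqI[of _ _ "?n - Suc i"]) auto
    then have "{..<?n} = (\<lambda>i. ?n - Suc i) ` {..<?n}" by auto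
    then have "f ` {..<?n} = f ` (\<lambda>i. ?n - Suc i) ` {..<?n}" by simp
    then show ?thesis unfolding f(2) by (simp add: image_image)
  qed
  moreover have "u (?g i) < u (?g j) \<longleftrightarrow> rev \<beta> ! i < rev \<beta> ! j" if "i < ?n" "j < ?n" for i j
    using f(3) val fA that by (simp add: rev_nth)
  ultimately show ?thesis unfolding pat_def by (intro exI[of _ ?g]) simp
qed

definition letter :: "(nat \<Rightarrow> nat) \<Rightarrow> nat set \<Rightarrow> lab \<Rightarrow> bool" where
  "letter v A x \<longleftrightarrow> pat v A (blk x) \<or> pat v A (rev (blk x))"

text \<open>An increasing enumeration is the sorted list of its image.\<close>

lemma strict_mono_image_unique:
  fixes f g :: "nat \<Rightarrow> nat"
  assumes "strict_mono_on {..<m} f" "strict_mono_on {..<m} g" "f ` {..<m} = g ` {..<m}" "i < m"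
  shows "f i = g i"
proof -
  have s: "sorted (map h [0..<m]) \<and> distinct (map h [0..<m])" if "strict_mono_on {..<m} h" for h :: "nat \<Rightarrow> nat"
  proof -
    have "sorted_wrt (<) (map h [0..<m])"
      using that by (auto simp: sorted_wrt_iff_nth_less strict_mono_on_def)
    then show ?thesis using strict_sorted_iff by blast
  qed
  have "map f [0..<m] = map g [0..<m]"
    using s[OF assms(1)] s[OF assms(2)] assms(3)
    by (intro sorted_distinct_set_unique) (auto simp: atLeast0LessThan)
  then have "map f [0..<m] ! i = map g [0..<m] ! i" by (rule arg_cong)
  then show ?thesis using assms(4) by (simp del: map_eq_conv)
qed

lemma pat_unique:
  assumes "pat v A \<beta>" "pat v A \<gamma>" "length \<beta> = length \<gamma>" "i < length \<beta>" "j < length \<beta>"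
  shows "\<beta> ! i < \<beta> ! j \<longleftrightarrow> \<gamma> ! i < \<gamma> ! j"
proof -
  obtain f where f: "strict_mono_on {..<length \<beta>} f" "A = f ` {..<length \<beta>}"
     "\<forall>i<length \<beta>. \<forall>j<length \<beta>. v (f i) < v (f j) \<longleftrightarrow> \<beta> ! i < \<beta> ! j"
    using assms(1) unfolding pat_def by blast
  obtain g where g: "strict_mono_on {..<length \<gamma>} g" "A = g ` {..<length \<gamma>}"
     "\<forall>i<length \<gamma>. \<forall>j<length \<gamma>. v (g i) < v (g j) \<longleftrightarrow> \<gamma> ! i < \<gamma> ! j"
    using assms(2) unfolding pat_def by blast
  have g1: "strict_mono_on {..<length \<beta>} g" and im: "f ` {..<length \<beta>} = g ` {..<length \<beta>}"
    using f(2) g(1,2) assms(3) by metis+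
  have "f i = g i" "f j = g j"
    using strict_mono_image_unique[OF f(1) g1 im] assms(4,5) by blast+
  moreover have "v (f i) < v (f j) \<longleftrightarrow> \<beta> ! i < \<beta> ! j" using f(3) assms(4,5) by blast
  moreover have "v (g i) < v (g j) \<longleftrightarrow> \<gamma> ! i < \<gamma> ! j" using g(3) assms(3,4,5) by auto
  ultimately show ?thesis by simp
qed

lemma pat_card:
  assumes "pat v A \<beta>" shows "finite A" "card A = length \<beta>"
proof -
  obtain f where f: "strict_mono_on {..<length \<beta>} f" "A = f ` {..<length \<beta>}"
    using assms(1) unfolding pat_def by blast
  show "finite A" unfolding f(2) by simp
  show "card A = length \<beta>"
    unfolding f(2) using card_image[OF strict_mono_on_imp_inj_on[OF f(1)]] by simp
qed

lemma letter_card: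
  assumes "letter v A x" shows "finite A" "card A = 7"
  using assms pat_card[of v A "blk x"] pat_card[of v A "rev (blk x)"] unfolding letter_def by auto

lemma letter_nonempty: "letter v A x \<Longrightarrow> A \<noteq> {}"
  using letter_card(2) by fastforce

text \<open>The first and the last entry compare oppositely in the two words.\<close>

lemma pat_blk_not_rev:
  assumes "pat v A (blk x)" "pat v A (rev (blk y))" shows False
proof -
  have "blk x ! 0 < blk x ! 6" "\<not> rev (blk y) ! 0 < rev (blk y) ! 6"
    by (cases x; simp; fail) (cases y; simp)
  with pat_unique[OF assms, of 0 6] show False by simp
qed

lemma pat_blk_label:
  assumes "pat v A (blk x)" "pat v A (blk y)" shows "x = y"
proof -
  have "blk x ! i < blk x ! j \<longleftrightarrow> blk y ! i < blk y ! j" if "i < 7" "j < 7" for i j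
    using pat_unique[OF assms] that by simp
  \<comment> \<open>These six comparisons of entries tell any two of the four words apart.\<close>
  from this[of 1 2] this[of 1 6] this[of 2 3] this[of 0 3] this[of 2 4] this[of 0 4] show ?thesis
    by (cases x; cases y) auto
qed

lemma pat_rev_label:
  assumes "pat v A (rev (blk x))" "pat v A (rev (blk y))" shows "x = y"
proof -
  have "rev (blk x) ! i < rev (blk x) ! j \<longleftrightarrow> rev (blk y) ! i < rev (blk y) ! j" if "i < 7" "j < 7" for i j
    using pat_unique[OF assms] that by simp
  from this[of 5 4] this[of 5 0] this[of 4 3] this[of 6 3] this[of 4 2] this[of 6 2] show ?thesis
    by (cases x; cases y) auto
qed

lemma letter_label: "letter v A x \<Longrightarrow> letter v A y \<Longrightarrow> x = y"
  unfolding letter_def using pat_blk_not_rev pat_blk_label pat_rev_label by blast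

text \<open>For \<open>K\<close> inside \<open>A\<close> this is the usual notion of an interval of
  a permutation: contiguous among the points of \<open>A\<close> both in positions and in values. A
  simple permutation has only trivial intervals.\<close>

definition convx :: "(nat \<Rightarrow> nat) \<Rightarrow> nat set \<Rightarrow> nat set \<Rightarrow> bool" where
  "convx v K A \<longleftrightarrow> (\<forall>x\<in>K. \<forall>y\<in>K. \<forall>z\<in>A. (x < z \<and> z < y) \<or> (v x < v z \<and> v z < v y) \<longrightarrow> z \<in> K)"

text \<open>Simplicity as a finite check: every window of at least two but not all positions has an
  outside value strictly between two of its own. The ranges are written as lists so that evaluation
  decides the statement.\<close>

lemma blk_interval_cut:
  "\<forall>a\<in>set [0..<7]. \<forall>b\<in>set [0..<7]. a < b \<longrightarrow> a \<noteq> 0 \<or> b \<noteq> 6 \<longrightarrow>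
     (\<exists>i\<in>set [a..<Suc b]. \<exists>j\<in>set [a..<Suc b]. \<exists>z\<in>set [0..<7].
        (z < a \<or> b < z) \<and> blk x ! i < blk x ! z \<and> blk x ! z < blk x ! j)"
  by (induct x; code_simp)

text \<open>A convex set of positions is the whole window from its minimum to its maximum, and the
  finite check excludes all nontrivial windows.\<close>

lemma blk_simple:
  assumes "convx ((!) (blk x)) J {..<7}" "J \<subseteq> {..<7}"
  shows "card J \<le> 1 \<or> J = {..<7}"
proof (rule disjCI)
  assume nJ: "J \<noteq> {..<7}"
  have fin: "finite J" using assms(2) finite_subset by blast
  show "card J \<le> 1"
  proof (rule ccontr)
    assume c1: "\<not> card J \<le> 1"
    then have ne: "J \<noteq> {}" by auto
    have mem: "Min J \<in> J" "Max J \<in> J" using fin ne by auto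
    have c2: "Min J \<noteq> Max J"
    proof
      assume e: "Min J = Max J"
      have "y = Min J" if "y \<in> J" for y
        using Min_le[OF fin that] Max_ge[OF fin that] e by simp
      then have "J \<subseteq> {Min J}" by blast
      then have "card J \<le> 1" using card_mono[of "{Min J}" J] by simp
      then show False using c1 by simp
    qed
    have le: "Min J \<le> Max J" using Min_le[OF fin mem(2)] .
    have lt: "Min J < Max J" "Max J < 7" using c2 le mem assms(2) by auto
    have J: "z \<in> J" if "Min J \<le> z" "z \<le> Max J" for z
    proof (cases "z = Min J \<or> z = Max J")
      case True then show ?thesis using mem by auto
    next
      case False
      then have "Min J < z" "z < Max J" "z < 7" using that lt by auto
      then show ?thesis using assms(1) mem unfolding convx_def by blast
    qed
    have nz: "z \<notin> J" if "z < Min J \<or> Max J < z" for z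
      using that Min_le[OF fin, of z] Max_ge[OF fin, of z] by auto
    have "Min J \<noteq> 0 \<or> Max J \<noteq> 6"
    proof (rule ccontr)
      assume "\<not> (Min J \<noteq> 0 \<or> Max J \<noteq> 6)"
      then have "{..<7} \<subseteq> J" using J by auto
      then show False using nJ assms(2) by auto
    qed
    moreover have m: "Min J \<in> set [0..<7]" "Max J \<in> set [0..<7]" using lt by auto
    ultimately obtain i j z where ij: "i \<in> set [Min J..<Suc (Max J)]" "j \<in> set [Min J..<Suc (Max J)]"
      and z: "z \<in> set [0..<7]" "z < Min J \<or> Max J < z" and b: "blk x ! i < blk x ! z" "blk x ! z < blk x ! j"
      using bspec[OF bspec[OF blk_interval_cut m(1)] m(2)] lt(1) by blast
    have "i \<in> J" "j \<in> J" using ij J by auto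
    moreover have "z \<in> {..<7}" using z(1) by simp
    ultimately have "z \<in> J" using assms(1) b unfolding convx_def by blast
    then show False using nz[OF z(2)] by simp
  qed
qed

section \<open>Reversing a letter\<close>

lemma convx_rev:
  assumes "convx ((!) (rev (blk x))) J {..<7}" "J \<subseteq> {..<7}"
  shows "convx ((!) (blk x)) ((\<lambda>i. 6 - i) ` J) {..<7}"
proof -
  have r: "rev (blk x) ! i = blk x ! (6 - i)" if "i < 7" for i using that by (simp add: rev_nth)
  show ?thesis
    unfolding convx_def
  proof (intro ballI impI)
    fix a b z
    assume a: "a \<in> (\<lambda>i. 6 - i) ` J" and b: "b \<in> (\<lambda>i. 6 - i) ` J" and z: "z \<in> {..<7::nat}"
      and c: "a < z \<and> z < b \<or> blk x ! a < blk x ! z \<and> blk x ! z < blk x ! b"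
    obtain a' b' where ab: "a' \<in> J" "a = 6 - a'" "b' \<in> J" "b = 6 - b'" using a b by auto
    have l: "a' < 7" "b' < 7" "z < 7" using ab assms(2) z by auto
    have "b' < 6 - z \<and> 6 - z < a' \<or> rev (blk x) ! a' < rev (blk x) ! (6 - z) \<and> rev (blk x) ! (6 - z) < rev (blk x) ! b'"
      using c l r[of a'] r[of b'] r[of "6 - z"] unfolding ab(2,4) by (auto simp: less_diff_conv)
    moreover have "6 - z \<in> {..<7}" by simp
    ultimately have "6 - z \<in> J" using assms(1) ab(1,3) unfolding convx_def by blast
    then show "z \<in> (\<lambda>i. 6 - i) ` J" using l by (intro image_eqI[of _ _ "6 - z"]) auto
  qed
qed

lemma blk_rev_simple:
  assumes "convx ((!) (rev (blk x))) J {..<7}" "J \<subseteq> {..<7}"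
  shows "card J \<le> 1 \<or> J = {..<7}"
proof -
  have inj: "inj_on (\<lambda>i. 6 - i) J"
  proof (rule inj_onI)
    fix a b assume "a \<in> J" "b \<in> J" "6 - a = 6 - b"
    moreover from this have "a < 7" "b < 7" using assms(2) by auto
    ultimately show "a = b" by simp
  qed
  have sub: "(\<lambda>i. 6 - i) ` J \<subseteq> {..<7::nat}" by auto
  have "card ((\<lambda>i. 6 - i) ` J) \<le> 1 \<or> (\<lambda>i. 6 - i) ` J = {..<7}"
    using blk_simple[OF convx_rev[OF assms] sub] .
  moreover have "card ((\<lambda>i. 6 - i) ` J) = card J" by (rule card_image[OF inj])
  moreover have "J = {..<7}" if "card J = card {..<7::nat}"
    using card_subset_eq[OF _ assms(2) that] by simp
  ultimately show ?thesis by auto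
qed

text \<open>Convexity pulls back along the increasing enumeration of \<open>A\<close> to the seven
  indices of the word.\<close>

lemma letter_simple:
  assumes "letter v A x" "K \<subseteq> A" "convx v K A"
  shows "card K \<le> 1 \<or> K = A"
proof -
  obtain \<beta> where \<beta>: "pat v A \<beta>" "\<beta> = blk x \<or> \<beta> = rev (blk x)"
    using assms(1) unfolding letter_def by blast
  have len: "length \<beta> = 7" using \<beta>(2) by auto
  obtain f where f: "strict_mono_on {..<7} f" "A = f ` {..<7}"
     "\<forall>i<7. \<forall>j<7. v (f i) < v (f j) \<longleftrightarrow> \<beta> ! i < \<beta> ! j"
    using \<beta>(1) unfolding pat_def len by blast
  define J where "J = {i. i < 7 \<and> f i \<in> K}"
  have J: "J \<subseteq> {..<7}" by (auto simp: J_def)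
  have K: "K = f ` J" using assms(2) unfolding f(2) J_def by auto
  have "convx ((!) \<beta>) J {..<7}"
    unfolding convx_def
  proof (intro ballI impI)
    fix a b z assume a: "a \<in> J" "b \<in> J" "z \<in> {..<7::nat}" and c: "a < z \<and> z < b \<or> \<beta> ! a < \<beta> ! z \<and> \<beta> ! z < \<beta> ! b"
    then have l: "a < 7" "b < 7" "z < 7" "f a \<in> K" "f b \<in> K" by (auto simp: J_def)
    have "f a < f z \<and> f z < f b \<or> v (f a) < v (f z) \<and> v (f z) < v (f b)"
      using c l f(1,3) by (auto simp: strict_mono_on_def)
    moreover have "f z \<in> A" using l f(2) by auto
    ultimately have "f z \<in> K" using assms(3) l unfolding convx_def by blast
    then show "z \<in> J" using l by (auto simp: J_def)
  qed
  then have "card J \<le> 1 \<or> J = {..<7}"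
    using \<beta>(2) blk_simple blk_rev_simple J by blast
  moreover have "card K \<le> card J" unfolding K using J finite_subset card_image_le by blast
  ultimately show ?thesis using K f(2) by auto
qed

definition solid :: "nat set \<Rightarrow> (nat \<Rightarrow> nat) \<Rightarrow> bool" where
  "solid X v \<longleftrightarrow> (\<forall>A x. A \<subseteq> X \<longrightarrow> letter v A x \<longrightarrow> convx v A X)"

text \<open>By simplicity, two overlapping letters share either everything or a single point
  \<open>z\<close>. In the second case removing \<open>z\<close> from \<open>A\<close> would leave
  an interval of six points in a simple letter.\<close>

lemma letters_disjoint:
  assumes "solid X v" "inj_on v X" "A \<subseteq> X" "B \<subseteq> X" "letter v A x" "letter v B y" "A \<inter> B \<noteq> {}"
  shows "A = B"
proof (rule ccontr)
  assume ne: "A \<noteq> B"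
  have cA: "convx v A X" and cB: "convx v B X" using assms unfolding solid_def by blast+
  have card: "card A = 7" "card B = 7" "finite A" "finite B" using letter_card assms by blast+
  have "convx v (A \<inter> B) B" using cA assms(4) unfolding convx_def by blast
  then have "card (A \<inter> B) \<le> 1 \<or> A \<inter> B = B" using letter_simple[OF assms(6)] by blast
  moreover have "A \<inter> B \<noteq> B"
  proof
    assume "A \<inter> B = B"
    then have "B \<subseteq> A" by blast
    then have "B = A" using card card_subset_eq by metis
    then show False using ne by simp
  qed
  ultimately have "card (A \<inter> B) = 1" using assms(7) card by (metis card_0_eq finite_Int le_antisym less_one not_le)
  then obtain z where z: "A \<inter> B = {z}" using card_1_singletonE by blast
  have "\<exists>u\<in>B. u \<noteq> z"
  proof (rule ccontr)
    assume "\<not> ?thesis" then have "B \<subseteq> {z}" by blast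
    then show False using card card_mono[of "{z}" B] by simp
  qed
  then obtain u where u: "u \<in> B" "u \<noteq> z" by blast
  have uA: "u \<notin> A" using u z by blast
  have zz: "z \<in> A" "z \<in> B" "z \<in> X" "u \<in> X" using z u assms by blast+
  \<comment> \<open>If \<open>z\<close> lay between \<open>a\<close> and \<open>b\<close>, so would
    \<open>u\<close>, because \<open>B\<close> is an interval and avoids \<open>a\<close> and
    \<open>b\<close>; but \<open>A\<close> is an interval that does not contain
    \<open>u\<close>.\<close>
  have "convx v (A - {z}) A"
    unfolding convx_def
  proof (intro ballI impI)
    fix a b w assume a: "a \<in> A - {z}" and b: "b \<in> A - {z}" and w: "w \<in> A"
      and c: "a < w \<and> w < b \<or> v a < v w \<and> v w < v b"
    have X: "a \<in> X" "b \<in> X" using a b assms by blast+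
    have nB: "a \<notin> B" "b \<notin> B" using a b z by blast+
    show "w \<in> A - {z}"
    proof (rule ccontr)
      assume "w \<notin> A - {z}"
      then have wz: "w = z" using w by simp
      have vne: "v u \<noteq> v a" "v u \<noteq> v b" using assms(2) X zz nB u inj_on_eq_iff[OF assms(2)] by metis+
      have pne: "u \<noteq> a" "u \<noteq> b" using nB u by auto
      have nb: "\<not> (p < a \<and> a < q)" "\<not> (v p < v a \<and> v a < v q)" "\<not> (p < b \<and> b < q)" "\<not> (v p < v b \<and> v b < v q)"
        if "p \<in> B" "q \<in> B" for p q
        using cB that X nB unfolding convx_def by blast+
      have na: "\<not> (a < u \<and> u < b)" "\<not> (v a < v u \<and> v u < v b)" using cA a b uA zz unfolding convx_def by blast+
      from c show False
      proof
        assume c: "a < w \<and> w < b"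
        then have "\<not> u < a" "\<not> b < u" using nb[OF u(1) zz(2)] nb[OF zz(2) u(1)] wz by blast+
        then show False using na(1) pne by simp
      next
        assume c: "v a < v w \<and> v w < v b"
        then have "\<not> v u < v a" "\<not> v b < v u" using nb[OF u(1) zz(2)] nb[OF zz(2) u(1)] wz by blast+
        then show False using na(2) vne by simp
      qed
    qed
  qed
  then have "card (A - {z}) \<le> 1 \<or> A - {z} = A" using letter_simple[OF assms(5)] by blast
  moreover have "card (A - {z}) = 6" using card zz by simp
  ultimately show False using zz by auto
qed

section \<open>Configurations of points and letters\<close>

text \<open>A configuration (type \<open>rule\<close>) lists points and letters, where an item \<open>Lt L\<close> is a letter, primed or not, with label in
  \<open>L\<close>. The constraints \<open>H i j\<close>, \<open>V i j\<close> and \<open>D i j\<close> say that item \<open>i\<close> is to the left of, below, and disjoint from item \<open>j\<close>.\<close>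

datatype item = Pt | Lt "lab set"
datatype con = H nat nat | V nat nat | D nat nat
type_synonym rule = "item list \<times> con list"

fun item_ok :: "nat set \<Rightarrow> (nat \<Rightarrow> nat) \<Rightarrow> item \<Rightarrow> nat set \<Rightarrow> bool" where
  "item_ok X v Pt B \<longleftrightarrow> (\<exists>z\<in>X. B = {z})"
| "item_ok X v (Lt L) B \<longleftrightarrow> B \<subseteq> X \<and> (\<exists>x\<in>L. letter v B x)"

fun holds :: "(nat \<Rightarrow> nat) \<Rightarrow> nat set list \<Rightarrow> con \<Rightarrow> bool" where
  "holds v Bs (H i j) \<longleftrightarrow> (\<forall>a\<in>Bs ! i. \<forall>b\<in>Bs ! j. a < b)"
| "holds v Bs (V i j) \<longleftrightarrow> (\<forall>a\<in>Bs ! i. \<forall>b\<in>Bs ! j. v a < v b)"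
| "holds v Bs (D i j) \<longleftrightarrow> Bs ! i \<inter> Bs ! j = {}"

definition matches :: "nat set \<Rightarrow> (nat \<Rightarrow> nat) \<Rightarrow> rule \<Rightarrow> nat set list \<Rightarrow> bool" where
  "matches X v R Bs \<longleftrightarrow> list_all2 (item_ok X v) (fst R) Bs \<and> (\<forall>c\<in>set (snd R). holds v Bs c)"

fun con_wf :: "nat \<Rightarrow> con \<Rightarrow> bool" where
  "con_wf n (H i j) \<longleftrightarrow> i < n \<and> j < n"
| "con_wf n (V i j) \<longleftrightarrow> i < n \<and> j < n"
| "con_wf n (D i j) \<longleftrightarrow> i < n \<and> j < n"

text \<open>Reversing a letter swaps its points, so two points may be compared horizontally only if some letter
  between them vertically keeps them from belonging to the same letter.\<close>

fun separated :: "rule \<Rightarrow> con \<Rightarrow> bool" where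
  "separated R (H i j) \<longleftrightarrow> fst R ! i \<noteq> Pt \<or> fst R ! j \<noteq> Pt \<or>
     (\<exists>k<length (fst R). fst R ! k \<noteq> Pt \<and> V i k \<in> set (snd R) \<and> V k j \<in> set (snd R)) \<or>
     (\<exists>k<length (fst R). fst R ! k \<noteq> Pt \<and> V j k \<in> set (snd R) \<and> V k i \<in> set (snd R))"
| "separated R _ \<longleftrightarrow> True"

text \<open>The bound 8 caps a configuration at 8 * 7 = 56 points.\<close>

definition rule_wf :: "rule \<Rightarrow> bool" where
  "rule_wf R \<longleftrightarrow> length (fst R) \<le> 8 \<and> (\<forall>c\<in>set (snd R). con_wf (length (fst R)) c \<and> separated R c)"

text \<open>An abstract reversal \<psi> of one letter \<open>A\<close>; \<open>reflect\<close> will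
  be the concrete one. The reversed values satisfy the same assumptions (\<open>flip'\<close>), so
  every preservation statement proved here also yields its converse.\<close>

locale flip =
  fixes X :: "nat set" and v :: "nat \<Rightarrow> nat" and A :: "nat set" and x :: lab and \<psi> :: "nat \<Rightarrow> nat"
  assumes inj: "inj_on v X" and AX: "A \<subseteq> X" and lett: "letter v A x" and sol: "solid X v"
    and inv: "\<psi> (\<psi> z) = z" and fixd: "z \<notin> A \<Longrightarrow> \<psi> z = z" and mapA: "z \<in> A \<Longrightarrow> \<psi> z \<in> A"
    and anti: "y \<in> A \<Longrightarrow> z \<in> A \<Longrightarrow> y < z \<Longrightarrow> \<psi> z < \<psi> y"
begin

definition "v' = v \<circ> \<psi>"

lemma psiA [simp]: "\<psi> z \<in> A \<longleftrightarrow> z \<in> A"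
  using mapA[of z] mapA[of "\<psi> z"] inv[of z] by auto

lemma psiX [simp]: "\<psi> z \<in> X \<longleftrightarrow> z \<in> X"
proof (cases "z \<in> A")
  case True then show ?thesis using AX psiA by blast
next
  case False then show ?thesis using fixd by simp
qed

lemma psi_inj: "\<psi> y = \<psi> z \<longleftrightarrow> y = z"
  by (metis inv)

lemma psi_img: "B \<inter> A = {} \<Longrightarrow> \<psi> ` B = B"
  using fixd by force

lemma psi_imgA: "\<psi> ` A = A"
proof -
  have "z \<in> \<psi> ` A" if "z \<in> A" for z using that inv[of z] by (intro image_eqI[of _ _ "\<psi> z"]) auto
  then show ?thesis by auto
qed

lemma v'_psi [simp]: "v' (\<psi> z) = v z"
  by (simp add: v'_def inv)

lemma v'_away: "B \<inter> A = {} \<Longrightarrow> z \<in> B \<Longrightarrow> v' z = v z"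
  using fixd[of z] by (auto simp: v'_def disjoint_iff)

lemma convA: "convx v A X"
  using sol AX lett unfolding solid_def by blast

text \<open>A point outside the interval \<open>A\<close> lies on the same side of all of
  \<open>A\<close>, so moving points within \<open>A\<close> does not affect its order.\<close>

lemma order_psi:
  assumes "y \<in> X" "z \<in> X" "y < z" "\<not> (y \<in> A \<and> z \<in> A)"
  shows "\<psi> y < \<psi> z"
proof (cases "y \<in> A")
  case True
  then have z: "z \<notin> A" "\<psi> z = z" using assms fixd by auto
  have "\<psi> y \<in> A" using True by simp
  then have "\<not> z < \<psi> y" using convA True z assms unfolding convx_def by blast
  moreover have "\<psi> y \<noteq> z" using z True by auto
  ultimately show ?thesis using z by simp
next
  case False
  then have y: "\<psi> y = y" using fixd by auto
  show ?thesis
  proof (cases "z \<in> A")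
    case True
    have "\<psi> z \<in> A" using True by simp
    then have "\<not> \<psi> z < y" using convA True False assms unfolding convx_def by blast
    moreover have "\<psi> z \<noteq> y" using False True by auto
    ultimately show ?thesis using y by simp
  next
    case False then show ?thesis using fixd y assms by simp
  qed
qed

lemma pat_flip: "pat v A \<beta> \<Longrightarrow> pat v' A (rev \<beta>)"
  using pat_image_rev[of v A \<beta> \<psi> v'] anti psi_imgA by simp

lemma pat_away: "B \<inter> A = {} \<Longrightarrow> pat v' B \<beta> \<longleftrightarrow> pat v B \<beta>"
  using pat_image[of v' B \<beta> "\<lambda>z. z" v] pat_image[of v B \<beta> "\<lambda>z. z" v'] v'_away[of B] by auto

lemma letter_away: "B \<inter> A = {} \<Longrightarrow> letter v' B y \<longleftrightarrow> letter v B y"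
  unfolding letter_def using pat_away by blast

lemma letter_flip: "letter v' A x"
  using lett pat_flip[of "blk x"] pat_flip[of "rev (blk x)"] unfolding letter_def by auto

lemma convA': "convx v' A X"
  unfolding convx_def
proof (intro ballI impI)
  fix a b z assume h: "a \<in> A" "b \<in> A" "z \<in> X" "a < z \<and> z < b \<or> v' a < v' z \<and> v' z < v' b"
  show "z \<in> A"
  proof (rule ccontr)
    assume "z \<notin> A"
    then have "v' z = v z" using fixd by (simp add: v'_def)
    then have "a < z \<and> z < b \<or> v (\<psi> a) < v z \<and> v z < v (\<psi> b)" using h by (simp add: v'_def)
    moreover have "\<psi> a \<in> A" "\<psi> b \<in> A" using h by auto
    ultimately have "z \<in> A" using convA h unfolding convx_def by blast
    then show False using \<open>z \<notin> A\<close> by simp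
  qed
qed

text \<open>Reversal creates no letter meeting \<open>A\<close> partially: by simplicity such a
  letter would have just one point in \<open>A\<close>, so \<psi> would carry it to a letter for the
  old values that meets \<open>A\<close>, hence to \<open>A\<close> itself.\<close>

lemma letter_dichotomy:
  assumes B: "B \<subseteq> X" "letter v' B y" shows "B = A \<or> B \<inter> A = {}"
proof -
  have cards: "card A = 7" "card B = 7" "finite A" "finite B" using letter_card lett B by blast+
  have "convx v' (A \<inter> B) B" using convA' B(1) unfolding convx_def by blast
  then have "card (A \<inter> B) \<le> 1 \<or> A \<inter> B = B" using letter_simple[OF B(2)] by blast
  moreover have "B = A" if "A \<inter> B = B"
    using that cards card_subset_eq by (metis inf.cobounded1)
  moreover have "A \<inter> B = {}" if c: "card (A \<inter> B) \<le> 1"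
  proof (rule ccontr)
    assume ne: "A \<inter> B \<noteq> {}"
    have one: "p = q" if "p \<in> B" "q \<in> B" "p \<in> A" "q \<in> A" for p q
      using c card_le_Suc0_iff_eq[of "A \<inter> B"] cards(3) that by auto
    have "pat v (\<psi> ` B) \<beta>" if p: "pat v' B \<beta>" for \<beta>
    proof (rule pat_image[OF p])
      show "\<psi> y < \<psi> z" if "y \<in> B" "z \<in> B" "y < z" for y z
        using order_psi[of y z] one[of y z] that B(1) by auto
    qed (simp add: v'_def)
    then have "letter v (\<psi> ` B) y" using B(2) unfolding letter_def by blast
    moreover have "\<psi> ` B \<subseteq> X" using B(1) by auto
    moreover have "\<psi> ` B \<inter> A \<noteq> {}" using ne by auto
    ultimately have "\<psi> ` B = A" using letters_disjoint[OF sol inj _ AX _ lett] by blast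
    then have "B \<subseteq> A" using psiA by blast
    then have "A \<inter> B = B" by blast
    then show False using c cards by simp
  qed
  ultimately show ?thesis by blast
qed

lemma inj': "inj_on v' X"
proof (rule inj_onI)
  fix y z assume "y \<in> X" "z \<in> X" "v' y = v' z"
  then have "\<psi> y = \<psi> z" using inj_onD[OF inj, of "\<psi> y" "\<psi> z"] by (simp add: v'_def)
  then show "y = z" using psi_inj by simp
qed

lemma solid': "solid X v'"
  unfolding solid_def
proof (intro allI impI)
  fix B y assume B: "B \<subseteq> X" "letter v' B y"
  show "convx v' B X"
  proof (cases "B = A")
    case True then show ?thesis using convA' by simp
  next
    case False
    then have d: "B \<inter> A = {}" using letter_dichotomy B by blast
    then have c: "convx v B X" using B letter_away sol unfolding solid_def by blast
    have e: "v' z = v z" if "z \<in> B" for z using v'_away[OF d that] .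
    show ?thesis
      unfolding convx_def
    proof (intro ballI impI)
      fix a b z assume h: "a \<in> B" "b \<in> B" "z \<in> X" "a < z \<and> z < b \<or> v' a < v' z \<and> v' z < v' b"
      then consider "a < z \<and> z < b" | "v a < v (\<psi> z) \<and> v (\<psi> z) < v b" using e by (auto simp: v'_def)
      then show "z \<in> B"
      proof cases
        case 1 then show ?thesis using c h unfolding convx_def by blast
      next
        case 2
        \<comment> \<open>The new value at \<open>z\<close> is the old value at
          \<open>\<psi> z\<close>. Once \<open>\<psi> z\<close> is known to lie in \<open>B\<close>,
          it lies outside \<open>A\<close> and therefore equals \<open>z\<close>.\<close>
        have "\<psi> z \<in> B" using c h 2 psiX[of z] unfolding convx_def by blast
        then have "z \<notin> A" using d psiA[of z] by blast
        then show ?thesis using \<open>\<psi> z \<in> B\<close> fixd by simp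
      qed
    qed
  qed
qed

lemma flip': "flip X v' A x \<psi>"
  using inj' AX letter_flip solid' inv fixd mapA anti by unfold_locales auto

lemma flip_flip: "flip.v' v' \<psi> = v"
  unfolding flip.v'_def[OF flip'] unfolding v'_def by (rule ext) (simp add: inv)

lemma letter_keep:
  assumes "B \<subseteq> X" "letter v B y" shows "letter v' B y" "\<psi> ` B = B"
proof -
  have *: "B = A \<or> B \<inter> A = {}"
    using letters_disjoint[OF sol inj assms(1) AX assms(2) lett] by blast
  then show "\<psi> ` B = B" using psi_img psi_imgA by blast
  show "letter v' B y"
  proof (cases "B = A")
    case True
    then have "y = x" using assms(2) lett letter_label by blast
    then show ?thesis using letter_flip True by simp
  next
    case False then show ?thesis using * assms letter_away by blast
  qed
qed

lemma item_keep: "item_ok X v it B \<Longrightarrow> item_ok X v' it (\<psi> ` B)"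
proof (cases it)
  case Pt assume "item_ok X v it B" then show ?thesis using Pt by auto
next
  case (Lt L)
  assume "item_ok X v it B"
  then obtain y where y: "B \<subseteq> X" "y \<in> L" "letter v B y" using Lt by auto
  then show ?thesis using letter_keep[OF y(1,3)] Lt by auto
qed

text \<open>The image of a match under \<psi> is a match: letters are mapped onto themselves, and
  vertical relations are transported exactly since \<open>v' (\<psi> z) = v z\<close>. Only
  horizontal relations between two points of \<open>A\<close> are at risk.\<close>

lemma matches_keep:
  assumes "matches X v R Bs" "rule_wf R"
  shows "matches X v' R (map ((`) \<psi>) Bs)"
proof -
  have l2: "list_all2 (item_ok X v) (fst R) Bs" and hs: "\<And>c. c \<in> set (snd R) \<Longrightarrow> holds v Bs c"
    using assms(1) unfolding matches_def by auto
  have len: "length Bs = length (fst R)" using l2 list_all2_lengthD by fastforce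
  have ok: "item_ok X v (fst R ! i) (Bs ! i)" if "i < length Bs" for i
    using l2 that len list_all2_nthD by metis
  have sub: "Bs ! i \<subseteq> X" if "i < length Bs" for i using ok[OF that] by (cases "fst R ! i") auto
  have whole: "Bs ! i = A" if w: "i < length Bs" "fst R ! i \<noteq> Pt" "a \<in> Bs ! i" "a \<in> A" for i a
  proof -
    obtain y where "letter v (Bs ! i) y" using ok[OF w(1)] w(2) by (cases "fst R ! i") auto
    then show ?thesis using letters_disjoint[OF sol inj sub[OF that(1)] AX _ lett] that by blast
  qed
  have "list_all2 (item_ok X v') (fst R) (map ((`) \<psi>) Bs)"
    using l2 item_keep by (auto simp: list_all2_conv_all_nth)
  moreover have "holds v' (map ((`) \<psi>) Bs) c" if c: "c \<in> set (snd R)" for c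
  proof -
    have wf: "con_wf (length Bs) c" and se: "separated R c" using assms(2) c len unfolding rule_wf_def by auto
    show ?thesis
    proof (cases c)
      case (H i j)
      have ij: "i < length Bs" "j < length Bs" using wf H by auto
      have h: "a < b" if "a \<in> Bs ! i" "b \<in> Bs ! j" for a b using hs[OF c] H that by auto
      have "\<psi> a < \<psi> b" if ab: "a \<in> Bs ! i" "b \<in> Bs ! j" for a b
      proof -
        have "\<not> (a \<in> A \<and> b \<in> A)"
        proof
          assume aA: "a \<in> A \<and> b \<in> A"
          \<comment> \<open>If one of the two items were a letter, it would be all of
            \<open>A\<close>, and the strict relation would compare a point with itself.\<close>
          have p1: "fst R ! i = Pt"
            using whole[OF ij(1) _ ab(1)] h[of b b] ab aA by fastforce
          have p2: "fst R ! j = Pt"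
            using whole[OF ij(2) _ ab(2)] h[of a a] ab aA by fastforce
          \<comment> \<open>A letter vertically between two points of \<open>A\<close> has points in
            the interval \<open>A\<close>, hence equals \<open>A\<close>, and would lie above one of
            its own points.\<close>
          have key: False if k: "k < length Bs" "fst R ! k \<noteq> Pt" "V i' k \<in> set (snd R)" "V k j' \<in> set (snd R)"
            "i' < length Bs" "j' < length Bs" and a': "a' \<in> Bs ! i'" "b' \<in> Bs ! j'" "a' \<in> A" "b' \<in> A" for i' j' k a' b'
          proof -
            obtain y where y: "letter v (Bs ! k) y" using ok[OF k(1)] k(2) by (cases "fst R ! k") auto
            then obtain e where e: "e \<in> Bs ! k" using letter_nonempty by blast
            have "v a' < v e" "v e < v b'" using hs[OF k(3)] hs[OF k(4)] a' e by auto
            moreover have "e \<in> X" using e sub[OF k(1)] by blast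
            ultimately have "e \<in> A" using convA a' unfolding convx_def by blast
            then have "Bs ! k = A" using whole[OF k(1,2) e] by blast
            then have "v a' < v a'" using hs[OF k(3)] a' by auto
            then show False by simp
          qed
          show False using se H p1 p2 key[of _ i j a b] key[of _ j i b a] ij ab aA len by auto
        qed
        then show ?thesis using order_psi[of a b] h[OF ab] ab sub ij by blast
      qed
      then show ?thesis using H ij by auto
    next
      case (V i j)
      then show ?thesis using wf hs[OF c] by auto
    next
      case (D i j)
      then show ?thesis using wf hs[OF c] psi_inj by auto
    qed
  qed
  ultimately show ?thesis unfolding matches_def by blast
qed

end

section \<open>The forbidden configurations\<close>

abbreviation (input) "Any \<equiv> Lt UNIV"

text \<open>Since no point may lie to the right of and below three letters (second rule), a point \<open>k\<close> to the right of and
  below the letters \<open>i\<close> and \<open>j\<close> certifies that these are consecutive.\<close>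

definition adj :: "nat \<Rightarrow> nat \<Rightarrow> nat \<Rightarrow> con list" where
  "adj i j k = [H i j, H j k, V k i]"

text \<open>Entries 1, 3 and 4 arrange the letters, and entry 2 makes linkers certify adjacency.
  Entries 6 to 12 and 14 leave at most one linker and one pointer per gap, with increasing pointers
  in distinct rows below the last letter. Entries 5, 13 and 15 to 17 govern the labels. Entries 18
  and 19 fix the order of a linker and a pointer that share a column or a row, so that no freedom
  remains.\<close>

definition rules :: "rule list" where
  "rules = [
    ([Any, Any], [H 0 1, V 1 0]),
    ([Any, Any, Any, Pt], [H 0 1, H 1 2, H 2 3, V 3 0]),
    ([Any, Lt {LP}], [H 0 1]),
    ([Lt {LQ}, Any], [H 0 1]),
    ([Lt {LP, LS}, Lt {LS, LQ}, Pt], adj 0 1 2),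
    ([Any, Any, Pt, Pt, Pt], adj 0 1 2 @ [H 0 3, H 3 1, V 3 0, H 0 4, H 4 1, V 4 0, D 3 4]),
    ([Lt {LP}, Pt, Pt], [V 1 0, V 2 0, D 1 2]),
    ([Lt {LQ}, Pt, Pt], [H 0 1, H 0 2, D 1 2]),
    ([Any, Any, Pt, Pt], adj 0 1 2 @ [H 0 3, H 3 1, V 0 3, V 3 1]),
    ([Lt {LP}, Pt], [H 1 0]),
    ([Any, Any, Pt, Pt, Pt], adj 0 1 2 @ [H 0 3, H 3 1, V 1 3, H 0 4, H 4 1, V 1 4, D 3 4]),
    ([Pt, Any, Pt, Any], [H 0 1, H 1 2, H 2 3, V 2 0, V 3 2]),
    ([Any, Lt {LS, LQ}, Pt, Pt], adj 0 1 2 @ [H 3 0, V 0 3, V 3 1]),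
    ([Any, Any, Pt, Pt, Pt], adj 0 1 2 @ [H 3 0, V 0 3, V 3 1, H 4 0, V 0 4, V 4 1, D 3 4]),
    ([Lt {LP, LS}, Any, Pt, Lt {LN}, Any, Pt, Pt], adj 0 1 2 @ adj 3 4 5 @ [H 0 6, H 6 1, V 3 6, V 6 4, H 6 3]),
    ([Lt {LN}, Any, Pt, Lt {LS}, Any, Pt, Pt], adj 0 1 2 @ adj 3 4 5 @ [H 0 6, H 6 1, V 3 6, V 6 4, H 6 3]),
    ([Any, Lt {LN}, Pt, Any, Pt, Pt, Pt, Lt {LQ}],
       adj 0 1 2 @ adj 1 3 4 @ [H 0 5, H 5 1, V 1 5, V 5 7, H 1 6, H 6 3, V 7 6]),
    ([Any, Any, Pt, Pt, Pt], adj 0 1 2 @ [H 0 4, H 4 3, H 3 1, V 3 0, V 0 4, V 1 4]),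
    ([Any, Any, Pt, Pt, Pt], adj 0 1 2 @ [H 3 0, V 0 3, V 3 1, H 1 4, V 0 4, V 4 1, V 3 4])]"

text \<open>The rules in a list are alternatives, and item 0 is the letter itself. Item 6 is a
  pointer in the row just above the letter; an \<open>LN\<close> followed by \<open>LS\<close> or
  \<open>LQ\<close> is exempt, because no pointer may enter the row just below these.
  \<open>LP\<close> asks for no previous letter and \<open>LQ\<close> for no next one, which lets
  the word begin and end.\<close>

fun need :: "lab \<Rightarrow> rule list" where
  "need LP = [([Lt {LP}, Any, Pt, Pt], adj 0 1 2 @ [H 0 3, H 3 1, V 1 3])]"
| "need LN = [
     ([Lt {LN}, Lt {LS, LQ}, Pt, Pt, Any, Pt], adj 0 1 2 @ [H 0 3, H 3 1, V 1 3] @ adj 4 0 5),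
     ([Lt {LN}, Any, Pt, Pt, Any, Pt, Pt], adj 0 1 2 @ [H 0 3, H 3 1, V 1 3] @ adj 4 0 5 @ [H 6 0, V 0 6, V 6 1])]"
| "need LS = [
     ([Lt {LS}, Any, Pt, Pt, Any, Pt, Pt], adj 0 1 2 @ [H 0 3, H 3 1, V 1 3] @ adj 4 0 5 @ [H 6 0, V 0 6, V 6 1])]"
| "need LQ = [([Lt {LQ}, Any, Pt], adj 1 0 2)]"

lemma rules_wf: "R \<in> set rules \<Longrightarrow> rule_wf R"
proof -
  have "\<forall>R\<in>set rules. rule_wf R" by code_simp
  then show "R \<in> set rules \<Longrightarrow> rule_wf R" by blast
qed

lemma need_wf: "R \<in> set (need x) \<Longrightarrow> rule_wf R"
proof -
  have "\<forall>R\<in>set (need x). rule_wf R" by (induct x; code_simp)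
  then show "R \<in> set (need x) \<Longrightarrow> rule_wf R" by blast
qed

lemma need_item: "R \<in> set (need x) \<Longrightarrow> fst R \<noteq> [] \<and> fst R ! 0 = Lt {x}"
  by (cases x) auto

definition met :: "nat set \<Rightarrow> (nat \<Rightarrow> nat) \<Rightarrow> lab \<Rightarrow> nat set \<Rightarrow> bool" where
  "met X v x A \<longleftrightarrow> (\<exists>R\<in>set (need x). \<exists>Bs. matches X v R Bs \<and> Bs ! 0 = A)"

text \<open>Orientation matters only in the last clause, and only for letters whose need is met; the
  other clauses are blind to reversal.\<close>

definition good :: "nat set \<Rightarrow> (nat \<Rightarrow> nat) \<Rightarrow> bool" where
  "good X v \<longleftrightarrow> solid X v \<and> (\<forall>R\<in>set rules. \<forall>Bs. \<not> matches X v R Bs) \<and>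
     (\<forall>A x. A \<subseteq> X \<longrightarrow> pat v A (rev (blk x)) \<longrightarrow> \<not> met X v x A)"

definition unmet :: "nat set \<Rightarrow> (nat \<Rightarrow> nat) \<Rightarrow> nat set set" where
  "unmet X v = {A. A \<subseteq> X \<and> (\<exists>x. letter v A x \<and> \<not> met X v x A)}"

lemma met_letter: "met X v x A \<Longrightarrow> A \<subseteq> X \<and> letter v A x"
proof -
  assume "met X v x A"
  then obtain R Bs where R: "R \<in> set (need x)" "list_all2 (item_ok X v) (fst R) Bs" "Bs ! 0 = A"
    unfolding met_def matches_def by blast
  from need_item[OF R(1)] have "item_ok X v (fst R ! 0) (Bs ! 0)" using list_all2_nthD[OF R(2), of 0] by simp
  then show ?thesis using need_item[OF R(1)] R(3) by simp
qed

context flip begin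

lemma met_keep: "met X v y B \<Longrightarrow> met X v' y B"
proof -
  assume s: "met X v y B"
  then obtain R Bs where R: "R \<in> set (need y)" "matches X v R Bs" "Bs ! 0 = B"
    unfolding met_def by blast
  have "Bs \<noteq> []" using R(2) need_item[OF R(1)] unfolding matches_def by auto
  moreover have "\<psi> ` B = B" using letter_keep(2) met_letter[OF s] by blast
  ultimately have "map ((`) \<psi>) Bs ! 0 = B" using R(3) by simp
  then show ?thesis using matches_keep[OF R(2) need_wf[OF R(1)]] R(1) unfolding met_def by blast
qed

lemma met_iff: "met X v' y B \<longleftrightarrow> met X v y B"
  using met_keep flip.met_keep[OF flip', of y B] unfolding flip_flip by blast

lemma letter_iff: "B \<subseteq> X \<Longrightarrow> letter v' B y \<longleftrightarrow> letter v B y"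
  using letter_keep(1) flip.letter_keep(1)[OF flip', of B y] unfolding flip_flip by blast

text \<open>This makes the cancellation an involution: a letter chosen from the set of unmet letters
  is the same before and after its reversal.\<close>

lemma unmet_eq: "unmet X v' = unmet X v"
  unfolding unmet_def using met_iff letter_iff by blast

lemma good_flip: "good X v \<Longrightarrow> \<not> met X v x A \<Longrightarrow> good X v'"
proof -
  assume g: "good X v" and ns: "\<not> met X v x A"
  have "\<not> matches X v' R Bs" if "R \<in> set rules" for R Bs
    using flip.matches_keep[OF flip', of R Bs] rules_wf[OF that] g that unfolding flip_flip good_def by blast
  moreover have "\<not> met X v' y B" if B: "B \<subseteq> X" "pat v' B (rev (blk y))" for B y
  proof
    assume s: "met X v' y B"
    have l: "letter v' B y" using B(2) unfolding letter_def by blast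
    show False
    proof (cases "B = A")
      case True
      then have "letter v A y" using l letter_iff AX by blast
      then have "y = x" using lett letter_label by blast
      then show False using s ns met_iff True by blast
    next
      case False
      then have "pat v B (rev (blk y))" using letter_dichotomy[OF B(1) l] pat_away B(2) by blast
      then show False using g B(1) s met_iff unfolding good_def by blast
    qed
  qed
  ultimately show ?thesis using solid' unfolding good_def by blast
qed

text \<open>Unchanged values on \<open>A\<close> would give the same set of positions both a word
  and its reversal as patterns.\<close>

lemma flip_ne: "\<exists>z\<in>A. v' z \<noteq> v z"
proof (rule ccontr)
  assume "\<not> ?thesis"
  then have e: "v' z = v z" if "z \<in> A" for z using that by blast
  have tr: "pat v A \<beta>" if "pat v' A \<beta>" for \<beta>
    using pat_image[OF that, of "\<lambda>z. z" v] e by simp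
  show False
    using lett tr pat_flip[of "blk x"] pat_flip[of "rev (blk x)"] pat_blk_not_rev
    unfolding letter_def by (metis rev_rev_ident)
qed

end

section \<open>Order embeddings and heredity of goodness\<close>

definition emb :: "nat set \<Rightarrow> (nat \<Rightarrow> nat) \<Rightarrow> nat set \<Rightarrow> (nat \<Rightarrow> nat) \<Rightarrow> (nat \<Rightarrow> nat) \<Rightarrow> bool" where
  "emb X v X' v' h \<longleftrightarrow> strict_mono_on X h \<and> h ` X \<subseteq> X' \<and> (\<forall>a\<in>X. \<forall>b\<in>X. v' (h a) < v' (h b) \<longleftrightarrow> v a < v b)"

lemma emb_pat:
  assumes "emb X v X' v' h" "A \<subseteq> X" "pat v A \<beta>"
  shows "pat v' (h ` A) \<beta>"
proof (rule pat_image[OF assms(3)])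
  fix y z assume "y \<in> A" "z \<in> A"
  then have X: "y \<in> X" "z \<in> X" using assms(2) by auto
  show "v' (h y) < v' (h z) \<longleftrightarrow> v y < v z" using assms(1) X unfolding emb_def by blast
  show "h y < h z" if "y < z" using strict_mono_onD[of X h y z] assms(1) X that unfolding emb_def by blast
qed

lemma emb_letter: "emb X v X' v' h \<Longrightarrow> A \<subseteq> X \<Longrightarrow> letter v A x \<Longrightarrow> letter v' (h ` A) x"
  unfolding letter_def using emb_pat by blast

lemma emb_inj: "emb X v X' v' h \<Longrightarrow> inj_on h X"
  unfolding emb_def using strict_mono_on_imp_inj_on by blast

lemma emb_matches:
  assumes e: "emb X v X' v' h" and m: "matches X v R Bs" and wf: "rule_wf R"
  shows "matches X' v' R (map ((`) h) Bs)"
proof -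
  have l2: "list_all2 (item_ok X v) (fst R) Bs" and hs: "\<And>c. c \<in> set (snd R) \<Longrightarrow> holds v Bs c"
    using m unfolding matches_def by auto
  have len: "length Bs = length (fst R)" using l2 list_all2_lengthD by fastforce
  have h: "strict_mono_on X h" "h ` X \<subseteq> X'" "\<forall>a\<in>X. \<forall>b\<in>X. v' (h a) < v' (h b) \<longleftrightarrow> v a < v b"
    using e unfolding emb_def by auto
  have ok: "item_ok X' v' it (h ` B)" if i: "item_ok X v it B" for it B
  proof (cases it)
    case Pt then show ?thesis using i h(2) by auto
  next
    case (Lt L)
    then obtain x where x: "B \<subseteq> X" "x \<in> L" "letter v B x" using i by auto
    then show ?thesis using emb_letter[OF e x(1,3)] h(2) Lt by auto
  qed
  have sub: "Bs ! i \<subseteq> X" if "i < length Bs" for i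
  proof -
    have "item_ok X v (fst R ! i) (Bs ! i)" using l2 that len list_all2_nthD by metis
    then show ?thesis by (cases "fst R ! i") auto
  qed
  have "list_all2 (item_ok X' v') (fst R) (map ((`) h) Bs)"
    using l2 ok by (auto simp: list_all2_conv_all_nth)
  moreover have "holds v' (map ((`) h) Bs) c" if c: "c \<in> set (snd R)" for c
  proof -
    have w: "con_wf (length Bs) c" using wf c len unfolding rule_wf_def by auto
    show ?thesis
    proof (cases c)
      case (H i j)
      have "h a < h b" if "a \<in> Bs ! i" "b \<in> Bs ! j" for a b
        using hs[OF c] H w sub that strict_mono_onD[OF h(1), of a b] by auto
      then show ?thesis using H w by auto
    next
      case (V i j)
      have "v' (h a) < v' (h b)" if ab: "a \<in> Bs ! i" "b \<in> Bs ! j" for a b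
      proof -
        have "a \<in> X" "b \<in> X" "v a < v b" using V w sub ab hs[OF c] by auto
        then show ?thesis using h(3) by simp
      qed
      then show ?thesis using V w by auto
    next
      case (D i j)
      then have "Bs ! i \<inter> Bs ! j = {}" "Bs ! i \<subseteq> X" "Bs ! j \<subseteq> X" using hs[OF c] w sub by auto
      then have "h ` (Bs ! i) \<inter> h ` (Bs ! j) = {}"
        using inj_on_image_Int[OF emb_inj[OF e], of "Bs ! i" "Bs ! j"] by simp
      then show ?thesis using D w by simp
    qed
  qed
  ultimately show ?thesis unfolding matches_def by blast
qed

lemma emb_met:
  assumes e: "emb X v X' v' h" and s: "met X v x A" shows "met X' v' x (h ` A)"
proof -
  obtain R Bs where R: "R \<in> set (need x)" "matches X v R Bs" "Bs ! 0 = A"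
    using s unfolding met_def by blast
  have "Bs \<noteq> []" using R(2) need_item[OF R(1)] unfolding matches_def by auto
  then have "map ((`) h) Bs ! 0 = h ` A" using R(3) by simp
  then show ?thesis using emb_matches[OF e R(2) need_wf[OF R(1)]] R(1) unfolding met_def by blast
qed

text \<open>A violation is expressed by order relations between its points, and \<open>h\<close>
  carries these along. Hence goodness passes to contained patterns and can be described by
  avoidance.\<close>

lemma emb_good:
  assumes e: "emb X v X' v' h" and g: "good X' v'" shows "good X v"
proof -
  have h: "strict_mono_on X h" "h ` X \<subseteq> X'" "\<forall>a\<in>X. \<forall>b\<in>X. v' (h a) < v' (h b) \<longleftrightarrow> v a < v b"
    using e unfolding emb_def by auto
  have s': "solid X' v'" using g unfolding good_def by blast
  have "convx v A X" if A: "A \<subseteq> X" "letter v A x" for A x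
    unfolding convx_def
  proof (intro ballI impI)
    fix a b z assume abz: "a \<in> A" "b \<in> A" "z \<in> X" and c: "a < z \<and> z < b \<or> v a < v z \<and> v z < v b"
    have X: "a \<in> X" "b \<in> X" using abz A by auto
    have "h ` A \<subseteq> X'" using A(1) h(2) by blast
    then have "convx v' (h ` A) X'" using s' emb_letter[OF e A] unfolding solid_def by blast
    moreover have "h a < h z \<and> h z < h b \<or> v' (h a) < v' (h z) \<and> v' (h z) < v' (h b)"
      using c strict_mono_onD[OF h(1), of a z] strict_mono_onD[OF h(1), of z b] h(3) X abz(3) by auto
    moreover have "h z \<in> X'" using abz h(2) by blast
    ultimately have "h z \<in> h ` A" using abz(1,2) unfolding convx_def by blast
    then show "z \<in> A" using emb_inj[OF e] abz(3) A(1) by (meson inj_on_image_mem_iff)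
  qed
  moreover have "\<not> matches X v R Bs" if "R \<in> set rules" for R Bs
    using emb_matches[OF e _ rules_wf[OF that]] g that unfolding good_def by blast
  moreover have "\<not> met X v x A" if "A \<subseteq> X" "pat v A (rev (blk x))" for A x
  proof
    assume "met X v x A"
    then have "met X' v' x (h ` A)" by (rule emb_met[OF e])
    moreover have "pat v' (h ` A) (rev (blk x))" using emb_pat[OF e that] .
    moreover have "h ` A \<subseteq> X'" using that h(2) by blast
    ultimately show False using g unfolding good_def by blast
  qed
  ultimately show ?thesis unfolding good_def solid_def by blast
qed

lemma matches_local:
  assumes m: "matches X v R Bs" and wf: "rule_wf R"
  shows "matches (\<Union>(set Bs)) v R Bs" "\<Union>(set Bs) \<subseteq> X" "finite (\<Union>(set Bs))" "card (\<Union>(set Bs)) \<le> 56"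
proof -
  have l2: "list_all2 (item_ok X v) (fst R) Bs" using m unfolding matches_def by auto
  have len: "length Bs = length (fst R)" using l2 list_all2_lengthD by fastforce
  have ok: "item_ok X v (fst R ! i) (Bs ! i)" if "i < length Bs" for i
    using l2 that len list_all2_nthD by metis
  have B: "B \<subseteq> X \<and> finite B \<and> card B \<le> 7" if BB: "B \<in> set Bs" for B
  proof -
    obtain i where i: "i < length Bs" "Bs ! i = B" using BB by (metis in_set_conv_nth)
    show ?thesis
    proof (cases "fst R ! i")
      case Pt then show ?thesis using ok[OF i(1)] i(2) by auto
    next
      case (Lt L)
      then obtain y where "B \<subseteq> X" "letter v B y" using ok[OF i(1)] i(2) by auto
      then show ?thesis using letter_card[of v B y] by simp
    qed
  qed
  show "\<Union>(set Bs) \<subseteq> X" "finite (\<Union>(set Bs))" using B by blast+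
  have "card (\<Union>(set Bs)) \<le> sum card (set Bs)" by (rule card_Union_le_sum_card)
  also have "\<dots> \<le> card (set Bs) * 7" using sum_bounded_above[of "set Bs" card 7] B by simp
  also have "\<dots> \<le> length Bs * 7" using card_length by simp
  also have "\<dots> \<le> 56" using wf len unfolding rule_wf_def by simp
  finally show "card (\<Union>(set Bs)) \<le> 56" .
  have "item_ok (\<Union>(set Bs)) v (fst R ! i) (Bs ! i)" if i: "i < length Bs" for i
  proof -
    have sub: "Bs ! i \<subseteq> \<Union>(set Bs)" using nth_mem[OF i] by blast
    show ?thesis
    proof (cases "fst R ! i")
      case Pt
      then obtain z where "Bs ! i = {z}" using ok[OF i] by auto
      then show ?thesis using Pt sub by auto
    next
      case (Lt L) then show ?thesis using ok[OF i] sub by simp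
    qed
  qed
  then show "matches (\<Union>(set Bs)) v R Bs" using m len unfolding matches_def by (simp add: list_all2_conv_all_nth)
qed

text \<open>A violation is already visible on the points that take part in it: eight for a letter
  that is not an interval, at most 56 for a rule or for a reversed letter whose need is met.\<close>

lemma bad_local:
  assumes "\<not> good X v"
  shows "\<exists>Y\<subseteq>X. finite Y \<and> card Y \<le> 80 \<and> \<not> good Y v"
proof -
  consider A x where "A \<subseteq> X" "letter v A x" "\<not> convx v A X"
    | R Bs where "R \<in> set rules" "matches X v R Bs"
    | A x where "A \<subseteq> X" "pat v A (rev (blk x))" "met X v x A"
    using assms unfolding good_def solid_def by blast
  then show ?thesis
  proof cases
    case 1
    then obtain a b z where z: "z \<in> X" "z \<notin> A" "a \<in> A" "b \<in> A" "a < z \<and> z < b \<or> v a < v z \<and> v z < v b"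
      unfolding convx_def by blast
    then have "\<not> convx v A (insert z A)" unfolding convx_def by blast
    moreover have "A \<subseteq> insert z A" by blast
    ultimately have "\<not> solid (insert z A) v" using 1(2) unfolding solid_def by blast
    then have "\<not> good (insert z A) v" unfolding good_def by blast
    moreover have "card (insert z A) \<le> 80" "finite (insert z A)" using letter_card[OF 1(2)] z(2) by auto
    ultimately show ?thesis using 1(1) z(1) by (intro exI[of _ "insert z A"]) simp
  next
    case 2
    note l = matches_local[OF 2(2) rules_wf[OF 2(1)]]
    have "\<not> good (\<Union>(set Bs)) v" using 2(1) l(1) unfolding good_def by blast
    then show ?thesis using l(2-4) by (intro exI[of _ "\<Union>(set Bs)"]) simp
  next
    case 3
    then obtain R Bs where R: "R \<in> set (need x)" "matches X v R Bs" "Bs ! 0 = A" unfolding met_def by blast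
    note l = matches_local[OF R(2) need_wf[OF R(1)]]
    have s: "met (\<Union>(set Bs)) v x A" using R(1,3) l(1) unfolding met_def by blast
    have "A \<subseteq> \<Union>(set Bs)" using met_letter[OF s] by blast
    then have "\<not> good (\<Union>(set Bs)) v" using 3(2) s unfolding good_def by blast
    then show ?thesis using l(2-4) by (intro exI[of _ "\<Union>(set Bs)"]) simp
  qed
qed

section \<open>Counting modulo 2\<close>

text \<open>The values on \<open>Y\<close> are replaced by their ranks \<open>\<rho>\<close>,
  counted from 1 so that they form a permutation in the sense of \<open>is_perm\<close>.\<close>

lemma standardize:
  fixes v :: "nat \<Rightarrow> nat"
  assumes fin: "finite Y" and inj: "inj_on v Y"
  obtains \<omega> idx where "is_perm (card Y) \<omega>" "strict_mono_on {..<card Y} idx" "idx ` {..<card Y} = Y"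
    "\<forall>a<card Y. \<forall>b<card Y. \<omega> ! a < \<omega> ! b \<longleftrightarrow> v (idx a) < v (idx b)"
proof -
  define m where "m = card Y"
  define L where "L = sorted_list_of_set Y"
  have L: "length L = m" "set L = Y" "sorted_wrt (<) L" "distinct L"
    using fin by (auto simp: L_def m_def)
  define idx where "idx = (\<lambda>i. L ! i)"
  have mono: "strict_mono_on {..<m} idx"
    using L(1,3) by (auto simp: strict_mono_on_def idx_def sorted_wrt_iff_nth_less)
  have im: "idx ` {..<m} = Y"
    using L(1,2) unfolding idx_def by (metis lessThan_atLeast0 list.set_map map_nth set_upt)
  define \<rho> where "\<rho> = (\<lambda>y. card {z\<in>Y. v z \<le> v y})"
  have lt: "\<rho> y < \<rho> z" if "y \<in> Y" "z \<in> Y" "v y < v z" for y z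
    unfolding \<rho>_def
  proof (rule psubset_card_mono)
    show "finite {w\<in>Y. v w \<le> v z}" using fin by simp
    show "{w\<in>Y. v w \<le> v y} \<subset> {w\<in>Y. v w \<le> v z}"
    proof
      show "{w\<in>Y. v w \<le> v y} \<subseteq> {w\<in>Y. v w \<le> v z}" using that(3) by auto
      have "z \<in> {w\<in>Y. v w \<le> v z}" "z \<notin> {w\<in>Y. v w \<le> v y}" using that by auto
      then show "{w\<in>Y. v w \<le> v y} \<noteq> {w\<in>Y. v w \<le> v z}" by blast
    qed
  qed
  have iff: "\<rho> y < \<rho> z \<longleftrightarrow> v y < v z" if "y \<in> Y" "z \<in> Y" for y z
    using lt[OF that] lt[OF that(2,1)] inj_onD[OF inj, of y z] that
    by (metis less_asym less_irrefl linorder_neqE_nat)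
  define \<omega> where "\<omega> = map (\<lambda>i. \<rho> (idx i)) [0..<m]"
  have inj': "inj_on (\<lambda>i. \<rho> (idx i)) {..<m}"
  proof (rule inj_onI)
    fix i j assume ij: "i \<in> {..<m}" "j \<in> {..<m}" "\<rho> (idx i) = \<rho> (idx j)"
    have "idx i \<in> Y" "idx j \<in> Y" using ij im by auto
    then have "v (idx i) = v (idx j)" using iff ij(3) by (metis less_irrefl linorder_neqE_nat)
    then have "idx i = idx j" using inj \<open>idx i \<in> Y\<close> \<open>idx j \<in> Y\<close> by (simp add: inj_on_eq_iff)
    then show "i = j" using strict_mono_on_imp_inj_on[OF mono] ij by (simp add: inj_on_eq_iff)
  qed
  have sub: "(\<lambda>i. \<rho> (idx i)) ` {..<m} \<subseteq> {1..m}"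
  proof
    fix r assume "r \<in> (\<lambda>i. \<rho> (idx i)) ` {..<m}"
    then obtain y where y: "y \<in> Y" "r = \<rho> y" using im by auto
    have "y \<in> {z\<in>Y. v z \<le> v y}" using y by simp
    then have "0 < r" using fin unfolding y(2) \<rho>_def by (auto simp: card_gt_0_iff)
    moreover have "r \<le> m" using fin unfolding y(2) \<rho>_def m_def by (auto intro: card_mono)
    ultimately show "r \<in> {1..m}" by simp
  qed
  have "(\<lambda>i. \<rho> (idx i)) ` {..<m} = {1..m}"
    by (rule card_subset_eq[OF _ sub]) (use card_image[OF inj'] in auto)
  then have "is_perm m \<omega>"
    unfolding is_perm_def \<omega>_def using inj' by (auto simp: distinct_map atLeast0LessThan)
  moreover have "\<forall>a<m. \<forall>b<m. \<omega> ! a < \<omega> ! b \<longleftrightarrow> v (idx a) < v (idx b)"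
    using iff im unfolding \<omega>_def by auto
  ultimately show thesis using that mono im unfolding m_def by blast
qed

lemma emb_inverse:
  assumes "emb X v X' v' h" "h ` X = X'"
  shows "emb X' v' X v (inv_into X h)"
proof -
  have inj: "inj_on h X" using emb_inj[OF assms(1)] .
  have h: "strict_mono_on X h" "\<forall>a\<in>X. \<forall>b\<in>X. v' (h a) < v' (h b) \<longleftrightarrow> v a < v b"
    using assms(1) unfolding emb_def by auto
  have iX: "inv_into X h a \<in> X" "h (inv_into X h a) = a" if "a \<in> X'" for a
    using that assms(2) by (auto simp: inv_into_into f_inv_into_f)
  have "strict_mono_on X' (inv_into X h)"
  proof (rule strict_mono_onI)
    fix a b assume ab: "a \<in> X'" "b \<in> X'" "a < b"
    show "inv_into X h a < inv_into X h b"
      using strict_mono_on_less[OF h(1) iX(1)[OF ab(1)] iX(1)[OF ab(2)]] iX(2) ab by simp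
  qed
  moreover have "v (inv_into X h a) < v (inv_into X h b) \<longleftrightarrow> v' a < v' b" if "a \<in> X'" "b \<in> X'" for a b
    using h(2) iX[OF that(1)] iX[OF that(2)] by metis
  ultimately show ?thesis unfolding emb_def using iX(1) by blast
qed

lemma emb_id: "X \<subseteq> Y \<Longrightarrow> (\<And>z. z \<in> X \<Longrightarrow> u z = w z) \<Longrightarrow> emb X u Y w id"
  unfolding emb_def by (auto simp: strict_mono_on_def)

definition F80 :: "nat list set" where
  "F80 = {\<omega>. is_perm 80 \<omega> \<and> \<not> good {..<80} ((!) \<omega>)}"

lemma is_perm_inj: "is_perm n \<sigma> \<Longrightarrow> inj_on ((!) \<sigma>) {..<n}"
  unfolding is_perm_def by (auto simp: inj_on_def nth_eq_iff_index_eq)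

text \<open>A permutation that is not good has a violation on at most 80 positions. By heredity any
  80 positions containing it are not good either, which gives a forbidden pattern of length exactly
  80; this is where \<open>80 \<le> n\<close> enters.\<close>

lemma avoids_F80:
  assumes n: "80 \<le> n" and \<sigma>: "is_perm n \<sigma>"
  shows "(\<forall>\<omega>\<in>F80. avoids \<sigma> \<omega>) \<longleftrightarrow> good {..<n} ((!) \<sigma>)"
proof
  assume av: "\<forall>\<omega>\<in>F80. avoids \<sigma> \<omega>"
  show "good {..<n} ((!) \<sigma>)"
  proof (rule ccontr)
    assume "\<not> good {..<n} ((!) \<sigma>)"
    then obtain Y where Y: "Y \<subseteq> {..<n}" "finite Y" "card Y \<le> 80" "\<not> good Y ((!) \<sigma>)"
      using bad_local by blast
    obtain Z where Z: "Y \<subseteq> Z" "Z \<subseteq> {..<n}" "card Z = 80"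
      using exists_subset_between[of Y 80 "{..<n}"] Y n by auto
    have Zb: "\<not> good Z ((!) \<sigma>)" using emb_good[OF emb_id[OF Z(1)]] Y(4) by blast
    have Zf: "finite Z" using Z(2) finite_subset by blast
    obtain \<omega> idx where w: "is_perm (card Z) \<omega>" "strict_mono_on {..<card Z} idx" "idx ` {..<card Z} = Z"
      "\<forall>a<card Z. \<forall>b<card Z. \<omega> ! a < \<omega> ! b \<longleftrightarrow> \<sigma> ! (idx a) < \<sigma> ! (idx b)"
      using standardize[OF Zf inj_on_subset[OF is_perm_inj[OF \<sigma>] Z(2)]] by blast
    have e: "emb {..<80} ((!) \<omega>) Z ((!) \<sigma>) idx"
      unfolding emb_def using w Z(3) by auto
    have "\<not> good {..<80} ((!) \<omega>)"
      using emb_good[OF emb_inverse[OF e]] w(3) Z(3) Zb by auto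
    then have "\<omega> \<in> F80" using w(1) Z(3) unfolding F80_def by simp
    moreover have "contains \<sigma> \<omega>"
    proof -
      have "length \<omega> = 80" using w(1) Z(3) unfolding is_perm_def by simp
      moreover have "length \<sigma> = n" using \<sigma> unfolding is_perm_def by simp
      moreover have "idx j < n" if "j < 80" for j using w(3) Z(2,3) that by auto
      ultimately show ?thesis unfolding contains_def using w Z(3) by (intro exI[of _ idx]) auto
    qed
    ultimately show False using av unfolding avoids_def by blast
  qed
next
  assume g: "good {..<n} ((!) \<sigma>)"
  show "\<forall>\<omega>\<in>F80. avoids \<sigma> \<omega>"
  proof (rule ballI)
    fix \<omega> assume w: "\<omega> \<in> F80"
    then have len: "length \<omega> = 80" unfolding F80_def is_perm_def by simp
    show "avoids \<sigma> \<omega>"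
      unfolding avoids_def
    proof
      assume "contains \<sigma> \<omega>"
      then obtain idx where i: "strict_mono_on {..<80} idx" "\<forall>j<80. idx j < length \<sigma>"
        "\<forall>a<80. \<forall>b<80. \<sigma> ! idx a < \<sigma> ! idx b \<longleftrightarrow> \<omega> ! a < \<omega> ! b"
        unfolding contains_def len by blast
      have "emb {..<80} ((!) \<omega>) {..<n} ((!) \<sigma>) idx"
        using i \<sigma> unfolding emb_def is_perm_def by auto
      then have "good {..<80} ((!) \<omega>)" using emb_good g by blast
      then show False using w unfolding F80_def by blast
    qed
  qed
qed

lemma even_card_involution:
  assumes "finite S" "\<And>x. x \<in> S \<Longrightarrow> f x \<in> S" "\<And>x. x \<in> S \<Longrightarrow> f (f x) = x" "\<And>x. x \<in> S \<Longrightarrow> f x \<noteq> x"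
  shows "even (card S)"
  using assms
proof (induction "card S" arbitrary: S rule: less_induct)
  case less
  show ?case
  proof (cases "S = {}")
    case False
    then obtain x where x: "x \<in> S" by blast
    have sub: "{x, f x} \<subseteq> S" using x less.prems by blast
    have c2: "card {x, f x} = 2" using less.prems(4)[OF x] by auto
    have card: "card S = card (S - {x, f x}) + 2"
      using card_Diff_subset[OF _ sub] card_mono[OF less.prems(1) sub] c2 by auto
    have "even (card (S - {x, f x}))"
    proof (rule less.hyps)
      show "card (S - {x, f x}) < card S" using card by simp
      show "finite (S - {x, f x})" using less.prems(1) by simp
      fix y assume y: "y \<in> S - {x, f x}"
      show "f y \<in> S - {x, f x}" using y less.prems(2,3) x by (metis DiffD1 DiffD2 DiffI insert_iff singletonD)
      show "f (f y) = y" "f y \<noteq> y" using y less.prems by auto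
    qed
    then show ?thesis using card by simp
  qed simp
qed

lemma good_cong:
  assumes "\<And>z. z \<in> X \<Longrightarrow> u z = w z"
  shows "good X u \<longleftrightarrow> good X w"
proof -
  have "emb X u X w id" "emb X w X u id" using assms by (auto intro: emb_id)
  from emb_good[OF this(1)] emb_good[OF this(2)] show ?thesis by blast
qed

lemma letter_cong:
  assumes "A \<subseteq> X" "\<And>z. z \<in> X \<Longrightarrow> u z = w z"
  shows "letter u A x \<longleftrightarrow> letter w A x"
proof -
  have "emb X u X w id" "emb X w X u id" using assms(2) by (auto intro: emb_id)
  from emb_letter[OF this(1) assms(1)] emb_letter[OF this(2) assms(1)] show ?thesis
    by (auto simp: image_id)
qed

lemma met_cong:
  assumes "\<And>z. z \<in> X \<Longrightarrow> u z = w z"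
  shows "met X u x A \<longleftrightarrow> met X w x A"
proof -
  have "emb X u X w id" "emb X w X u id" using assms by (auto intro: emb_id)
  from emb_met[OF this(1)] emb_met[OF this(2)] show ?thesis by (auto simp: image_id)
qed

lemma unmet_cong:
  assumes "\<And>z. z \<in> X \<Longrightarrow> u z = w z"
  shows "unmet X u = unmet X w"
proof -
  have "letter u A x \<longleftrightarrow> letter w A x" if "A \<subseteq> X" for A x using letter_cong[OF that assms] .
  moreover have "met X u x A \<longleftrightarrow> met X w x A" for A x using met_cong[OF assms] .
  ultimately show ?thesis unfolding unmet_def by blast
qed

section \<open>Reversing a letter in one-line notation\<close>

definition reflect :: "nat set \<Rightarrow> nat \<Rightarrow> nat" where
  "reflect A i = (if i \<in> A then Min A + Max A - i else i)"

definition toggle :: "nat \<Rightarrow> nat set \<Rightarrow> nat list \<Rightarrow> nat list" where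
  "toggle n A \<sigma> = map (\<lambda>i. \<sigma> ! reflect A i) [0..<n]"

lemma flip_reflect:
  assumes "A \<subseteq> {..<n}" "letter v A x" "solid {..<n} v" "inj_on v {..<n}"
  shows "flip {..<n} v A x (reflect A)"
proof -
  have fin: "finite A" and ne: "A \<noteq> {}" using letter_card letter_nonempty assms(2) by blast+
  have mem: "Min A \<in> A" "Max A \<in> A" using fin ne by auto
  \<comment> \<open>The ground set consists of all positions below \<open>n\<close>, so an interval
    is a full range of integers and the reflection maps it onto itself.\<close>
  have A: "A = {Min A..Max A}"
  proof (intro equalityI subsetI)
    fix z assume z: "z \<in> {Min A..Max A}"
    show "z \<in> A"
    proof (cases "z = Min A \<or> z = Max A")
      case True then show ?thesis using mem by auto
    next
      case False
      then have lt: "Min A < z" "z < Max A" using z by auto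
      then have "z \<in> {..<n}" using mem assms(1) by auto
      moreover have "convx v A {..<n}" using assms unfolding solid_def by blast
      ultimately show ?thesis using lt mem unfolding convx_def by blast
    qed
  qed (use fin in auto)
  have iff: "z \<in> A \<longleftrightarrow> Min A \<le> z \<and> z \<le> Max A" for z
    using arg_cong[OF A, of "\<lambda>S. z \<in> S"] by (simp only: atLeastAtMost_iff)
  define p q where "p = Min A" and "q = Max A"
  have iff': "z \<in> A \<longleftrightarrow> p \<le> z \<and> z \<le> q" for z using iff unfolding p_def q_def .
  have refl: "reflect A z = (if p \<le> z \<and> z \<le> q then p + q - z else z)" for z
    unfolding reflect_def iff' p_def[symmetric] q_def[symmetric] by (rule refl)
  show ?thesis
  proof
    show "inj_on v {..<n}" "A \<subseteq> {..<n}" "letter v A x" "solid {..<n} v" by fact+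
    show "reflect A (reflect A z) = z" for z unfolding refl by (cases "p \<le> z \<and> z \<le> q") auto
    show "z \<notin> A \<Longrightarrow> reflect A z = z" for z unfolding refl iff' by auto
    show "z \<in> A \<Longrightarrow> reflect A z \<in> A" for z unfolding refl iff' by (auto split: if_splits)
    show "y \<in> A \<Longrightarrow> z \<in> A \<Longrightarrow> y < z \<Longrightarrow> reflect A z < reflect A y" for y z unfolding refl iff' by (auto split: if_splits)
  qed
qed

lemma toggle_props:
  assumes "is_perm n \<sigma>" "good {..<n} ((!) \<sigma>)" "A \<in> unmet {..<n} ((!) \<sigma>)"
  shows "is_perm n (toggle n A \<sigma>)" "good {..<n} ((!) (toggle n A \<sigma>))"
    "unmet {..<n} ((!) (toggle n A \<sigma>)) = unmet {..<n} ((!) \<sigma>)"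
    "toggle n A (toggle n A \<sigma>) = \<sigma>" "toggle n A \<sigma> \<noteq> \<sigma>"
proof -
  obtain x where x: "A \<subseteq> {..<n}" "letter ((!) \<sigma>) A x" "\<not> met {..<n} ((!) \<sigma>) x A"
    using assms(3) unfolding unmet_def by blast
  interpret flip "{..<n}" "(!) \<sigma>" A x "reflect A"
    by (rule flip_reflect[OF x(1,2) _ is_perm_inj[OF assms(1)]]) (use assms(2) in \<open>simp add: good_def\<close>)
  have len: "length \<sigma> = n" using assms(1) unfolding is_perm_def by simp
  have rn: "reflect A i < n \<longleftrightarrow> i < n" for i using psiX[of i] by simp
  have e: "toggle n A \<sigma> ! i = v' i" if "i < n" for i using that unfolding toggle_def v'_def by simp
  have img: "reflect A ` {..<n} = {..<n}"
  proof -
    have "i \<in> reflect A ` {..<n}" if "i < n" for i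
      using that rn inv[of i] by (intro image_eqI[of _ _ "reflect A i"]) auto
    then show ?thesis using rn by auto
  qed
  have "set (toggle n A \<sigma>) = (!) \<sigma> ` reflect A ` {..<n}"
    unfolding toggle_def by (auto simp: image_image)
  also have "\<dots> = set \<sigma>" unfolding img using len by (auto simp: set_conv_nth)
  finally have st: "set (toggle n A \<sigma>) = set \<sigma>" .
  moreover have "distinct (toggle n A \<sigma>)"
    using inj' e unfolding toggle_def distinct_map by (simp add: inj_on_def v'_def)
  ultimately show "is_perm n (toggle n A \<sigma>)" using assms(1) unfolding is_perm_def by (simp add: toggle_def)
  show "good {..<n} ((!) (toggle n A \<sigma>))"
    using good_flip[OF assms(2) x(3)] good_cong[of "{..<n}" v' "(!) (toggle n A \<sigma>)"] e by auto
  show "unmet {..<n} ((!) (toggle n A \<sigma>)) = unmet {..<n} ((!) \<sigma>)"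
    using unmet_eq unmet_cong[of "{..<n}" v' "(!) (toggle n A \<sigma>)"] e by auto
  have "toggle n A (toggle n A \<sigma>) ! i = \<sigma> ! i" if "i < n" for i
    using that rn[of i] inv[of i] unfolding toggle_def by simp
  then show "toggle n A (toggle n A \<sigma>) = \<sigma>"
    using len by (intro nth_equalityI) (auto simp: toggle_def)
  obtain z where "z \<in> A" "v' z \<noteq> \<sigma> ! z" using flip_ne by blast
  then show "toggle n A \<sigma> \<noteq> \<sigma>" using e[of z] x(1) by auto
qed

section \<open>Cancellation down to the survivors\<close>

definition letterless :: "nat set \<Rightarrow> (nat \<Rightarrow> nat) \<Rightarrow> bool" where
  "letterless X v \<longleftrightarrow> (\<forall>A x. A \<subseteq> X \<longrightarrow> \<not> letter v A x)"

lemma letter_mirror: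
  assumes "letter ((!) (rev \<sigma>)) A x" "A \<subseteq> {..<length \<sigma>}"
  shows "letter ((!) \<sigma>) ((\<lambda>i. length \<sigma> - Suc i) ` A) x"
proof -
  have p: "pat ((!) \<sigma>) ((\<lambda>i. length \<sigma> - Suc i) ` A) (rev \<beta>)" if "pat ((!) (rev \<sigma>)) A \<beta>" for \<beta>
    by (rule pat_image_rev[OF that]) (use assms(2) in \<open>auto simp: rev_nth subset_eq intro!: diff_less_mono2\<close>)
  show ?thesis using assms(1) p[of "blk x"] p[of "rev (blk x)"] unfolding letter_def by auto
qed

text \<open>The notion of a letter includes both orientations, so reversing the whole list preserves
  the absence of letters; it exchanges the first and the last entry, which differ because
  \<open>2 \<le> n\<close>.\<close>

lemma even_letterless:
  assumes "2 \<le> n"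
  shows "even (card {\<sigma>. is_perm n \<sigma> \<and> letterless {..<n} ((!) \<sigma>)})"
proof (rule even_card_involution[where f = rev])
  show "finite {\<sigma>. is_perm n \<sigma> \<and> letterless {..<n} ((!) \<sigma>)}"
    by (rule finite_subset[OF _ finite_lists_length_eq[of "{1..n}" n]]) (auto simp: is_perm_def)
  fix \<sigma> assume s: "\<sigma> \<in> {\<sigma>. is_perm n \<sigma> \<and> letterless {..<n} ((!) \<sigma>)}"
  then have len: "length \<sigma> = n" "distinct \<sigma>" unfolding is_perm_def by auto
  have "letterless {..<n} ((!) (rev \<sigma>))"
    unfolding letterless_def
  proof (intro allI impI notI)
    fix A x assume A: "A \<subseteq> {..<n}" "letter ((!) (rev \<sigma>)) A x"
    have "(\<lambda>i. n - Suc i) ` A \<subseteq> {..<n}" using assms by auto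
    then show False using letter_mirror[OF A(2)] A(1) len s unfolding letterless_def by auto
  qed
  then show "rev \<sigma> \<in> {\<sigma>. is_perm n \<sigma> \<and> letterless {..<n} ((!) \<sigma>)}" using s unfolding is_perm_def by auto
  show "rev (rev \<sigma>) = \<sigma>" by simp
  have "rev \<sigma> ! 0 = \<sigma> ! (n - 1)" using len assms by (simp add: rev_nth)
  moreover have "\<sigma> ! (n - 1) \<noteq> \<sigma> ! 0" using len assms nth_eq_iff_index_eq[OF len(2), of "n-1" 0] by auto
  ultimately show "rev \<sigma> \<noteq> \<sigma>" by metis
qed

definition surv :: "nat set \<Rightarrow> (nat \<Rightarrow> nat) \<Rightarrow> bool" where
  "surv X v \<longleftrightarrow> good X v \<and> unmet X v = {} \<and> \<not> letterless X v"

text \<open>No rule and no need consists of points only.\<close>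

lemma letterless_good:
  assumes "letterless X v" shows "good X v" "unmet X v = {}"
proof -
  have nl: False if a: "list_all2 (item_ok X v) its Bs" and i: "i < length its" "its ! i \<noteq> Pt" for its Bs i
  proof -
    have "item_ok X v (its ! i) (Bs ! i)" using list_all2_nthD[OF a i(1)] .
    then show False using i(2) assms unfolding letterless_def by (cases "its ! i") auto
  qed
  have R: "\<exists>i<length (fst R). fst R ! i \<noteq> Pt" if "R \<in> set rules" for R
  proof -
    have "\<forall>R\<in>set rules. \<exists>i<length (fst R). fst R ! i \<noteq> Pt" by code_simp
    then show ?thesis using that by blast
  qed
  have "\<not> matches X v R Bs" if r: "R \<in> set rules" for R Bs
  proof
    assume "matches X v R Bs"
    then have m: "list_all2 (item_ok X v) (fst R) Bs" unfolding matches_def by simp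
    obtain i where "i < length (fst R)" "fst R ! i \<noteq> Pt" using R[OF r] by blast
    then show False by (rule nl[OF m])
  qed
  moreover have "\<not> met X v x A" for x A
  proof
    assume "met X v x A"
    from met_letter[OF this] assms show False unfolding letterless_def by blast
  qed
  moreover have "solid X v" using assms unfolding solid_def letterless_def by simp
  ultimately show "good X v" unfolding good_def by simp
  show "unmet X v = {}" using assms unfolding unmet_def letterless_def by simp
qed

lemma C_parity:
  assumes n: "80 \<le> n"
  shows "even (C n F80) \<longleftrightarrow> even (card {\<sigma>. is_perm n \<sigma> \<and> surv {..<n} ((!) \<sigma>)})"
proof -
  let ?X = "{..<n}"
  define G where "G = {\<sigma>. is_perm n \<sigma> \<and> good ?X ((!) \<sigma>)}"
  define D where "D = {\<sigma>. is_perm n \<sigma> \<and> good ?X ((!) \<sigma>) \<and> unmet ?X ((!) \<sigma>) \<noteq> {}}"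
  define E where "E = {\<sigma>. is_perm n \<sigma> \<and> letterless ?X ((!) \<sigma>)}"
  define S where "S = {\<sigma>. is_perm n \<sigma> \<and> surv ?X ((!) \<sigma>)}"
  have fin: "finite {\<sigma>. is_perm n \<sigma>}"
    by (rule finite_subset[OF _ finite_lists_length_eq[of "{1..n}" n]]) (auto simp: is_perm_def)
  have fins: "finite D" "finite E" "finite S"
    unfolding D_def E_def S_def by (rule finite_subset[OF _ fin]; blast)+
  have "C n F80 = card G"
    unfolding C_def G_def by (rule arg_cong[of _ _ card]) (use avoids_F80[OF n] in blast)
  also have "G = (D \<union> E) \<union> S"
    unfolding G_def D_def E_def S_def surv_def using letterless_good by blast
  also have "card \<dots> = card D + card E + card S"
  proof -
    have "D \<inter> E = {}" "(D \<union> E) \<inter> S = {}"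
      unfolding D_def E_def S_def surv_def using letterless_good by blast+
    then show ?thesis using fins by (simp add: card_Un_disjoint)
  qed
  finally have c: "C n F80 = card D + card E + card S" .
  have "even (card E)" unfolding E_def using even_letterless n by simp
  moreover have "even (card D)"
  proof (rule even_card_involution[OF fins(1), where f = "\<lambda>\<sigma>. toggle n (SOME A. A \<in> unmet ?X ((!) \<sigma>)) \<sigma>"])
    fix \<sigma> assume "\<sigma> \<in> D"
    then have s: "is_perm n \<sigma>" "good ?X ((!) \<sigma>)" "unmet ?X ((!) \<sigma>) \<noteq> {}" unfolding D_def by auto
    define A where "A = (SOME A. A \<in> unmet ?X ((!) \<sigma>))"
    have A: "A \<in> unmet ?X ((!) \<sigma>)" unfolding A_def using s(3) some_in_eq by blast
    note t = toggle_props[OF s(1,2) A]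
    show "toggle n (SOME A. A \<in> unmet ?X ((!) \<sigma>)) \<sigma> \<in> D"
      unfolding A_def[symmetric] D_def using t s(3) by auto
    show "toggle n (SOME A. A \<in> unmet ?X ((!) (toggle n (SOME A. A \<in> unmet ?X ((!) \<sigma>)) \<sigma>)))
        (toggle n (SOME A. A \<in> unmet ?X ((!) \<sigma>)) \<sigma>) = \<sigma>"
      unfolding A_def[symmetric] t(3) using t(4) by simp
    show "toggle n (SOME A. A \<in> unmet ?X ((!) \<sigma>)) \<sigma> \<noteq> \<sigma>" unfolding A_def[symmetric] using t(5) .
  qed
  ultimately show ?thesis using c unfolding S_def by simp
qed

section \<open>Parities supported on triangular numbers\<close>

primrec tri :: "nat \<Rightarrow> nat" where
  "tri 0 = 0"
| "tri (Suc m) = tri m + Suc m"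

lemma tri_add: "tri (m + s) = tri m + tri s + m * s"
  by (induction s) auto

lemma tri_double: "2 * tri m = m * (m + 1)"
  by (induction m) auto

lemma tri_mono: "m \<le> m' \<Longrightarrow> tri m \<le> tri m'"
  by (induction m' rule: dec_induct) auto

lemma tri_gap: "m < m' \<Longrightarrow> tri m + m < tri m'"
  using tri_mono[of "Suc m" m'] by simp

text \<open>Twice the difference is \<open>d * (2 * m + d + 1)\<close>, whose factors have opposite
  parity. So \<open>2 ^ Suc e\<close>, if it divides the product, divides one factor, but both are
  positive and smaller.\<close>

lemma tri_inj_mod:
  assumes "m < m'" "m' < 2 ^ e" shows "\<not> 2 ^ e dvd tri m' - tri m"
proof
  assume d: "2 ^ e dvd tri m' - tri m"
  have gt: "tri m < tri m'" using tri_gap[OF assms(1)] by simp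
  obtain d where m': "m' = m + d" "0 < d" using assms(1) less_imp_add_positive by blast
  have "2 * (tri m' - tri m) = d * (2 * m + d + 1)"
    using tri_double[of d] unfolding m' tri_add by (simp add: algebra_simps)
  moreover have "2 ^ Suc e dvd 2 * (tri m' - tri m)" using d by simp
  ultimately have dv: "2 ^ Suc e dvd d * (2 * m + d + 1)" by simp
  have small: "d < 2 ^ Suc e" "2 * m + d + 1 < 2 ^ Suc e" using assms(2) m' by auto
  show False
  proof (cases "even d")
    case True
    then have "coprime (2 ^ Suc e) (2 * m + d + 1)" by simp
    then have "2 ^ Suc e dvd d" using dv coprime_dvd_mult_left_iff by blast
    then show False using small(1) m'(2) nat_dvd_not_less by blast
  next
    case False
    then have "coprime (2 ^ Suc e) d" by simp
    then have "2 ^ Suc e dvd 2 * m + d + 1" using dv coprime_dvd_mult_right_iff by blast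
    then show False using small(2) nat_dvd_not_less by (metis add_gr_0 zero_less_one)
  qed
qed

text \<open>Indices below \<open>2 ^ e\<close> give distinct, hence all, residues of triangular
  numbers, and the odd factor 9 is invertible. Adding a multiple of \<open>2 ^ Suc e\<close> to the
  index keeps the residue and makes the index large.\<close>

lemma tri_hits_residue:
  "\<exists>m\<ge>B. (9 * tri m + i) mod 2 ^ e = r mod 2 ^ e" for r :: nat
proof -
  let ?f = "\<lambda>m. (9 * tri m + i) mod 2 ^ e"
  have aux: "?f m \<noteq> ?f m'" if "m < m'" "m' < 2 ^ e" for m m'
  proof
    assume f: "?f m = ?f m'"
    have ge: "9 * tri m + i \<le> 9 * tri m' + i" using tri_gap[OF that(1)] by simp
    have "2 ^ e dvd (9 * tri m' + i) - (9 * tri m + i)"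
      by (rule mod_eq_dvd_iff_nat[OF ge, THEN iffD1]) (rule f[symmetric])
    then have "2 ^ e dvd 9 * (tri m' - tri m)" by (simp add: diff_mult_distrib2)
    moreover have "coprime (2 ^ e) (9::nat)" by simp
    ultimately have "2 ^ e dvd tri m' - tri m" using coprime_dvd_mult_right_iff by blast
    then show False using tri_inj_mod[OF that] by simp
  qed
  have inj: "inj_on ?f {..<2 ^ e}"
  proof (rule inj_onI)
    fix m m' assume "m \<in> {..<2 ^ e}" "m' \<in> {..<2 ^ e}" "?f m = ?f m'"
    then show "m = m'" using aux[of m m'] aux[of m' m] by (metis lessThan_iff nat_neq_iff)
  qed
  have "?f ` {..<2 ^ e} = {..<2 ^ e}"
  proof (rule card_subset_eq)
    show "card (?f ` {..<2 ^ e}) = card {..<2 ^ e :: nat}" using card_image[OF inj] .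
  qed auto
  moreover have "r mod 2 ^ e \<in> {..<2 ^ e}" by simp
  ultimately obtain m where m: "?f m = r mod 2 ^ e" by (metis (no_types, lifting) imageE)
  define s where "s = 2 ^ Suc e * B"
  have "2 * tri s = 2 * (2 ^ e * (B * (s + 1)))" unfolding tri_double by (simp add: s_def algebra_simps)
  then have ts: "tri s = 2 ^ e * (B * (s + 1))" by simp
  have "9 * tri (m + s) + i = 9 * tri m + i + 2 ^ e * (9 * (B * (s + 1) + m * (2 * B)))"
    unfolding tri_add ts by (simp add: s_def algebra_simps)
  then have "?f (m + s) = ?f m" by (metis mod_mult_self2)
  moreover have "1 * B \<le> 2 ^ Suc e * B" by (rule mult_le_mono1) simp
  then have "B \<le> m + s" unfolding s_def mult_1 by (rule trans_le_add2)
  ultimately show ?thesis using m by metis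
qed

lemma poly_diff_dvd: "a - b dvd poly p a - poly p b" for p :: "int poly"
proof (induction p)
  case (pCons c p)
  have "poly (pCons c p) a - poly (pCons c p) b = a * (poly p a - poly p b) + (a - b) * poly p b"
    by (simp add: algebra_simps)
  then show ?case using pCons.IH by simp
qed simp

text \<open>Let \<open>E\<close> be maximal such that \<open>2 ^ E\<close> divides all coefficient
  values, and let coefficient \<open>i0\<close> at \<open>n0\<close> violate divisibility by
  \<open>2 ^ Suc E\<close>. At a large \<open>n\<close> congruent to \<open>n0\<close> for which
  \<open>a (n - i0)\<close> is odd and the other terms are even, the recurrence fails modulo
  \<open>2 ^ Suc E\<close>.\<close>

lemma not_P_recursive:
  fixes a :: "nat \<Rightarrow> int"
  assumes odd: "\<And>n. 80 \<le> n \<Longrightarrow> odd (a n) \<longleftrightarrow> (\<exists>m\<ge>2. n = 9 * tri m - 2)"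
  shows "\<not> P_recursive a"
proof
  assume "P_recursive a"
  then obtain k :: nat and q :: "nat \<Rightarrow> int poly" and N :: nat where
    ex: "\<exists>i\<le>k. q i \<noteq> 0" and rec: "\<And>n. n \<ge> N \<Longrightarrow> n \<ge> k \<Longrightarrow> (\<Sum>i\<le>k. poly (q i) (int n) * a (n - i)) = 0"
    unfolding P_recursive_def by blast
  obtain i1 where i1: "i1 \<le> k" "q i1 \<noteq> 0" using ex by blast
  have "\<not> range int \<subseteq> {x. poly (q i1) x = 0}"
    using finite_subset[OF _ poly_roots_finite[OF i1(2)]] range_inj_infinite[of int] by auto
  then obtain n1 where n1: "poly (q i1) (int n1) \<noteq> 0" by blast
  define D where "D = (\<lambda>E. \<forall>i\<le>k. \<forall>n. (2::int) ^ E dvd poly (q i) (int n))"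
  define c where "c = poly (q i1) (int n1)"
  \<comment> \<open>The nonzero value \<open>c\<close> is smaller in size than
    \<open>2 ^ nat \<bar>c\<bar>\<close>, which bounds the common powers of 2.\<close>
  have "\<not> D (nat \<bar>c\<bar>)"
  proof
    assume "D (nat \<bar>c\<bar>)"
    then have "2 ^ nat \<bar>c\<bar> dvd poly (q i1) (int n1)" using i1(1) unfolding D_def by blast
    then have "2 ^ nat \<bar>c\<bar> dvd c" unfolding c_def .
    moreover have "c \<noteq> 0" using n1 unfolding c_def .
    ultimately have "2 ^ nat \<bar>c\<bar> \<le> \<bar>c\<bar>" using dvd_imp_le_int[of c "2 ^ nat \<bar>c\<bar>"] by simp
    moreover have "\<bar>c\<bar> < 2 ^ nat \<bar>c\<bar>"
      using of_nat_less_two_power[of "nat \<bar>c\<bar>", where 'a = int] by simp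
    ultimately show False by simp
  qed
  moreover have "D 0" unfolding D_def by simp
  ultimately obtain E where E: "D E" "\<not> D (Suc E)" by (metis nat_induct)
  obtain i0 n0 where i0: "i0 \<le> k" and n0: "\<not> 2 ^ Suc E dvd poly (q i0) (int n0)"
    using E(2) unfolding D_def by blast
  \<comment> \<open>Large \<open>m\<close> makes the recurrence apply, keeps every
    \<open>n - i\<close> above 80 and lets the gaps around \<open>tri m\<close> exceed
    \<open>k\<close>. The congruence puts \<open>n\<close> into the class of \<open>n0\<close>; the
    2 on the right compensates the 2 in 9 * tri m - 2.\<close>
  obtain m where m: "m \<ge> N + k + 100" "(9 * tri m + i0) mod 2 ^ Suc E = (n0 + 2) mod 2 ^ Suc E"
    using tri_hits_residue by blast
  have tm: "m \<le> tri m" using tri_gap[of 0 m] m(1) tri_double[of m] by (cases m) auto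
  define n where "n = 9 * tri m - 2 + i0"
  have n2: "n + 2 = 9 * tri m + i0" unfolding n_def using tm m(1) by simp
  have ev: "even (a (n - i))" if i: "i \<le> k" "i \<noteq> i0" for i
  proof -
    have big: "80 \<le> n - i" using tm m(1) i unfolding n_def by simp
    have "n - i \<noteq> 9 * tri m' - 2" if "m' \<ge> 2" for m'
    proof
      assume e: "n - i = 9 * tri m' - 2"
      have "2 \<le> tri m'" using that tri_mono[of 2 m'] by (simp add: numeral_2_eq_2)
      then have e': "9 * tri m + i0 = 9 * tri m' + i" using e n2 big by simp
      consider "m < m'" | "m' < m" | "m = m'" by linarith
      then show False
      proof cases
        case 1 then show False using tri_gap[OF 1] e' i0 m(1) by simp
      next
        case 2
        then obtain m'' where mm: "m = Suc m''" "m' \<le> m''" by (metis Suc_le_D Suc_le_eq less_Suc_eq_le)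
        then have "tri m' \<le> tri m''" using tri_mono by blast
        then show False using e' i m(1) mm(1) by simp
      next
        case 3 then show False using e' i by simp
      qed
    qed
    then show ?thesis using odd[OF big] by auto
  qed
  have od: "odd (a (n - i0))"
  proof -
    have "n - i0 = 9 * tri m - 2" unfolding n_def by simp
    moreover have "80 \<le> 9 * tri m - 2" "2 \<le> m" using tm m(1) by auto
    ultimately show ?thesis using odd by metis
  qed
  have "(\<Sum>i\<le>k. poly (q i) (int n) * a (n - i)) = 0"
    by (rule rec) (use tm m(1) n2 in auto)
  then have "poly (q i0) (int n) * a (n - i0) = - (\<Sum>i\<in>{..k} - {i0}. poly (q i) (int n) * a (n - i))"
    using i0 by (simp add: sum.remove[of "{..k}" i0])
  moreover have "2 ^ Suc E dvd (\<Sum>i\<in>{..k} - {i0}. poly (q i) (int n) * a (n - i))"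
  proof (rule dvd_sum)
    fix i assume i: "i \<in> {..k} - {i0}"
    have "2 ^ E dvd poly (q i) (int n)" using E(1) i unfolding D_def by simp
    moreover have "2 dvd a (n - i)" using ev i by simp
    ultimately have "2 ^ E * 2 dvd poly (q i) (int n) * a (n - i)" by (rule mult_dvd_mono)
    then show "2 ^ Suc E dvd poly (q i) (int n) * a (n - i)" by (simp add: mult.commute)
  qed
  ultimately have "2 ^ Suc E dvd poly (q i0) (int n) * a (n - i0)" by simp
  moreover have "coprime (2 ^ Suc E) (a (n - i0))" using od by simp
  ultimately have d: "2 ^ Suc E dvd poly (q i0) (int n)" using coprime_dvd_mult_left_iff by blast
  have "(n + 2) mod 2 ^ Suc E = (n0 + 2) mod 2 ^ Suc E" using m(2) n2 by simp
  then have "int (n + 2) mod 2 ^ Suc E = int (n0 + 2) mod 2 ^ Suc E"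
    by (metis of_nat_mod of_nat_numeral of_nat_power)
  then have "2 ^ Suc E dvd int (n + 2) - int (n0 + 2)" by (simp add: mod_eq_dvd_iff)
  then have "2 ^ Suc E dvd int n - int n0" by simp
  then have "2 ^ Suc E dvd poly (q i0) (int n) - poly (q i0) (int n0)"
    using poly_diff_dvd dvd_trans by blast
  then have "2 ^ Suc E dvd poly (q i0) (int n0)" using d dvd_diff_right_iff by (metis dvd_diff_commute dvd_diffD)
  then show False using n0 by simp
qed

section \<open>The structure of surviving permutations\<close>

text \<open>The common part of the needs of \<open>LP\<close>, \<open>LN\<close> and
  \<open>LS\<close>: a next letter \<open>B\<close> with linker \<open>z\<close>, a pointer
  \<open>p\<close>, and a point \<open>q\<close> in the row just above \<open>A\<close> unless the
  labels exempt it.\<close>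

lemma met_next:
  assumes "met X v x A" "x \<noteq> LQ"
  obtains B y z p where "B \<subseteq> X" "letter v B y" "z \<in> X" "p \<in> X"
    "\<forall>a\<in>A. \<forall>b\<in>B. a < b" "\<forall>b\<in>B. b < z" "\<forall>a\<in>A. v z < v a"
    "\<forall>a\<in>A. a < p" "\<forall>b\<in>B. p < b" "\<forall>b\<in>B. v b < v p"
    "x = LP \<or> x = LN \<and> (y = LS \<or> y = LQ) \<or>
      (\<exists>q\<in>X. (\<forall>a\<in>A. q < a) \<and> (\<forall>a\<in>A. v a < v q) \<and> (\<forall>b\<in>B. v q < v b))"
proof -
  obtain R Bs where R: "R \<in> set (need x)" "matches X v R Bs" "Bs ! 0 = A"
    using assms(1) unfolding met_def by blast
  show thesis
  proof (cases x)
    case LP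
    then have "R = ([Lt {LP}, Any, Pt, Pt], adj 0 1 2 @ [H 0 3, H 3 1, V 1 3])" using R(1) by simp
    then show ?thesis using R(2,3) LP that unfolding matches_def adj_def
      by (auto simp: list_all2_Cons1)
  next
    case LN
    then consider "R = ([Lt {LN}, Lt {LS, LQ}, Pt, Pt, Any, Pt], adj 0 1 2 @ [H 0 3, H 3 1, V 1 3] @ adj 4 0 5)"
      | "R = ([Lt {LN}, Any, Pt, Pt, Any, Pt, Pt], adj 0 1 2 @ [H 0 3, H 3 1, V 1 3] @ adj 4 0 5 @ [H 6 0, V 0 6, V 6 1])"
      using R(1) by auto
    then show ?thesis
    proof cases
      case 1
      then obtain B y z p where "Bs ! 1 = B" "B \<subseteq> X" "letter v B y" "y = LS \<or> y = LQ" "Bs ! 2 = {z}" "z \<in> X" "Bs ! 3 = {p}" "p \<in> X"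
        using R(2) unfolding matches_def by (auto simp: list_all2_Cons1)
      with R(2,3) 1 LN show ?thesis by (intro that[of B y z p]) (auto simp: matches_def adj_def)
    next
      case 2
      then obtain B y z p q where "Bs ! 1 = B" "B \<subseteq> X" "letter v B y" "Bs ! 2 = {z}" "z \<in> X" "Bs ! 3 = {p}" "p \<in> X" "Bs ! 6 = {q}" "q \<in> X"
        using R(2) unfolding matches_def by (auto simp: list_all2_Cons1)
      with R(2,3) 2 LN show ?thesis by (intro that[of B y z p]) (auto simp: matches_def adj_def)
    qed
  next
    case LS
    then have 2: "R = ([Lt {LS}, Any, Pt, Pt, Any, Pt, Pt], adj 0 1 2 @ [H 0 3, H 3 1, V 1 3] @ adj 4 0 5 @ [H 6 0, V 0 6, V 6 1])"
      using R(1) by simp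
    then obtain B y z p q where "Bs ! 1 = B" "B \<subseteq> X" "letter v B y" "Bs ! 2 = {z}" "z \<in> X" "Bs ! 3 = {p}" "p \<in> X" "Bs ! 6 = {q}" "q \<in> X"
      using R(2) unfolding matches_def by (auto simp: list_all2_Cons1)
    with R(2,3) 2 LS show ?thesis by (intro that[of B y z p]) (auto simp: matches_def adj_def)
  next
    case LQ then show ?thesis using assms by simp
  qed
qed

lemma met_prev:
  assumes "met X v x A" "x \<noteq> LP"
  obtains B y where "B \<subseteq> X" "letter v B y" "\<forall>b\<in>B. \<forall>a\<in>A. b < a"
proof -
  obtain R Bs where R: "R \<in> set (need x)" "matches X v R Bs" "Bs ! 0 = A"
    using assms(1) unfolding met_def by blast
  have "\<exists>i. i < length (fst R) \<and> fst R ! i = Any \<and> H i 0 \<in> set (snd R)"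
    using R(1) assms(2) by (cases x) (auto simp: adj_def intro: exI[of _ 4] exI[of _ 1])
  then obtain i where i: "i < length (fst R)" "fst R ! i = Any" "H i 0 \<in> set (snd R)" by blast
  have "item_ok X v (fst R ! i) (Bs ! i)" using R(2) i(1) list_all2_nthD unfolding matches_def by blast
  moreover have "holds v Bs (H i 0)" using R(2) i(3) unfolding matches_def by blast
  ultimately show thesis using that R(3) i(2) by auto
qed

lemma enumerate_by_key:
  fixes key :: "'a \<Rightarrow> nat"
  assumes "finite S" "inj_on key S"
  obtains b where "bij_betw b {1..card S} S"
    "\<And>i j. i \<in> {1..card S} \<Longrightarrow> j \<in> {1..card S} \<Longrightarrow> i < j \<Longrightarrow> key (b i) < key (b j)"
proof -
  define L where "L = sorted_list_of_set (key ` S)"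
  have c: "card (key ` S) = card S" using card_image[OF assms(2)] .
  have L: "length L = card S" "set L = key ` S" "sorted_wrt (<) L" "distinct L"
    using assms(1) c by (auto simp: L_def)
  define b where "b = (\<lambda>j. inv_into S key (L ! (j - 1)))"
  have mem: "L ! (j - 1) \<in> key ` S" if "j \<in> {1..card S}" for j
    using that L(1) unfolding L(2)[symmetric] by (intro nth_mem) auto
  have key: "key (b j) = L ! (j - 1)" "b j \<in> S" if "j \<in> {1..card S}" for j
    using mem[OF that] unfolding b_def by (auto simp: f_inv_into_f inv_into_into)
  have mono: "key (b i) < key (b j)" if "i \<in> {1..card S}" "j \<in> {1..card S}" "i < j" for i j
    using key(1)[OF that(1)] key(1)[OF that(2)] L(1,3) that by (auto simp: sorted_wrt_iff_nth_less)
  have inj: "inj_on b {1..card S}"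
  proof (rule inj_onI)
    fix i j assume "i \<in> {1..card S}" "j \<in> {1..card S}" "b i = b j"
    then show "i = j" using mono[of i j] mono[of j i] by (metis less_irrefl nat_neq_iff)
  qed
  have "b ` {1..card S} = S"
    by (rule card_subset_eq[OF assms(1)]) (use key(2) card_image[OF inj] in auto)
  then show thesis using that mono inj unfolding bij_betw_def by blast
qed

lemma downset_eq_atMost:
  assumes "S \<subseteq> {1..N::nat}" "\<And>i j. j \<in> S \<Longrightarrow> 1 \<le> i \<Longrightarrow> i < j \<Longrightarrow> i \<in> S"
  shows "S = {1..card S}"
proof (cases "S = {}")
  case False
  have fin: "finite S" using assms(1) finite_subset by blast
  have "S = {1..Max S}"
  proof (intro equalityI subsetI)
    fix i assume "i \<in> S" then show "i \<in> {1..Max S}" using fin assms(1) by auto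
  next
    fix i assume "i \<in> {1..Max S}"
    then show "i \<in> S" using assms(2)[of "Max S" i] fin False by (cases "i = Max S") auto
  qed
  then show ?thesis by (metis card_atLeastAtMost diff_Suc_1)
qed simp

section \<open>Increasing letters and cell coordinates\<close>

locale survivor =
  fixes X :: "nat set" and v :: "nat \<Rightarrow> nat"
  assumes fin: "finite X" and inj: "inj_on v X" and surv: "surv X v"
begin

lemma good: "good X v" and solid: "solid X v"
  using surv unfolding surv_def good_def by auto

lemma letter_met: "A \<subseteq> X \<Longrightarrow> letter v A x \<Longrightarrow> met X v x A"
  using surv unfolding surv_def unmet_def by blast

lemma letter_upright: "A \<subseteq> X \<Longrightarrow> letter v A x \<Longrightarrow> pat v A (blk x)"
  using good letter_met[of A x] unfolding good_def letter_def by blast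

lemma no_rule: "(its, cs) \<in> set rules \<Longrightarrow> list_all2 (item_ok X v) its Bs \<Longrightarrow> \<forall>c\<in>set cs. holds v Bs c \<Longrightarrow> False"
  using good unfolding good_def matches_def by (metis fst_conv snd_conv)

lemma side:
  assumes "A \<subseteq> X" "letter v A x" "z \<in> X" "z \<notin> A"
  shows "(\<forall>a\<in>A. a < z) \<or> (\<forall>a\<in>A. z < a)" "(\<forall>a\<in>A. v a < v z) \<or> (\<forall>a\<in>A. v z < v a)"
proof -
  have c: "convx v A X" using solid assms unfolding solid_def by blast
  have ne: "a \<noteq> z" "v a \<noteq> v z" if "a \<in> A" for a
    using that assms inj_on_eq_iff[OF inj, of a z] by auto
  show "(\<forall>a\<in>A. a < z) \<or> (\<forall>a\<in>A. z < a)"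
    using c ne(1) assms(3,4) unfolding convx_def by (meson linorder_neqE_nat)
  show "(\<forall>a\<in>A. v a < v z) \<or> (\<forall>a\<in>A. v z < v a)"
    using c ne(2) assms(3,4) unfolding convx_def by (meson linorder_neqE_nat)
qed

definition "letters = {A. A \<subseteq> X \<and> (\<exists>x. letter v A x)}"

lemma letters_finite: "finite letters"
  using fin unfolding letters_def by simp

lemma letters_order:
  assumes "A \<in> letters" "B \<in> letters" "Min A < Min B"
  shows "\<forall>a\<in>A. \<forall>b\<in>B. a < b" "\<forall>a\<in>A. \<forall>b\<in>B. v a < v b"
proof -
  obtain x y where A: "A \<subseteq> X" "letter v A x" and B: "B \<subseteq> X" "letter v B y"
    using assms unfolding letters_def by blast
  have fA: "finite A" "A \<noteq> {}" "finite B" "B \<noteq> {}" using letter_card letter_nonempty A B by blast+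
  have "A \<noteq> B" using assms(3) by auto
  then have d: "A \<inter> B = {}" using letters_disjoint[OF solid inj A(1) B(1) A(2) B(2)] by blast
  have cA: "convx v A X" and cB: "convx v B X" using solid A B unfolding solid_def by blast+
  have mA: "Min A \<in> A" and mB: "Min B \<in> B" using fA by auto
  have AB: "\<forall>a\<in>A. a < Min B"
    using side(1)[OF A, of "Min B"] mA mB d B assms(3) by (metis disjoint_iff less_asym subsetD)
  show h: "\<forall>a\<in>A. \<forall>b\<in>B. a < b"
    using AB Min_le[OF fA(3)] by (meson order_less_le_trans)
  have tri: "(\<forall>a\<in>A. \<forall>b\<in>B. v a < v b) \<or> (\<forall>b\<in>B. \<forall>a\<in>A. v b < v a)"
  proof (rule ccontr)
    assume n: "\<not> ?thesis"
    have sB: "(\<forall>a\<in>A. v a < v b) \<or> (\<forall>a\<in>A. v b < v a)" if "b \<in> B" for b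
      using side(2)[OF A, of b] that d B by blast
    have sA: "(\<forall>b\<in>B. v b < v a) \<or> (\<forall>b\<in>B. v a < v b)" if "a \<in> A" for a
      using side(2)[OF B, of a] that d A by blast
    show False using n sA sB mA mB by (metis less_asym)
  qed
  have "\<not> (\<forall>b\<in>B. \<forall>a\<in>A. v b < v a)"
  proof
    assume "\<forall>b\<in>B. \<forall>a\<in>A. v b < v a"
    then show False
      using no_rule[of "[Any, Any]" "[H 0 1, V 1 0]" "[A, B]"] h A B by (auto simp: rules_def)
  qed
  then show "\<forall>a\<in>A. \<forall>b\<in>B. v a < v b" using tri by blast
qed

lemma Min_inj: "inj_on Min letters"
proof (rule inj_onI)
  fix A B assume AB: "A \<in> letters" "B \<in> letters" "Min A = Min B"
  obtain x y where A: "A \<subseteq> X" "letter v A x" and B: "B \<subseteq> X" "letter v B y"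
    using AB unfolding letters_def by blast
  have fA: "finite A" "A \<noteq> {}" "finite B" "B \<noteq> {}" using letter_card letter_nonempty A B by blast+
  then have "Min A \<in> A \<inter> B" using AB(3) by (metis IntI Min_in)
  then show "A = B" using letters_disjoint[OF solid inj A(1) B(1) A(2) B(2)] by blast
qed

definition "N = card letters"

definition "b = (SOME b. bij_betw b {1..N} letters \<and>
   (\<forall>i\<in>{1..N}. \<forall>j\<in>{1..N}. i < j \<longrightarrow> Min (b i) < Min (b j)))"

lemma b_props: "bij_betw b {1..N} letters" "i \<in> {1..N} \<Longrightarrow> j \<in> {1..N} \<Longrightarrow> i < j \<Longrightarrow> Min (b i) < Min (b j)"
proof -
  have "\<exists>b. bij_betw b {1..N} letters \<and> (\<forall>i\<in>{1..N}. \<forall>j\<in>{1..N}. i < j \<longrightarrow> Min (b i) < Min (b j))"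
    using enumerate_by_key[OF letters_finite Min_inj] unfolding N_def by metis
  then have "bij_betw b {1..N} letters \<and> (\<forall>i\<in>{1..N}. \<forall>j\<in>{1..N}. i < j \<longrightarrow> Min (b i) < Min (b j))"
    unfolding b_def by (rule someI_ex)
  then show "bij_betw b {1..N} letters" "i \<in> {1..N} \<Longrightarrow> j \<in> {1..N} \<Longrightarrow> i < j \<Longrightarrow> Min (b i) < Min (b j)" by blast+
qed

definition "w j = (THE x. letter v (b j) x)"

lemma b_letter: assumes "j \<in> {1..N}" shows "b j \<subseteq> X" "letter v (b j) (w j)" "b j \<in> letters"
proof -
  show l: "b j \<in> letters" using b_props(1) assms unfolding bij_betw_def by blast
  then obtain x where x: "b j \<subseteq> X" "letter v (b j) x" unfolding letters_def by blast
  then show "b j \<subseteq> X" by simp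
  show "letter v (b j) (w j)" unfolding w_def using x(2) letter_label by (metis theI)
qed

lemma letter_b:
  assumes "A \<subseteq> X" "letter v A x" obtains j where "j \<in> {1..N}" "A = b j" "w j = x"
proof -
  have "A \<in> letters" using assms unfolding letters_def by blast
  then obtain j where j: "j \<in> {1..N}" "A = b j" using b_props(1) unfolding bij_betw_def by blast
  then have "w j = x" using b_letter(2)[OF j(1)] assms(2) letter_label by blast
  then show thesis using that j by blast
qed

lemma b_ne: "j \<in> {1..N} \<Longrightarrow> \<exists>a. a \<in> b j"
  using b_letter(2) letter_nonempty by blast

lemma b_less:
  assumes "i \<in> {1..N}" "j \<in> {1..N}" "i < j" "a \<in> b i" "e \<in> b j"
  shows "a < e" "v a < v e"
  using letters_order[OF b_letter(3)[OF assms(1)] b_letter(3)[OF assms(2)] b_props(2)[OF assms(1-3)]] assms(4,5)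
  by blast+

lemma b_H: assumes "i \<in> {1..N}" "j \<in> {1..N}" shows "(\<forall>a\<in>b i. \<forall>c\<in>b j. a < c) \<longleftrightarrow> i < j"
proof
  obtain a e where ae: "a \<in> b i" "e \<in> b j" using b_ne assms by blast
  assume "\<forall>a\<in>b i. \<forall>c\<in>b j. a < c"
  then have "a < e" using ae by blast
  then show "i < j" using b_less(1)[OF assms(2,1) _ ae(2,1)] \<open>a < e\<close> \<open>\<forall>a\<in>b i. \<forall>c\<in>b j. a < c\<close> ae
    by (cases i j rule: linorder_cases) auto
qed (use b_less(1)[OF assms] in blast)

lemma b_V: assumes "i \<in> {1..N}" "j \<in> {1..N}" shows "(\<forall>a\<in>b i. \<forall>c\<in>b j. v a < v c) \<longleftrightarrow> i < j"
proof
  obtain a e where ae: "a \<in> b i" "e \<in> b j" using b_ne assms by blast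
  assume "\<forall>a\<in>b i. \<forall>c\<in>b j. v a < v c"
  then have "v a < v e" using ae by blast
  then show "i < j" using b_less(2)[OF assms(2,1) _ ae(2,1)] \<open>v a < v e\<close> \<open>\<forall>a\<in>b i. \<forall>c\<in>b j. v a < v c\<close> ae
    by (cases i j rule: linorder_cases) auto
qed (use b_less(2)[OF assms] in blast)

definition "plain z \<longleftrightarrow> z \<in> X \<and> (\<forall>j\<in>{1..N}. z \<notin> b j)"
text \<open>The letters cut the plane into cells, and \<open>c\<close> and \<open>r\<close> are the
  column and the row of a point, counted from 0. For a plain point the letters to its left form an
  initial segment of the numbering, and so do those below it; hence the counts act as
  thresholds.\<close>

definition "c z = card {j\<in>{1..N}. \<forall>a\<in>b j. a < z}"
definition "r z = card {j\<in>{1..N}. \<forall>a\<in>b j. v a < v z}"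

lemma plain_coord:
  assumes "plain z" "j \<in> {1..N}"
  shows "(\<forall>a\<in>b j. a < z) \<longleftrightarrow> j \<le> c z" "(\<forall>a\<in>b j. z < a) \<longleftrightarrow> c z < j"
    "(\<forall>a\<in>b j. v a < v z) \<longleftrightarrow> j \<le> r z" "(\<forall>a\<in>b j. v z < v a) \<longleftrightarrow> r z < j"
proof -
  have z: "z \<in> X" "z \<notin> b j" using assms unfolding plain_def by auto
  have S1: "{j\<in>{1..N}. \<forall>a\<in>b j. a < z} = {1..c z}"
    unfolding c_def
  proof (rule downset_eq_atMost[where N = N])
    fix i k assume k: "k \<in> {j\<in>{1..N}. \<forall>a\<in>b j. a < z}" "1 \<le> i" "i < k"
    then have "\<forall>a\<in>b i. \<forall>c\<in>b k. a < c" using b_H[of i k] by auto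
    then show "i \<in> {j\<in>{1..N}. \<forall>a\<in>b j. a < z}" using k b_ne[of k] by fastforce
  qed auto
  have S2: "{j\<in>{1..N}. \<forall>a\<in>b j. v a < v z} = {1..r z}"
    unfolding r_def
  proof (rule downset_eq_atMost[where N = N])
    fix i k assume k: "k \<in> {j\<in>{1..N}. \<forall>a\<in>b j. v a < v z}" "1 \<le> i" "i < k"
    then have "\<forall>a\<in>b i. \<forall>c\<in>b k. v a < v c" using b_V[of i k] by auto
    then show "i \<in> {j\<in>{1..N}. \<forall>a\<in>b j. v a < v z}" using k b_ne[of k] by fastforce
  qed auto
  show h1: "(\<forall>a\<in>b j. a < z) \<longleftrightarrow> j \<le> c z" using arg_cong[OF S1, of "\<lambda>S. j \<in> S"] assms(2) by auto
  show h2: "(\<forall>a\<in>b j. v a < v z) \<longleftrightarrow> j \<le> r z" using arg_cong[OF S2, of "\<lambda>S. j \<in> S"] assms(2) by auto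
  obtain a where a: "a \<in> b j" using b_ne assms(2) by blast
  note s = side[OF b_letter(1,2)[OF assms(2)] z]
  show "(\<forall>a\<in>b j. z < a) \<longleftrightarrow> c z < j" using h1 s(1) a by (metis less_asym not_le)
  show "(\<forall>a\<in>b j. v z < v a) \<longleftrightarrow> r z < j" using h2 s(2) a by (metis less_asym not_le)
qed

lemma c_le: "c z \<le> N" and r_le: "r z \<le> N"
  unfolding c_def r_def by (auto intro: order_trans[OF card_mono[of "{1..N}"]])

lemma plain_X: "plain z \<Longrightarrow> z \<in> X" unfolding plain_def by simp

end

section \<open>Linkers and pointers are the only points outside letters\<close>

context survivor begin

lemma bH: "1 \<le> i \<Longrightarrow> i \<le> N \<Longrightarrow> 1 \<le> j \<Longrightarrow> j \<le> N \<Longrightarrow> (\<forall>a\<in>b i. \<forall>e\<in>b j. a < e) \<longleftrightarrow> i < j"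
  and bV: "1 \<le> i \<Longrightarrow> i \<le> N \<Longrightarrow> 1 \<le> j \<Longrightarrow> j \<le> N \<Longrightarrow> (\<forall>a\<in>b i. \<forall>e\<in>b j. v a < v e) \<longleftrightarrow> i < j"
  using b_H[of i j] b_V[of i j] by auto

lemma pc: assumes "plain z" "1 \<le> j" "j \<le> N"
  shows "(\<forall>a\<in>b j. a < z) \<longleftrightarrow> j \<le> c z" "(\<forall>a\<in>b j. z < a) \<longleftrightarrow> c z < j"
    "(\<forall>a\<in>b j. v a < v z) \<longleftrightarrow> j \<le> r z" "(\<forall>a\<in>b j. v z < v a) \<longleftrightarrow> r z < j"
  using plain_coord[OF assms(1), of j] assms(2,3) by auto

lemma item_Lt: "1 \<le> j \<Longrightarrow> j \<le> N \<Longrightarrow> item_ok X v (Lt S) (b j) \<longleftrightarrow> w j \<in> S"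
proof -
  assume "1 \<le> j" "j \<le> N"
  then have "b j \<subseteq> X" "letter v (b j) (w j)" using b_letter[of j] by auto
  then show ?thesis unfolding item_ok.simps using letter_label by blast
qed

lemma item_Pt: "plain z \<Longrightarrow> item_ok X v Pt {z}"
  using plain_X by auto

text \<open>With these, an instance of a rule at numbered letters and plain points becomes a system
  of inequalities between indices and cell coordinates.\<close>

lemmas rule_simps = bH bV pc item_Lt item_Pt

lemma no_inner_LP: "1 \<le> i \<Longrightarrow> i < j \<Longrightarrow> j \<le> N \<Longrightarrow> w j \<noteq> LP"
  using no_rule[of "[Any, Lt {LP}]" "[H 0 1]" "[b i, b j]"]
  by (auto simp del: item_ok.simps simp add: rule_simps rules_def)

lemma no_inner_LQ: "1 \<le> i \<Longrightarrow> i < j \<Longrightarrow> j \<le> N \<Longrightarrow> w i \<noteq> LQ"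
  using no_rule[of "[Lt {LQ}, Any]" "[H 0 1]" "[b i, b j]"]
  by (auto simp del: item_ok.simps simp add: rule_simps rules_def)

lemma met_b: "1 \<le> j \<Longrightarrow> j \<le> N \<Longrightarrow> met X v (w j) (b j)"
  using letter_met b_letter[of j] by simp

lemma N_pos: "1 \<le> N"
proof -
  have "letters \<noteq> {}" using surv unfolding surv_def letterless_def letters_def by blast
  then show ?thesis using letters_finite unfolding N_def by (simp add: Suc_le_eq card_gt_0_iff)
qed

text \<open>Used to show that a point required by a need is plain: for a point of a letter,
  horizontal and vertical relations to other letters both follow the index, whereas the required
  relations conflict.\<close>

lemma coord_b:
  assumes "1 \<le> j" "j \<le> N" "1 \<le> k" "k \<le> N" "z \<in> b k"
  shows "(\<forall>a\<in>b j. a < z) \<Longrightarrow> j < k" "(\<forall>a\<in>b j. z < a) \<Longrightarrow> k < j"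
    "(\<forall>a\<in>b j. v a < v z) \<Longrightarrow> j < k" "(\<forall>a\<in>b j. v z < v a) \<Longrightarrow> k < j"
proof -
  obtain a where a: "a \<in> b j" using b_ne assms by auto
  have l: "j < k \<Longrightarrow> a < z \<and> v a < v z" "k < j \<Longrightarrow> z < a \<and> v z < v a"
    using b_less[of j k a z] b_less[of k j z a] a assms by auto
  show "(\<forall>a\<in>b j. a < z) \<Longrightarrow> j < k" "(\<forall>a\<in>b j. z < a) \<Longrightarrow> k < j"
    "(\<forall>a\<in>b j. v a < v z) \<Longrightarrow> j < k" "(\<forall>a\<in>b j. v z < v a) \<Longrightarrow> k < j"
    using l a assms(5) by (cases j k rule: linorder_cases; fastforce)+
qed

lemma plain_or_b: "z \<in> X \<Longrightarrow> plain z \<or> (\<exists>k. 1 \<le> k \<and> k \<le> N \<and> z \<in> b k)"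
  unfolding plain_def by auto

lemma lower_coord: "plain z \<Longrightarrow> c z \<le> r z + 2"
proof (rule ccontr)
  assume z: "plain z" "\<not> c z \<le> r z + 2"
  let ?i = "r z + 1"
  have "1 \<le> ?i" "?i + 2 \<le> N" using z c_le[of z] by auto
  then show False
    using no_rule[of "[Any, Any, Any, Pt]" "[H 0 1, H 1 2, H 2 3, V 3 0]" "[b ?i, b (?i + 1), b (?i + 2), {z}]"] z
    by (auto simp del: item_ok.simps simp add: rule_simps rules_def)
qed

lemma next_facts:
  assumes j: "1 \<le> j" "j \<le> N" "w j \<noteq> LQ"
  shows "j < N" "\<exists>z. plain z \<and> c z = j + 1 \<and> r z = j - 1" "\<exists>p. plain p \<and> c p = j \<and> j + 1 \<le> r p"
    "w j = LP \<or> w j = LN \<and> (w (j + 1) = LS \<or> w (j + 1) = LQ) \<or> (\<exists>q. plain q \<and> c q < j \<and> r q = j)"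
proof -
  obtain B y z p where B: "B \<subseteq> X" "letter v B y" "z \<in> X" "p \<in> X"
    "\<forall>a\<in>b j. \<forall>e\<in>B. a < e" "\<forall>e\<in>B. e < z" "\<forall>a\<in>b j. v z < v a"
    "\<forall>a\<in>b j. a < p" "\<forall>e\<in>B. p < e" "\<forall>e\<in>B. v e < v p"
    "w j = LP \<or> w j = LN \<and> (y = LS \<or> y = LQ) \<or>
      (\<exists>q\<in>X. (\<forall>a\<in>b j. q < a) \<and> (\<forall>a\<in>b j. v a < v q) \<and> (\<forall>e\<in>B. v q < v e))"
    by (rule met_next[OF met_b[OF j(1,2)] j(3)])
  obtain k where "k \<in> {1..N}" and Bk: "B = b k" "w k = y" by (rule letter_b[OF B(1,2)])
  then have k: "1 \<le> k" "k \<le> N" by auto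
  have jk: "j < k" using B(5) bH[OF j(1,2) k] unfolding Bk by simp
  have pz: "plain z"
  proof (rule ccontr)
    assume "\<not> plain z"
    then obtain m where m: "1 \<le> m" "m \<le> N" "z \<in> b m" using plain_or_b[OF B(3)] by blast
    have "k < m" using coord_b(1)[OF k m] B(6) Bk by simp
    moreover have "m < j" using coord_b(4)[OF j(1,2) m] B(7) by simp
    ultimately show False using jk by simp
  qed
  have "k \<le> c z" "r z < j" using pc(1)[OF pz k] pc(4)[OF pz j(1,2)] B(6,7) Bk by auto
  \<comment> \<open>The inequality \<open>c z \<le> r z + 2\<close> leaves no letter between
    \<open>b j\<close> and \<open>b k\<close>.\<close>
  then have kk: "k = j + 1" "c z = j + 1" "r z = j - 1" using lower_coord[OF pz] jk by auto
  then show "\<exists>z. plain z \<and> c z = j + 1 \<and> r z = j - 1" using pz by blast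
  show "j < N" using jk k by simp
  have pp: "plain p"
  proof (rule ccontr)
    assume "\<not> plain p"
    then obtain m where m: "1 \<le> m" "m \<le> N" "p \<in> b m" using plain_or_b[OF B(4)] by blast
    have "m < k" using coord_b(2)[OF k m] B(9) Bk by simp
    moreover have "k < m" using coord_b(3)[OF k m] B(10) Bk by simp
    ultimately show False by simp
  qed
  have "c p = j" "j + 1 \<le> r p" using pc[OF pp k] pc[OF pp j(1,2)] B(8-10) Bk kk by auto
  then show "\<exists>p. plain p \<and> c p = j \<and> j + 1 \<le> r p" using pp by blast
  have "\<exists>q. plain q \<and> c q < j \<and> r q = j"
    if q: "q \<in> X" "\<forall>a\<in>b j. q < a" "\<forall>a\<in>b j. v a < v q" "\<forall>e\<in>B. v q < v e" for q
  proof -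
    have pq: "plain q"
    proof (rule ccontr)
      assume "\<not> plain q"
      then obtain m where m: "1 \<le> m" "m \<le> N" "q \<in> b m" using plain_or_b[OF q(1)] by blast
      have "m < j" using coord_b(2)[OF j(1,2) m] q by simp
      moreover have "j < m" using coord_b(3)[OF j(1,2) m] q by simp
      ultimately show False by simp
    qed
    have "c q < j" "r q = j" using pc[OF pq k] pc[OF pq j(1,2)] q Bk kk by auto
    then show ?thesis using pq by blast
  qed
  then show "w j = LP \<or> w j = LN \<and> (w (j + 1) = LS \<or> w (j + 1) = LQ) \<or> (\<exists>q. plain q \<and> c q < j \<and> r q = j)"
    using B(11) Bk kk by blast
qed

text \<open>Every need except that of \<open>LQ\<close> asks for a next letter. Dually,
  \<open>w_first\<close> rests on every need except that of \<open>LP\<close> asking for a previous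
  one.\<close>

lemma w_last: "w N = LQ"
  using next_facts(1)[of N] N_pos by auto

lemma w_first: "w 1 = LP"
proof (rule ccontr)
  assume ne: "w 1 \<noteq> LP"
  have s: "met X v (w 1) (b 1)" using N_pos by (intro met_b) auto
  obtain B y where B: "B \<subseteq> X" "letter v B y" "\<forall>e\<in>B. \<forall>a\<in>b 1. e < a"
    by (rule met_prev[OF s ne])
  obtain k where k: "k \<in> {1..N}" "B = b k" "w k = y" by (rule letter_b[OF B(1,2)])
  then show False using bH[of k 1] N_pos B(3) by auto
qed

lemma N_ge2: "2 \<le> N"
  using w_last w_first N_pos by (cases "N = 1") auto

lemma w_inner: "1 \<le> j \<Longrightarrow> j < N \<Longrightarrow> w j \<noteq> LQ" "1 < j \<Longrightarrow> j \<le> N \<Longrightarrow> w j \<noteq> LP"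
  using no_inner_LQ[of j N] no_inner_LP[of 1 j] by auto

text \<open>Note the shift: \<open>linker j\<close> certifies that letters \<open>j\<close> and
  \<open>j + 1\<close> are consecutive but sits in column \<open>j + 1\<close>, so column
  \<open>j\<close> holds \<open>linker (j - 1)\<close> and \<open>pointer j\<close>.\<close>

definition "linker j = (SOME z. plain z \<and> c z = j + 1 \<and> r z = j - 1)"
definition "pointer j = (SOME p. plain p \<and> c p = j \<and> j + 1 \<le> r p)"

lemma linker: assumes "1 \<le> j" "j < N" shows "plain (linker j)" "c (linker j) = j + 1" "r (linker j) = j - 1"
  using someI_ex[OF next_facts(2)[of j]] w_inner(1)[OF assms] assms unfolding linker_def by auto

lemma pointer: assumes "1 \<le> j" "j < N" shows "plain (pointer j)" "c (pointer j) = j" "j + 1 \<le> r (pointer j)"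
  using someI_ex[OF next_facts(3)[of j]] w_inner(1)[OF assms] assms unfolding pointer_def by auto

lemma row_pointer:
  assumes "1 < j" "j < N" "w j = LS \<or> w (j + 1) = LN" shows "\<exists>q. plain q \<and> c q < j \<and> r q = j"
  using next_facts(4)[of j] w_inner(1)[of j] w_inner(2)[of j] assms by auto

lemma w_after: assumes "1 \<le> j" "j < N" "w j = LP \<or> w j = LS" shows "w (j + 1) = LN"
proof -
  have "\<not> (w (j + 1) = LS \<or> w (j + 1) = LQ)"
    using no_rule[of "[Lt {LP, LS}, Lt {LS, LQ}, Pt]" "adj 0 1 2" "[b j, b (j + 1), {linker j}]"] assms linker[of j]
    by (auto simp del: item_ok.simps simp add: rule_simps rules_def adj_def)
  then show ?thesis using w_inner(2)[of "j + 1"] assms by (cases "w (j + 1)") auto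
qed

lemma bottom_unique:
  assumes "plain z" "plain z'" "r z = 0" "r z' = 0" shows "z = z'"
  using no_rule[of "[Lt {LP}, Pt, Pt]" "[V 1 0, V 2 0, D 1 2]" "[b 1, {z}, {z'}]"] assms w_first N_pos
  by (auto simp del: item_ok.simps simp add: rule_simps rules_def)

lemma right_unique:
  assumes "plain z" "plain z'" "c z = N" "c z' = N" shows "z = z'"
  using no_rule[of "[Lt {LQ}, Pt, Pt]" "[H 0 1, H 0 2, D 1 2]" "[b N, {z}, {z'}]"] assms w_last N_pos
  by (auto simp del: item_ok.simps simp add: rule_simps rules_def)

lemma left_empty: "plain z \<Longrightarrow> 1 \<le> c z"
  using no_rule[of "[Lt {LP}, Pt]" "[H 1 0]" "[b 1, {z}]"] w_first N_pos
  by (force simp del: item_ok.simps simp add: rule_simps rules_def)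

text \<open>In column \<open>N\<close> no next letter delimits the gap, so the rule about points to
  the right of \<open>LQ\<close> takes over.\<close>

lemma lower_unique:
  assumes "plain z" "plain z'" "c z = j" "c z' = j" "r z < j" "r z' < j" "1 \<le> j" shows "z = z'"
proof (cases "j = N")
  case True then show ?thesis using right_unique assms by blast
next
  case False
  then have "j < N" using assms c_le[of z] by simp
  then show ?thesis
    using no_rule[of "[Any, Any, Pt, Pt, Pt]" "adj 0 1 2 @ [H 0 3, H 3 1, V 3 0, H 0 4, H 4 1, V 4 0, D 3 4]"
      "[b j, b (j + 1), {linker j}, {z}, {z'}]"] assms linker[of j]
    by (auto simp del: item_ok.simps simp add: rule_simps rules_def adj_def)
qed

lemma upper_unique:
  assumes "plain z" "plain z'" "c z = j" "c z' = j" "j < r z" "j < r z'" "1 \<le> j" shows "z = z'"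
proof -
  have "j < N" using assms r_le[of z] by simp
  then show ?thesis
    using no_rule[of "[Any, Any, Pt, Pt, Pt]" "adj 0 1 2 @ [H 0 3, H 3 1, V 1 3, H 0 4, H 4 1, V 1 4, D 3 4]"
      "[b j, b (j + 1), {linker j}, {z}, {z'}]"] assms linker[of j]
    by (auto simp del: item_ok.simps simp add: rule_simps rules_def adj_def)
qed

lemma no_central: "plain z \<Longrightarrow> c z \<noteq> r z"
proof
  assume z: "plain z" and e: "c z = r z"
  have c1: "1 \<le> c z" using left_empty[OF z] .
  show False
  proof (cases "c z = N")
    case True
    \<comment> \<open>To the right of the last letter only \<open>linker (N - 1)\<close> exists, and
      it lies in row \<open>N - 2\<close>.\<close>
    have "z = linker (N - 1)" by (rule right_unique) (use True z linker[of "N - 1"] N_ge2 in auto)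
    then show False using linker(2,3)[of "N - 1"] N_ge2 e by simp
  next
    case False
    then have "c z < N" using c_le[of z] by simp
    then show False
      using no_rule[of "[Any, Any, Pt, Pt]" "adj 0 1 2 @ [H 0 3, H 3 1, V 0 3, V 3 1]"
        "[b (c z), b (c z + 1), {linker (c z)}, {z}]"] c1 z e linker[of "c z"]
      by (auto simp del: item_ok.simps simp add: rule_simps rules_def adj_def)
  qed
qed

text \<open>In each column there is at most one point below the diagonal, which must be the linker,
  at most one above it, which must be the pointer, and none on it. Column 1 has no linker, since
  \<open>linker 1\<close> in column 2 is already the only point below the first letter.\<close>

lemma plain_cases:
  assumes "plain z"
  shows "(2 \<le> c z \<and> z = linker (c z - 1)) \<or> (1 \<le> c z \<and> c z < N \<and> z = pointer (c z))"
proof (cases "r z < c z")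
  case True
  have c1: "1 \<le> c z" "c z \<le> N" using left_empty[OF assms] c_le[of z] by simp_all
  have "c z \<noteq> 1"
  proof
    assume "c z = 1"
    then have "r z = 0" using True by simp
    have "z = linker 1" by (rule bottom_unique) (use \<open>r z = 0\<close> assms linker[of 1] N_ge2 in auto)
    with \<open>c z = 1\<close> show False using linker(2)[of 1] N_ge2 by simp
  qed
  then have c2: "2 \<le> c z" using c1 by simp
  have "z = linker (c z - 1)"
    by (rule lower_unique[OF assms]) (use True c1 c2 linker[of "c z - 1"] in auto)
  then show ?thesis using c2 by simp
next
  case False
  then have u: "c z < r z" using no_central[OF assms] by simp
  have c1: "1 \<le> c z" "c z < N" using left_empty[OF assms] u r_le[of z] by auto
  have "z = pointer (c z)"
    by (rule upper_unique[OF assms]) (use u c1 pointer[of "c z"] in auto)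
  then show ?thesis using c1 by simp
qed

lemma plain_ne: "plain z \<Longrightarrow> plain z' \<Longrightarrow> z \<noteq> z' \<Longrightarrow> v z \<noteq> v z'"
  using inj_on_eq_iff[OF inj] plain_X by blast

lemma pointer_mono:
  assumes "1 \<le> i" "i < j" "j < N" shows "v (pointer i) < v (pointer j)"
proof (rule ccontr)
  have ij: "i < N" "1 \<le> j" using assms by auto
  note p = pointer[OF assms(1) ij(1)] pointer[OF ij(2) assms(3)]
  have "pointer i \<noteq> pointer j" using p(2,5) assms(2) by auto
  then have "v (pointer i) \<noteq> v (pointer j)" by (rule plain_ne[OF p(1,4)])
  moreover assume "\<not> v (pointer i) < v (pointer j)"
  ultimately have "v (pointer j) < v (pointer i)" by simp
  then show False
    using no_rule[of "[Pt, Any, Pt, Any]" "[H 0 1, H 1 2, H 2 3, V 2 0, V 3 2]" "[{pointer i}, b j, {pointer j}, b (j + 1)]"]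
      assms p by (auto simp del: item_ok.simps simp add: rule_simps rules_def)
qed

lemma row_empty:
  assumes "1 \<le> i" "i < N" "r (pointer i) = j" "j < N" shows "w (j + 1) = LN"
proof -
  have "\<not> (w (j + 1) = LS \<or> w (j + 1) = LQ)"
    using no_rule[of "[Any, Lt {LS, LQ}, Pt, Pt]" "adj 0 1 2 @ [H 3 0, V 0 3, V 3 1]" "[b j, b (j + 1), {linker j}, {pointer i}]"]
      assms linker[of j] pointer[of i]
    by (auto simp del: item_ok.simps simp add: rule_simps rules_def adj_def)
  then show ?thesis using w_inner(2)[of "j + 1"] assms pointer(3)[of i] by (cases "w (j + 1)") auto
qed

lemma row_unique:
  assumes "1 \<le> i" "i < N" "1 \<le> k" "k < N" "r (pointer i) = j" "r (pointer k) = j" "j < N" shows "i = k"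
proof -
  have "pointer i = pointer k"
  proof (rule ccontr)
    assume ne: "pointer i \<noteq> pointer k"
    then show False using ne[symmetric] no_rule[of "[Any, Any, Pt, Pt, Pt]" "adj 0 1 2 @ [H 3 0, V 0 3, V 3 1, H 4 0, V 0 4, V 4 1, D 3 4]"
      "[b j, b (j + 1), {linker j}, {pointer i}, {pointer k}]"] assms linker[of j] pointer[of i] pointer[of k]
      by (auto simp del: item_ok.simps simp add: rule_simps rules_def adj_def)
  qed
  then show ?thesis using pointer(2) assms by metis
qed

lemma pointer_label:
  assumes "1 \<le> i" "i < N" "r (pointer i) = j" "j < N" shows "w i = LN \<longleftrightarrow> w j = LN"
proof
  note p = pointer[of i]
  have j: "i < j" using p assms by simp
  have w: "w i \<noteq> LQ" "w j \<noteq> LQ" "w j \<noteq> LP" using w_inner j assms by auto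
  let ?cs = "adj 0 1 2 @ adj 3 4 5 @ [H 0 6, H 6 1, V 3 6, V 6 4, H 6 3]"
  let ?Bs = "[b i, b (i + 1), {linker i}, b j, b (j + 1), {linker j}, {pointer i}]"
  {
    assume a: "w i = LN"
    then have "w j \<noteq> LS"
      using no_rule[of "[Lt {LN}, Any, Pt, Lt {LS}, Any, Pt, Pt]" ?cs ?Bs] assms linker[of i] linker[of j] p j
      by (auto simp del: item_ok.simps simp add: rule_simps rules_def adj_def)
    then show "w j = LN" using w by (cases "w j") auto
  }
  {
    assume a: "w j = LN"
    then have "\<not> (w i = LP \<or> w i = LS)"
      using no_rule[of "[Lt {LP, LS}, Any, Pt, Lt {LN}, Any, Pt, Pt]" ?cs ?Bs] assms linker[of i] linker[of j] p j
      by (auto simp del: item_ok.simps simp add: rule_simps rules_def adj_def)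
    then show "w i = LN" using w by (cases "w i") auto
  }
qed

lemma pointer_exit:
  assumes "1 \<le> i" "i + 1 < N" "r (pointer i) < N" "r (pointer (i + 1)) = N" shows "w (i + 1) \<noteq> LN"
  using no_rule[of "[Any, Lt {LN}, Pt, Any, Pt, Pt, Pt, Lt {LQ}]"
       "adj 0 1 2 @ adj 1 3 4 @ [H 0 5, H 5 1, V 1 5, V 5 7, H 1 6, H 6 3, V 7 6]"
       "[b i, b (i + 1), {linker i}, b (i + 2), {linker (i + 1)}, {pointer i}, {pointer (i + 1)}, b N]"]
    assms linker[of i] linker[of "i + 1"] pointer[of i] pointer[of "i + 1"] w_last
  by (auto simp del: item_ok.simps simp add: rule_simps rules_def adj_def)

text \<open>Cell coordinates do not order two points of the same column, so a rule of its own is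
  needed here; \<open>linker_below_pointer\<close> does the same for a row.\<close>

lemma linker_left_pointer:
  assumes "2 \<le> j" "j < N" shows "linker (j - 1) < pointer j"
proof (rule ccontr)
  assume "\<not> linker (j - 1) < pointer j"
  moreover have "linker (j - 1) \<noteq> pointer j" using linker(3)[of "j - 1"] pointer(3)[of j] assms by auto
  ultimately have "pointer j < linker (j - 1)" by simp
  then show False
    using no_rule[of "[Any, Any, Pt, Pt, Pt]" "adj 0 1 2 @ [H 0 4, H 4 3, H 3 1, V 3 0, V 0 4, V 1 4]"
      "[b j, b (j + 1), {linker j}, {linker (j - 1)}, {pointer j}]"] assms linker[of j] linker[of "j - 1"] pointer[of j]
    by (auto simp del: item_ok.simps simp add: rule_simps rules_def adj_def)
qed

lemma linker_below_pointer:
  assumes "1 \<le> i" "i < N" "r (pointer i) = j" "j + 1 < N" shows "v (linker (j + 1)) < v (pointer i)"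
proof (rule ccontr)
  note p = pointer[of i] linker[of "j + 1"]
  assume "\<not> v (linker (j + 1)) < v (pointer i)"
  moreover have "linker (j + 1) \<noteq> pointer i" using p assms by auto
  ultimately have "v (linker (j + 1)) \<noteq> v (pointer i)" "\<not> v (linker (j + 1)) < v (pointer i)"
    using plain_ne[of "linker (j + 1)" "pointer i"] p assms by auto
  then have "v (pointer i) < v (linker (j + 1))" by simp
  then show False
    using no_rule[of "[Any, Any, Pt, Pt, Pt]" "adj 0 1 2 @ [H 3 0, V 0 3, V 3 1, H 1 4, V 0 4, V 4 1, V 3 4]"
      "[b j, b (j + 1), {linker j}, {pointer i}, {linker (j + 1)}]"] assms linker[of j] p
    by (auto simp del: item_ok.simps simp add: rule_simps rules_def adj_def)
qed

lemma plain_less: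
  assumes "plain z" "plain z'"
  shows "c z < c z' \<Longrightarrow> z < z'" "r z < r z' \<Longrightarrow> v z < v z'"
proof -
  assume "c z < c z'"
  moreover have "c z' \<le> N" by (rule c_le)
  moreover obtain a where "a \<in> b (c z')" using b_ne[of "c z'"] calculation by auto
  ultimately show "z < z'" using pc(1)[OF assms(2), of "c z'"] pc(2)[OF assms(1), of "c z'"] by fastforce
next
  assume "r z < r z'"
  moreover have "r z' \<le> N" by (rule r_le)
  moreover obtain a where "a \<in> b (r z')" using b_ne[of "r z'"] calculation by auto
  ultimately show "v z < v z'" using pc(3)[OF assms(2), of "r z'"] pc(4)[OF assms(1), of "r z'"] by fastforce
qed

end

section \<open>Laps and targets of pointers\<close>

text \<open>The \<open>d\<close>-th letter of lap \<open>t\<close> has index \<open>tri t + d\<close>; its pointer targets the row above letter \<open>tri (Suc t) + d\<close>.\<close>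

definition triangular :: "nat \<Rightarrow> bool" where "triangular j \<longleftrightarrow> (\<exists>t. j = tri t)"

text \<open>\<open>lap c\<close> counts the positive triangular numbers up to
  \<open>c\<close>.\<close>

primrec lap :: "nat \<Rightarrow> nat" where
  "lap 0 = 0"
| "lap (Suc c) = (if triangular (Suc c) then Suc (lap c) else lap c)"

definition target :: "nat \<Rightarrow> nat" where "target c = c + lap c + 1"

text \<open>The triangular number following \<open>tri t\<close> is
  \<open>tri t + t + 1\<close>.\<close>

lemma triangular_offset: assumes "d \<le> t" shows "triangular (tri t + d) \<longleftrightarrow> d = 0"
proof
  assume "triangular (tri t + d)"
  then obtain s where s: "tri t + d = tri s" unfolding triangular_def by blast
  have "s \<le> t" using tri_mono[of "Suc t" s] s assms by (cases "s \<le> t") auto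
  then show "d = 0" using tri_mono[of s t] s by simp
qed (auto simp: triangular_def)

lemma lap_offset: "d \<le> t \<Longrightarrow> lap (tri t + d) = t"
proof (induction t arbitrary: d)
  case (Suc t)
  have z: "lap (tri (Suc t)) = Suc t"
    using Suc.IH[of t] triangular_offset[of 0 "Suc t"] by simp
  show ?case using Suc.prems
  proof (induction d)
    case (Suc d)
    then show ?case using triangular_offset[of "Suc d" "Suc t"] by simp
  qed (use z in simp)
qed simp

lemma tri_decomp: obtains t d where "d \<le> t" "c = tri t + d"
proof -
  have "\<exists>t d. d \<le> t \<and> c = tri t + d"
  proof (induction c)
    case 0 show ?case by (intro exI[of _ 0]) simp
  next
    case (Suc c)
    then obtain t d where td: "d \<le> t" "c = tri t + d" by blast
    show ?case
    proof (cases "d = t")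
      case True
      then have "0 \<le> Suc t \<and> Suc c = tri (Suc t) + 0" using td by simp
      then show ?thesis by blast
    next
      case False
      then have "Suc d \<le> t \<and> Suc c = tri t + Suc d" using td by simp
      then show ?thesis by blast
    qed
  qed
  then show thesis using that by blast
qed

lemma target_offset: "d \<le> t \<Longrightarrow> target (tri t + d) = tri (Suc t) + d"
  unfolding target_def using lap_offset by simp

lemma lap_mono: "lap c \<le> lap (c + k)"
  by (induction k) auto

lemma target_mono: "c < c' \<Longrightarrow> target c < target c'"
  unfolding target_def using lap_mono[of c "c' - c"] by simp

text \<open>When letter \<open>c + 1\<close> begins a new lap, its target skips one row, namely the
  row just below the special letter with index \<open>target c + 2\<close>.\<close>

lemma target_step:
  assumes "1 \<le> c"
  shows "triangular (c + 1) \<longleftrightarrow> triangular (target c + 2)"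
    "target (c + 1) = (if triangular (c + 1) then target c + 2 else target c + 1)"
    "triangular (c + 1) \<Longrightarrow> \<not> triangular (target c + 3)"
proof -
  obtain t d where td: "d \<le> t" "c = tri t + d" by (rule tri_decomp)
  have t: "1 \<le> t" using assms td by (cases t) auto
  have n: "target c = tri (Suc t) + d" using target_offset td by simp
  show "target (c + 1) = (if triangular (c + 1) then target c + 2 else target c + 1)" unfolding target_def by simp
  have a: "triangular (c + 1) \<longleftrightarrow> d = t"
    using triangular_offset[of "d + 1" t] triangular_offset[of 0 "Suc t"] td by (cases "d = t") auto
  have b: "triangular (target c + 2) \<longleftrightarrow> d = t"
  proof (cases "d = t")
    case True
    then have "target c + 2 = tri (Suc (Suc t))" using n by simp
    then show ?thesis using True unfolding triangular_def by blast
  next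
    case False
    then have "d + 2 \<le> Suc t" using td by simp
    then show ?thesis using triangular_offset[of "d + 2" "Suc t"] n False by simp
  qed
  show "triangular (c + 1) \<longleftrightarrow> triangular (target c + 2)" using a b by simp
  assume "triangular (c + 1)"
  then have e: "target c + 3 = tri (Suc (Suc t)) + 1" using n a by simp
  have "\<not> triangular (tri (Suc (Suc t)) + 1)" using triangular_offset[of 1 "Suc (Suc t)"] by (simp del: tri.simps)
  then show "\<not> triangular (target c + 3)" unfolding e .
qed

definition label :: "nat \<Rightarrow> nat \<Rightarrow> lab" where
  "label m j = (if j = 1 then LP else if j = tri m then LQ else if triangular j then LS else LN)"

text \<open>A point of the model has position \<open>10 * j + o\<close>: the digit \<open>o\<close> is below 7 for the points of the \<open>j\<close>-th letter,
  8 for a linker and 9 for a pointer.\<close>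

definition model :: "nat \<Rightarrow> nat set" where
  "model m = {x. 1 \<le> x div 10 \<and> x div 10 \<le> tri m \<and>
     (x mod 10 < 7 \<or> x mod 10 = 8 \<and> 2 \<le> x div 10 \<or> x mod 10 = 9 \<and> x div 10 < tri m)}"

definition mval :: "nat \<Rightarrow> nat \<Rightarrow> nat" where
  "mval m x = (if x mod 10 < 7 then 10 * (x div 10) + blk (label m (x div 10)) ! (x mod 10)
     else if x mod 10 = 8 then 10 * (x div 10 - 2) + 8 else 10 * target (x div 10) + 9)"

section \<open>The sweep that determines labels and pointer rows\<close>

context survivor begin

lemma pointer_row_mono: assumes "1 \<le> i" "i \<le> j" "j < N" shows "r (pointer i) \<le> r (pointer j)"
proof (cases "i = j")
  case False
  then have "v (pointer i) < v (pointer j)" using pointer_mono assms by simp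
  then show ?thesis using plain_less(2)[of "pointer j" "pointer i"] pointer(1)[of i] pointer(1)[of j] assms by fastforce
qed simp

text \<open>The point supplied by the need lies above the diagonal, so it is a pointer and not a
  linker.\<close>

lemma row_pointer_ex:
  assumes "1 < j" "j < N" "w j = LS \<or> w (j + 1) = LN"
  obtains i where "1 \<le> i" "i < j" "r (pointer i) = j"
proof -
  obtain q where q: "plain q" "c q < j" "r q = j" using row_pointer[OF assms] by blast
  have "q \<noteq> linker (c q - 1) \<or> c q < 2" using linker(3)[of "c q - 1"] q c_le[of q] by (cases "c q < 2") auto
  then have "1 \<le> c q" "q = pointer (c q)" using plain_cases[OF q(1)] by auto
  then show thesis using that q by metis
qed

text \<open>The state of the sweep after \<open>e\<close> pointers. Labels are known one step past
  \<open>target e\<close>, because a pointer in that row forces the letter above it to be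
  \<open>LN\<close>.\<close>

definition "inv_upto e \<longleftrightarrow> 1 \<le> e \<and> target e < N \<and> (\<forall>i. 1 \<le> i \<and> i \<le> e \<longrightarrow> r (pointer i) = target i) \<and>
   (\<forall>j. 2 \<le> j \<and> j \<le> target e + 1 \<longrightarrow> (w j = LN \<longleftrightarrow> \<not> triangular j))"

text \<open>A pointer whose target would pass the last letter merely lies above that letter, in row
  \<open>N\<close>; hence the minimum.\<close>

definition "determined \<longleftrightarrow> triangular N \<and> (\<forall>i. 1 \<le> i \<and> i < N \<longrightarrow> r (pointer i) = min N (target i)) \<and>
   (\<forall>j. 2 \<le> j \<and> j \<le> N \<longrightarrow> (w j = LN \<longleftrightarrow> \<not> triangular j))"

lemma target_ge: "i + 1 \<le> target i"
  unfolding target_def by simp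

text \<open>The label of letter \<open>j + 2\<close>, where \<open>j = target e\<close>, decides the
  row of pointer \<open>e + 1\<close>. That pointer relates the already known label of letter
  \<open>e + 1\<close> to the new one, which shows that the new label is the right one.\<close>

lemma inv_step:
  assumes "inv_upto e" shows "inv_upto (e + 1) \<or> determined"
proof -
  have e1: "1 \<le> e" and jN: "target e < N"
    and rows: "\<And>i. 1 \<le> i \<Longrightarrow> i \<le> e \<Longrightarrow> r (pointer i) = target i"
    and labs: "\<And>j. 2 \<le> j \<Longrightarrow> j \<le> target e + 1 \<Longrightarrow> (w j = LN \<longleftrightarrow> \<not> triangular j)"
    using assms unfolding inv_upto_def by auto
  define j where "j = target e"
  have rj: "r (pointer e) = j" using rows e1 j_def by simp
  have eN: "e + 1 < N" "e + 1 \<le> j" using target_ge[of e] jN j_def by auto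
  have w1: "w (j + 1) = LN" using row_empty[OF e1 _ rj] eN jN j_def by simp
  have j2: "j + 2 \<le> N"
  proof -
    have "j + 1 \<noteq> N" using w1 w_last by auto
    then show ?thesis using jN j_def by simp
  qed
  have next_ge: "j < r (pointer (e + 1))"
  proof -
    have "r (pointer e) \<le> r (pointer (e + 1))" using pointer_row_mono[of e "e + 1"] e1 eN by simp
    moreover have "r (pointer (e + 1)) \<noteq> j" using row_unique[of e "e + 1" j] e1 eN rj jN j_def by auto
    ultimately show ?thesis using rj by simp
  qed
  \<comment> \<open>By monotonicity a pointer in a row above \<open>j\<close> is not among the first
    \<open>e\<close>, so pointer \<open>e + 1\<close> cannot have overshot that row.\<close>
  have hit: "r (pointer (e + 1)) \<le> k" if k: "1 \<le> i" "i < N" "r (pointer i) = k" "j < k" for i k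
  proof -
    have "\<not> i \<le> e" using pointer_row_mono[of i e] k e1 eN rj by auto
    then show ?thesis using pointer_row_mono[of "e + 1" i] k by simp
  qed
  have st: "triangular (e + 1) \<longleftrightarrow> triangular (j + 2)" "target (e + 1) = (if triangular (e + 1) then j + 2 else j + 1)"
    "triangular (e + 1) \<Longrightarrow> \<not> triangular (j + 3)"
    using target_step[OF e1] unfolding j_def by auto
  have labe: "w (e + 1) = LN \<longleftrightarrow> \<not> triangular (e + 1)"
    using labs[of "e + 1"] e1 eN unfolding j_def by auto
  have "w (j + 2) \<noteq> LP" using w_inner(2)[of "j + 2"] j2 by simp
  then consider "w (j + 2) = LN" | "w (j + 2) = LS" | "w (j + 2) = LQ" by (cases "w (j + 2)") auto
  then show ?thesis
  proof cases
    case 1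
    then have "j + 2 \<noteq> N" using w_last by auto
    then have lt: "j + 2 < N" using j2 by simp
    have w2: "w (j + 1 + 1) = LN" using 1 by (simp add: numeral_2_eq_2)
    \<comment> \<open>An \<open>LN\<close> followed by \<open>LN\<close> is not exempt: its need
      supplies a pointer in row \<open>j + 1\<close>.\<close>
    obtain i where i: "1 \<le> i" "i < j + 1" "r (pointer i) = j + 1"
      by (rule row_pointer_ex[of "j + 1"]) (use w2 lt eN e1 in auto)
    have rn: "r (pointer (e + 1)) = j + 1" using hit[of i "j + 1"] i lt next_ge by simp
    have "w (e + 1) = LN" using pointer_label[of "e + 1" "j + 1"] rn w1 lt eN by simp
    then have nt: "\<not> triangular (e + 1)" using labe by simp
    have "target (e + 1) = j + 1" using st nt by simp
    moreover have "r (pointer i) = target i" if "1 \<le> i" "i \<le> e + 1" for i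
      using rows[of i] rn calculation that by (cases "i = e + 1") auto
    moreover have "w k = LN \<longleftrightarrow> \<not> triangular k" if "2 \<le> k" "k \<le> j + 2" for k
      using labs[of k] 1 st nt that j_def by (cases "k = j + 2") auto
    ultimately have "inv_upto (e + 1)" unfolding inv_upto_def using lt by (simp add: numeral_2_eq_2)
    then show ?thesis by simp
  next
    case 2
    then have "j + 2 \<noteq> N" using w_last by auto
    then have lt: "j + 2 < N" using j2 by simp
    obtain i where i: "1 \<le> i" "i < j + 2" "r (pointer i) = j + 2"
      by (rule row_pointer_ex[of "j + 2"]) (use 2 lt in auto)
    have le: "r (pointer (e + 1)) \<le> j + 2" using hit[of i "j + 2"] i lt by simp
    \<comment> \<open>The row just below an \<open>LS\<close> has no pointer, so this one has to
      skip it.\<close>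
    have "r (pointer (e + 1)) \<noteq> j + 1"
      using row_empty[of "e + 1" "j + 1"] eN lt 2 by (auto simp: numeral_2_eq_2)
    then have rn: "r (pointer (e + 1)) = j + 2" using le next_ge by simp
    have "w (e + 1) \<noteq> LN" using pointer_label[of "e + 1" "j + 2"] rn 2 lt eN by simp
    then have nt: "triangular (e + 1)" using labe by simp
    have "target (e + 1) = j + 2" using st nt by simp
    moreover have "r (pointer i) = target i" if "1 \<le> i" "i \<le> e + 1" for i
      using rows[of i] rn calculation that by (cases "i = e + 1") auto
    moreover have "w (j + 3) = LN" using w_after[of "j + 2"] 2 lt by (simp add: numeral_3_eq_3)
    moreover have "w k = LN \<longleftrightarrow> \<not> triangular k" if kk: "2 \<le> k" "k \<le> j + 3" for k
    proof -
      consider "k \<le> j + 1" | "k = j + 2" | "k = j + 3" using kk by linarith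
      then show ?thesis using labs[of k] 2 st nt kk j_def calculation by cases auto
    qed
    ultimately have "inv_upto (e + 1)" unfolding inv_upto_def using lt by (simp add: numeral_3_eq_3)
    then show ?thesis by simp
  next
    case 3
    then have jN2: "j + 2 = N" using w_inner(1)[of "j + 2"] j2 by fastforce
    have "r (pointer (e + 1)) \<noteq> j + 1"
      using row_empty[of "e + 1" "j + 1"] eN jN2 3 by (auto simp: numeral_2_eq_2)
    then have rn: "r (pointer (e + 1)) = N" using next_ge r_le[of "pointer (e + 1)"] jN2 by simp
    \<comment> \<open>The first pointer to pass the last letter belongs to a special letter. Hence
      \<open>e + 1\<close> is triangular, and with it \<open>N = j + 2\<close>.\<close>
    have "w (e + 1) \<noteq> LN" using pointer_exit[of e] e1 eN rj rn jN j_def by simp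
    then have nt: "triangular (e + 1)" using labe by simp
    have nn: "target (e + 1) = N" using st nt jN2 by simp
    have "r (pointer i) = min N (target i)" if i: "1 \<le> i" "i < N" for i
    proof (cases "i \<le> e")
      case True
      then have "target i \<le> target e" using target_mono[of i e] by (cases "i = e") auto
      then show ?thesis using rows[of i] i True jN by simp
    next
      case False
      then have "N \<le> target i" using target_mono[of "e + 1" i] nn by (cases "i = e + 1") auto
      moreover have "N \<le> r (pointer i)" using pointer_row_mono[of "e + 1" i] rn i False by simp
      ultimately show ?thesis using r_le[of "pointer i"] by simp
    qed
    moreover have "w k = LN \<longleftrightarrow> \<not> triangular k" if kk: "2 \<le> k" "k \<le> N" for k
    proof -
      consider "k \<le> j + 1" | "k = j + 2" using kk jN2 by linarith
      then show ?thesis using labs[of k] 3 st nt kk j_def by cases auto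
    qed
    moreover have "triangular N" using st nt jN2 by simp
    ultimately show ?thesis unfolding determined_def by blast
  qed
qed

lemma triangular_small: "\<not> triangular 2" "triangular 3" "\<not> triangular 4"
  using triangular_offset[of 1 1] triangular_offset[of 0 2] triangular_offset[of 1 2] by (auto simp: numeral_2_eq_2 numeral_3_eq_3 eval_nat_numeral)

lemma target_small: "target 1 = 3" "target 2 = 4"
  using target_offset[of 0 1] target_offset[of 1 1] by (auto simp: eval_nat_numeral)

text \<open>The same case distinction for pointer 1, on the label of letter 3. Here
  \<open>LN\<close> is impossible: pointer 1 would have to enter row 2 and match the special letter
  1 with the \<open>LN\<close> at 2.\<close>

lemma inv_start: "inv_upto 1 \<or> determined"
proof -
  have w2: "w 2 = LN" using w_after[of 1] w_first N_ge2 by (simp add: numeral_2_eq_2)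
  then have "N \<noteq> 2" using w_last by auto
  then have N3: "3 \<le> N" using N_ge2 by simp
  have r1: "2 \<le> r (pointer 1)" using pointer(3)[of 1] N3 by simp
  have r2: "3 \<le> r (pointer 2)" using pointer(3)[of 2] N3 by simp
  have "w 3 \<noteq> LP" using w_inner(2)[of 3] N3 by simp
  then consider "w 3 = LN" | "w 3 = LS" | "w 3 = LQ" by (cases "w 3") auto
  then show ?thesis
  proof cases
    case 1
    then have "N \<noteq> 3" using w_last by auto
    then have lt: "3 < N" using N3 by simp
    obtain i where i: "1 \<le> i" "i < 2" "r (pointer i) = 2"
      by (rule row_pointer_ex[of 2]) (use 1 lt in auto)
    then have "r (pointer 1) = 2" by (metis One_nat_def Suc_1 le_antisym less_Suc_eq_le)
    then have False using pointer_label[of 1 2] w_first w2 lt by simp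
    then show ?thesis by simp
  next
    case 2
    then have "N \<noteq> 3" using w_last by auto
    then have lt: "3 < N" using N3 by simp
    obtain i where i: "1 \<le> i" "i < 3" "r (pointer i) = 3"
      by (rule row_pointer_ex[of 3]) (use 2 lt in auto)
    have "r (pointer 1) \<le> 3" using pointer_row_mono[of 1 i] i lt by simp
    moreover have "r (pointer 1) \<noteq> 2" using row_empty[of 1 2] 2 lt by auto
    ultimately have rn: "r (pointer 1) = 3" using r1 by simp
    have w4: "w 4 = LN" using w_after[of 3] 2 lt by simp
    have "w k = LN \<longleftrightarrow> \<not> triangular k" if kk: "2 \<le> k" "k \<le> 4" for k
    proof -
      consider "k = 2" | "k = 3" | "k = 4" using kk by linarith
      then show ?thesis using 2 w2 w4 triangular_small by cases auto
    qed
    moreover have "r (pointer i) = target i" if "1 \<le> i" "i \<le> 1" for i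
    proof -
      have "i = 1" using that by simp
      then show ?thesis using rn target_small by simp
    qed
    moreover have "target 1 < N" "target 1 + 1 = 4" using lt target_small(1) by simp_all
    ultimately have "inv_upto 1" unfolding inv_upto_def by auto
    then show ?thesis by simp
  next
    case 3
    then have N: "N = 3" using w_inner(1)[of 3] N3 by fastforce
    have "r (pointer 1) \<noteq> 2" using row_empty[of 1 2] 3 N by auto
    then have rn: "r (pointer 1) = 3" "r (pointer 2) = 3" using r1 r2 r_le[of "pointer 1"] r_le[of "pointer 2"] N by auto
    have "r (pointer i) = min N (target i)" if ii: "1 \<le> i" "i < N" for i
    proof -
      consider "i = 1" | "i = 2" using ii N by linarith
      then show ?thesis using rn N target_small by cases auto
    qed
    moreover have "w k = LN \<longleftrightarrow> \<not> triangular k" if kk: "2 \<le> k" "k \<le> N" for k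
    proof -
      consider "k = 2" | "k = 3" using kk N by linarith
      then show ?thesis using 3 w2 triangular_small by cases auto
    qed
    moreover have "triangular N" using N triangular_small(2) by simp
    ultimately have determined unfolding determined_def by simp
    then show ?thesis by simp
  qed
qed

text \<open>Every state of the sweep has \<open>e < target e < N\<close>, so the sweep cannot
  continue forever.\<close>

lemma determined: determined
proof -
  have "determined" if "inv_upto e" for e
    using that
  proof (induction "N - e" arbitrary: e rule: less_induct)
    case less
    have "e < N" using less.prems target_ge[of e] unfolding inv_upto_def by simp
    then show ?case using inv_step[OF less.prems] less.hyps[of "e + 1"] by auto
  qed
  then show ?thesis using inv_start by blast
qed

lemma shape:
  obtains m where "2 \<le> m" "N = tri m" "\<And>j. 1 \<le> j \<Longrightarrow> j \<le> N \<Longrightarrow> w j = label m j"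
    "\<And>i. 1 \<le> i \<Longrightarrow> i < N \<Longrightarrow> r (pointer i) = min N (target i)"
proof -
  obtain m where m: "N = tri m" using determined unfolding determined_def triangular_def by blast
  have "2 \<le> m"
  proof (rule ccontr)
    assume "\<not> 2 \<le> m"
    then have "m = 0 \<or> m = 1" by auto
    then show False using m N_ge2 by auto
  qed
  moreover have "w j = label m j" if j: "1 \<le> j" "j \<le> N" for j
  proof (cases "j = 1 \<or> j = N")
    case True
    then show ?thesis using w_first w_last m N_ge2 unfolding label_def by auto
  next
    case False
    then have j2: "2 \<le> j" "j < N" using j by auto
    then have l: "w j = LN \<longleftrightarrow> \<not> triangular j" using determined unfolding determined_def by simp
    have "w j \<noteq> LP" "w j \<noteq> LQ" using w_inner[of j] j2 by auto
    then show ?thesis using l False m unfolding label_def by (cases "w j") auto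
  qed
  moreover have "r (pointer i) = min N (target i)" if "1 \<le> i" "i < N" for i
    using determined that unfolding determined_def by blast
  ultimately show thesis using that m by blast
qed

end

section \<open>The model permutation\<close>

lemma blk_range: "i < 7 \<Longrightarrow> 1 \<le> blk x ! i \<and> blk x ! i \<le> 7"
  using nth_mem[of i "blk x"] set_blk[of x] by simp

lemma model_cases:
  assumes "x \<in> model m"
  obtains (letter) j i where "x = 10 * j + i" "1 \<le> j" "j \<le> tri m" "i < 7" "mval m x = 10 * j + blk (label m j) ! i"
  | (link) j where "x = 10 * j + 8" "2 \<le> j" "j \<le> tri m" "mval m x = 10 * (j - 2) + 8"
  | (point) j where "x = 10 * j + 9" "1 \<le> j" "j < tri m" "mval m x = 10 * target j + 9"
proof -
  define j i where "j = x div 10" and "i = x mod 10"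
  have x: "x = 10 * j + i" by (simp add: j_def i_def)
  have h: "1 \<le> j" "j \<le> tri m" "i < 7 \<or> i = 8 \<and> 2 \<le> j \<or> i = 9 \<and> j < tri m"
    using assms unfolding model_def j_def i_def by auto
  have v: "mval m x = (if i < 7 then 10 * j + blk (label m j) ! i else if i = 8 then 10 * (j - 2) + 8 else 10 * target j + 9)"
    unfolding mval_def j_def i_def ..
  from h(3) consider "i < 7" | "i = 8" "2 \<le> j" | "i = 9" "j < tri m" by blast
  then show thesis
  proof cases
    case 1 then show ?thesis using letter[of j i] x h v by simp
  next
    case 2 then show ?thesis using link[of j] x h v by simp
  next
    case 3 then show ?thesis using point[of j] x h v by simp
  qed
qed

lemma in_model:
  "1 \<le> j \<Longrightarrow> j \<le> tri m \<Longrightarrow> i < 7 \<Longrightarrow> 10 * j + i \<in> model m"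
  "2 \<le> j \<Longrightarrow> j \<le> tri m \<Longrightarrow> 10 * j + 8 \<in> model m"
  "1 \<le> j \<Longrightarrow> j < tri m \<Longrightarrow> 10 * j + 9 \<in> model m"
  unfolding model_def by auto

lemma digit_eq: "10 * a + i = 10 * b + j \<Longrightarrow> i < 10 \<Longrightarrow> j < 10 \<Longrightarrow> a = b \<and> i = j" for a b i j :: nat
  by (metis add.commute div_mult_self2 div_less mod_mult_self2 mod_less nat_arith.rule0 zero_neq_numeral)

lemma mval_inj: "inj_on (mval m) (model m)"
proof (rule inj_onI)
  fix x y assume x: "x \<in> model m" and y: "y \<in> model m" and e: "mval m x = mval m y"
  have nuinj: "j = k" if "target j = target k" for j k
    using target_mono[of j k] target_mono[of k j] that by (cases j k rule: linorder_cases) auto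
  from x show "x = y"
  proof (cases rule: model_cases)
    case (letter j i)
    note bi = blk_range[OF letter(4), of "label m j"]
    from y show ?thesis
    proof (cases rule: model_cases)
      case l2: (letter k i2)
      note bi2 = blk_range[OF l2(4), of "label m k"]
      have "j = k \<and> blk (label m j) ! i = blk (label m k) ! i2"
        by (rule digit_eq) (use e letter(5) l2(5) bi bi2 in auto)
      then have "j = k" "i = i2" using distinct_blk[of "label m j"] letter(4) l2(4) by (auto simp: nth_eq_iff_index_eq)
      then show ?thesis using letter(1) l2(1) by simp
    next
      case l2: (link k)
      have "j = k - 2 \<and> blk (label m j) ! i = 8"
        by (rule digit_eq) (use e letter(5) l2(4) bi in auto)
      then show ?thesis using bi by simp
    next
      case l2: (point k)
      have "j = target k \<and> blk (label m j) ! i = 9"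
        by (rule digit_eq) (use e letter(5) l2(4) bi in auto)
      then show ?thesis using bi by simp
    qed
  next
    case (link j)
    from y show ?thesis
    proof (cases rule: model_cases)
      case l2: (letter k i2)
      note bi2 = blk_range[OF l2(4), of "label m k"]
      have "j - 2 = k \<and> 8 = blk (label m k) ! i2"
        by (rule digit_eq) (use e link(4) l2(5) bi2 in auto)
      then show ?thesis using bi2 by simp
    next
      case l2: (link k)
      then show ?thesis using e link by simp
    next
      case l2: (point k)
      have "j - 2 = target k \<and> (8::nat) = 9"
        by (rule digit_eq) (use e link(4) l2(4) in auto)
      then show ?thesis by simp
    qed
  next
    case (point j)
    from y show ?thesis
    proof (cases rule: model_cases)
      case l2: (letter k i2)
      note bi2 = blk_range[OF l2(4), of "label m k"]
      have "target j = k \<and> 9 = blk (label m k) ! i2"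
        by (rule digit_eq) (use e point(4) l2(5) bi2 in auto)
      then show ?thesis using bi2 by simp
    next
      case l2: (link k)
      have "target j = k - 2 \<and> (9::nat) = 8"
        by (rule digit_eq) (use e point(4) l2(4) in auto)
      then show ?thesis by simp
    next
      case l2: (point k)
      have "target j = target k" using e point(4) l2(4) by simp
      then have "j = k" by (rule nuinj)
      then show ?thesis using point(1) l2(1) by simp
    qed
  qed
qed

section \<open>Isomorphism between the model and an arbitrary survivor\<close>

context survivor begin

definition "block_pos j = (SOME f. strict_mono_on {..<7} f \<and> b j = f ` {..<7} \<and>
  (\<forall>i<7. \<forall>k<7. v (f i) < v (f k) \<longleftrightarrow> blk (w j) ! i < blk (w j) ! k))"

lemma block_pos:
  assumes "1 \<le> j" "j \<le> N"
  shows "strict_mono_on {..<7} (block_pos j)" "b j = block_pos j ` {..<7}"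
    "i < 7 \<Longrightarrow> k < 7 \<Longrightarrow> v (block_pos j i) < v (block_pos j k) \<longleftrightarrow> blk (w j) ! i < blk (w j) ! k"
    "i < 7 \<Longrightarrow> block_pos j i \<in> b j"
proof -
  have "pat v (b j) (blk (w j))" using letter_upright b_letter[of j] assms by simp
  then have ex: "\<exists>f. strict_mono_on {..<7} f \<and> b j = f ` {..<7} \<and>
    (\<forall>i<7. \<forall>k<7. v (f i) < v (f k) \<longleftrightarrow> blk (w j) ! i < blk (w j) ! k)"
    unfolding pat_def by simp
  have s: "strict_mono_on {..<7} (block_pos j) \<and> b j = block_pos j ` {..<7} \<and>
    (\<forall>i<7. \<forall>k<7. v (block_pos j i) < v (block_pos j k) \<longleftrightarrow> blk (w j) ! i < blk (w j) ! k)"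
    unfolding block_pos_def by (rule someI_ex[OF ex])
  show "strict_mono_on {..<7} (block_pos j)" using s by (rule conjunct1)
  show bj: "b j = block_pos j ` {..<7}" using s by (rule conjunct1[OF conjunct2])
  show "i < 7 \<Longrightarrow> k < 7 \<Longrightarrow> v (block_pos j i) < v (block_pos j k) \<longleftrightarrow> blk (w j) ! i < blk (w j) ! k" using s by blast
  show "i < 7 \<Longrightarrow> block_pos j i \<in> b j" using bj by blast
qed

definition "place x = (if x mod 10 < 7 then block_pos (x div 10) (x mod 10)
   else if x mod 10 = 8 then linker (x div 10 - 1) else pointer (x div 10))"

lemma place_simps: "i < 7 \<Longrightarrow> place (10 * j + i) = block_pos j i" "place (10 * j + 8) = linker (j - 1)" "place (10 * j + 9) = pointer j"
  unfolding place_def by auto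

lemma b_plain:
  assumes "1 \<le> j" "j \<le> N" "a \<in> b j" "plain z"
  shows "j \<le> c z \<Longrightarrow> a < z" "c z < j \<Longrightarrow> z < a" "j \<le> r z \<Longrightarrow> v a < v z" "r z < j \<Longrightarrow> v z < v a"
  using pc[OF assms(4,1,2)] assms(3) by blast+

text \<open>Cell coordinates order points of different columns and of different rows. What remains
  are points of one letter, a linker and a pointer sharing a column or a row, and pointers sharing
  row \<open>N\<close>. For values it suffices to preserve the strict order in one direction, since
  \<open>mval m\<close> is injective.\<close>

lemma iso_model: "\<exists>m h. 2 \<le> m \<and> emb (model m) (mval m) X v h \<and> h ` model m = X"
proof -
  obtain m where m: "2 \<le> m" "N = tri m" and w: "\<And>j. 1 \<le> j \<Longrightarrow> j \<le> N \<Longrightarrow> w j = label m j"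
    and rp: "\<And>i. 1 \<le> i \<Longrightarrow> i < N \<Longrightarrow> r (pointer i) = min N (target i)"
    using shape by metis
  have link: "plain (linker (j - 1))" "c (linker (j - 1)) = j" "r (linker (j - 1)) = j - 2" if "2 \<le> j" "j \<le> N" for j
    using linker[of "j - 1"] that by auto
  have H: "place x < place y" if x: "x \<in> model m" and y: "y \<in> model m" and lt: "x < y" for x y
    using x
  proof (cases rule: model_cases)
    case x1: (letter j i)
    have jN: "1 \<le> j" "j \<le> N" using x1 m by auto
    have px: "place x = block_pos j i" "block_pos j i \<in> b j" using x1 place_simps(1) block_pos(4)[OF jN] by auto
    from y show ?thesis
    proof (cases rule: model_cases)
      case y1: (letter k i2)
      have kN: "1 \<le> k" "k \<le> N" using y1 m by auto
      have py: "place y = block_pos k i2" "block_pos k i2 \<in> b k" using y1 place_simps(1) block_pos(4)[OF kN] by auto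
      show ?thesis
      proof (cases "j = k")
        case True
        then have "i < i2" using lt x1 y1 by simp
        then show ?thesis using px py True strict_mono_onD[OF block_pos(1)[OF jN], of i i2] x1 y1 by simp
      next
        case False
        then have "j < k" using lt x1 y1 by simp
        then show ?thesis using b_less(1)[of j k] px py jN kN by simp
      qed
    next
      case y1: (link k)
      have "j \<le> k" using lt x1 y1 by simp
      then show ?thesis using b_plain(1)[OF jN px(2) link(1)[of k]] link(2)[of k] px y1 place_simps(2) m by simp
    next
      case y1: (point k)
      have "j \<le> k" using lt x1 y1 by simp
      then show ?thesis using b_plain(1)[OF jN px(2) pointer(1)[of k]] pointer(2)[of k] px y1 place_simps(3) m by simp
    qed
  next
    case x1: (link j)
    have jN: "2 \<le> j" "j \<le> N" using x1 m by auto
    note px = link[OF jN]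
    have px': "place x = linker (j - 1)" using x1 place_simps(2) by simp
    from y show ?thesis
    proof (cases rule: model_cases)
      case y1: (letter k i2)
      have kN: "1 \<le> k" "k \<le> N" using y1 m by auto
      have py: "place y = block_pos k i2" "block_pos k i2 \<in> b k" using y1 place_simps(1) block_pos(4)[OF kN] by auto
      have "j < k" using lt x1 y1 by simp
      then show ?thesis using b_plain(2)[OF kN py(2) px(1)] px px' py by simp
    next
      case y1: (link k)
      have "j < k" using lt x1 y1 by simp
      then show ?thesis using plain_less(1)[OF px(1) link(1)[of k]] link(2)[of k] px(2) px' y1 place_simps(2) m by simp
    next
      case y1: (point k)
      have "j \<le> k" using lt x1 y1 by simp
      show ?thesis
      proof (cases "j = k")
        case True
        then show ?thesis using linker_left_pointer[of k] jN px' y1 place_simps(3) m by simp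
      next
        case False
        then show ?thesis using plain_less(1)[OF px(1) pointer(1)[of k]] pointer(2)[of k] px(2) px' y1 place_simps(3) m \<open>j \<le> k\<close> by simp
      qed
    qed
  next
    case x1: (point j)
    have jN: "1 \<le> j" "j < N" using x1 m by auto
    note px = pointer[OF jN]
    have px': "place x = pointer j" using x1 place_simps(3) by simp
    from y show ?thesis
    proof (cases rule: model_cases)
      case y1: (letter k i2)
      have kN: "1 \<le> k" "k \<le> N" using y1 m by auto
      have py: "place y = block_pos k i2" "block_pos k i2 \<in> b k" using y1 place_simps(1) block_pos(4)[OF kN] by auto
      have "j < k" using lt x1 y1 by simp
      then show ?thesis using b_plain(2)[OF kN py(2) px(1)] px px' py by simp
    next
      case y1: (link k)
      have "j < k" using lt x1 y1 by simp
      then show ?thesis using plain_less(1)[OF px(1) link(1)[of k]] link(2)[of k] px(2) px' y1 place_simps(2) m by simp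
    next
      case y1: (point k)
      have "j < k" using lt x1 y1 by simp
      then show ?thesis using plain_less(1)[OF px(1) pointer(1)[of k]] pointer(2)[of k] px(2) px' y1 place_simps(3) m by simp
    qed
  qed
  have V: "v (place x) < v (place y)" if x: "x \<in> model m" and y: "y \<in> model m" and lt: "mval m x < mval m y" for x y
    using x
  proof (cases rule: model_cases)
    case x1: (letter j i)
    have jN: "1 \<le> j" "j \<le> N" using x1 m by auto
    have px: "place x = block_pos j i" "block_pos j i \<in> b j" using x1 place_simps(1) block_pos(4)[OF jN] by auto
    note bi = blk_range[OF x1(4), of "label m j"]
    from y show ?thesis
    proof (cases rule: model_cases)
      case y1: (letter k i2)
      have kN: "1 \<le> k" "k \<le> N" using y1 m by auto
      have py: "place y = block_pos k i2" "block_pos k i2 \<in> b k" using y1 place_simps(1) block_pos(4)[OF kN] by auto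
      note bi2 = blk_range[OF y1(4), of "label m k"]
      show ?thesis
      proof (cases "j = k")
        case True
        then have "blk (label m j) ! i < blk (label m j) ! i2" using lt x1 y1 by simp
        then show ?thesis using px py True block_pos(3)[OF jN, of i i2] w[OF jN] x1 y1 by simp
      next
        case False
        then have "j < k" using lt x1(5) y1(5) bi bi2 by simp
        then show ?thesis using b_less(2)[of j k] px py jN kN by simp
      qed
    next
      case y1: (link k)
      have "j \<le> k - 2" using lt x1(5) y1(4) bi by simp
      then show ?thesis using b_plain(3)[OF jN px(2) link(1)[of k]] link(3)[of k] px y1 place_simps(2) m by simp
    next
      case y1: (point k)
      have "j \<le> target k" using lt x1(5) y1(4) bi by simp
      then show ?thesis using b_plain(3)[OF jN px(2) pointer(1)[of k]] rp[of k] jN px y1 place_simps(3) m by simp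
    qed
  next
    case x1: (link j)
    have jN: "2 \<le> j" "j \<le> N" using x1 m by auto
    note px = link[OF jN]
    have px': "place x = linker (j - 1)" using x1 place_simps(2) by simp
    from y show ?thesis
    proof (cases rule: model_cases)
      case y1: (letter k i2)
      have kN: "1 \<le> k" "k \<le> N" using y1 m by auto
      have py: "place y = block_pos k i2" "block_pos k i2 \<in> b k" using y1 place_simps(1) block_pos(4)[OF kN] by auto
      note bi2 = blk_range[OF y1(4), of "label m k"]
      have "j - 2 < k" using lt x1(4) y1(5) bi2 by simp
      then show ?thesis using b_plain(4)[OF kN py(2) px(1)] px px' py by simp
    next
      case y1: (link k)
      have "j - 2 < k - 2" using lt x1 y1 by simp
      then show ?thesis using plain_less(2)[OF px(1) link(1)[of k]] link(3)[of k] px(3) px' y1 place_simps(2) m by simp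
    next
      case y1: (point k)
      have kN: "1 \<le> k" "k < N" using y1 m by auto
      have le: "j - 2 \<le> target k" using lt x1(4) y1(4) by simp
      have py: "place y = pointer k" using y1 place_simps(3) by simp
      show ?thesis
      proof (cases "j - 2 < r (pointer k)")
        case True
        then show ?thesis using plain_less(2)[OF px(1) pointer(1)[OF kN]] px(3) px' py by simp
      next
        case False
        \<comment> \<open>The linker and the pointer share a row, where only the last rule orders
          them.\<close>
        then have e: "r (pointer k) = j - 2" using rp[OF kN] le jN by simp
        have "v (linker (j - 2 + 1)) < v (pointer k)"
          by (rule linker_below_pointer[OF kN e]) (use jN in simp)
        moreover have "j - 2 + 1 = j - 1" using jN by simp
        ultimately show ?thesis using px' py by simp
      qed
    qed
  next
    case x1: (point j)
    have jN: "1 \<le> j" "j < N" using x1 m by auto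
    note px = pointer[OF jN]
    have px': "place x = pointer j" using x1 place_simps(3) by simp
    from y show ?thesis
    proof (cases rule: model_cases)
      case y1: (letter k i2)
      have kN: "1 \<le> k" "k \<le> N" using y1 m by auto
      have py: "place y = block_pos k i2" "block_pos k i2 \<in> b k" using y1 place_simps(1) block_pos(4)[OF kN] by auto
      note bi2 = blk_range[OF y1(4), of "label m k"]
      have "target j < k" using lt x1(4) y1(5) bi2 by simp
      then show ?thesis using b_plain(4)[OF kN py(2) px(1)] rp[OF jN] px' py by simp
    next
      case y1: (link k)
      have "target j < k - 2" using lt x1(4) y1(4) by simp
      then show ?thesis using plain_less(2)[OF px(1) link(1)[of k]] link(3)[of k] rp[OF jN] px' y1 place_simps(2) m by simp
    next
      case y1: (point k)
      \<comment> \<open>Several pointers may share row \<open>N\<close>, so their values are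
        compared by monotonicity in the index and not by rows.\<close>
      have "target j < target k" using lt x1(4) y1(4) by simp
      then have "j < k" using target_mono[of k j] by (cases j k rule: linorder_cases) auto
      then show ?thesis using pointer_mono[OF jN(1), of k] px' y1 place_simps(3) m by simp
    qed
  qed
  have im: "place ` model m = X"
  proof (intro equalityI subsetI)
    fix z assume "z \<in> place ` model m"
    then obtain x where x: "x \<in> model m" "z = place x" by blast
    from x(1) show "z \<in> X"
    proof (cases rule: model_cases)
      case (letter j i)
      then have "z \<in> b j" using x(2) place_simps(1) block_pos(4)[of j i] m by simp
      then show ?thesis using b_letter(1)[of j] letter m by auto
    next
      case (link j)
      then show ?thesis using x(2) place_simps(2) plain_X[OF linker(1)[of "j - 1"]] m by simp
    next
      case (point j)
      then show ?thesis using x(2) place_simps(3) plain_X[OF pointer(1)[of j]] m by simp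
    qed
  next
    fix z assume z: "z \<in> X"
    show "z \<in> place ` model m"
    proof (cases "plain z")
      case True
      from plain_cases[OF this] show ?thesis
      proof
        assume a: "2 \<le> c z \<and> z = linker (c z - 1)"
        then have "z = place (10 * c z + 8)" using place_simps(2) by simp
        moreover have "10 * c z + 8 \<in> model m" using in_model(2) a c_le[of z] m by simp
        ultimately show ?thesis by blast
      next
        assume a: "1 \<le> c z \<and> c z < N \<and> z = pointer (c z)"
        then have "z = place (10 * c z + 9)" using place_simps(3) by simp
        moreover have "10 * c z + 9 \<in> model m" using in_model(3) a m by simp
        ultimately show ?thesis by blast
      qed
    next
      case False
      then obtain k where k: "1 \<le> k" "k \<le> N" "z \<in> b k" using plain_or_b[OF z] by blast
      then obtain i where i: "i < 7" "z = block_pos k i" using block_pos(2)[OF k(1,2)] by auto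
      then have "z = place (10 * k + i)" using place_simps(1) by simp
      moreover have "10 * k + i \<in> model m" using in_model(1) k i m by simp
      ultimately show ?thesis by blast
    qed
  qed
  have "emb (model m) (mval m) X v place"
    unfolding emb_def
  proof (intro conjI ballI)
    show "strict_mono_on (model m) place" using H by (intro strict_mono_onI) blast
    show "place ` model m \<subseteq> X" using im by simp
    fix x y assume xy: "x \<in> model m" "y \<in> model m"
    show "v (place x) < v (place y) \<longleftrightarrow> mval m x < mval m y"
    proof
      assume a: "v (place x) < v (place y)"
      show "mval m x < mval m y"
      proof (rule ccontr)
        assume "\<not> mval m x < mval m y"
        then consider "mval m y < mval m x" | "mval m x = mval m y" by linarith
        then show False
        proof cases
          case 1 then show ?thesis using V[OF xy(2,1)] a by simp
        next
          case 2 then have "x = y" using inj_onD[OF mval_inj _ xy] by blast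
          then show ?thesis using a by simp
        qed
      qed
    qed (rule V[OF xy])
  qed
  then show ?thesis using m(1) im by blast
qed

end

section \<open>Which rows are targets\<close>

lemma triangular_target: "1 \<le> c \<Longrightarrow> triangular (target c) \<longleftrightarrow> triangular c"
proof -
  obtain t d where td: "d \<le> t" "c = tri t + d" by (rule tri_decomp)
  then show ?thesis using triangular_offset[of d t] triangular_offset[of d "Suc t"] target_offset[of d t] by (simp del: tri.simps)
qed

text \<open>The offset of \<open>target (tri t + d) + 1\<close> in lap \<open>Suc t\<close> is
  \<open>d + 1\<close>, which is positive and still inside that lap.\<close>

lemma not_triangular_target_Suc: "\<not> triangular (target c + 1)"
proof -
  obtain t d where td: "d \<le> t" "c = tri t + d" by (rule tri_decomp)
  have "target c + 1 = tri (Suc t) + (d + 1)" using target_offset td by simp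
  then show ?thesis using triangular_offset[of "d + 1" "Suc t"] td(1) by (simp del: tri.simps)
qed

lemma triangular_Suc: assumes "1 \<le> j" "triangular j" shows "\<not> triangular (j + 1)"
proof -
  obtain t where t: "j = tri t" using assms(2) unfolding triangular_def by blast
  then have "1 \<le> t" using assms(1) by (cases t) auto
  then show ?thesis using triangular_offset[of 1 t] t by simp
qed

text \<open>An offset \<open>d < t\<close> in lap \<open>t\<close> occurs already in lap
  \<open>t - 1\<close>, whose letter at that offset points here; only the last offset of a lap is
  missed.\<close>

lemma target_hit:
  assumes "2 \<le> j" "\<not> triangular (j + 1)" obtains c where "1 \<le> c" "target c = j"
proof -
  obtain t d where td: "d \<le> t" "j = tri t + d" by (rule tri_decomp)
  have "d \<noteq> t"
  proof
    assume "d = t"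
    then have "j + 1 = tri (Suc t)" using td by simp
    then show False using assms(2) unfolding triangular_def by blast
  qed
  then obtain s where s: "t = Suc s" "d \<le> s" using td(1) by (cases t) auto
  have "target (tri s + d) = j" using target_offset[OF s(2)] td s by simp
  moreover have "1 \<le> tri s + d" using assms(1) td s by (cases s) auto
  ultimately show thesis using that by blast
qed

section \<open>Blocks of the model and its letters\<close>

definition K :: "nat \<Rightarrow> nat set" where "K j = {10 * j..<10 * j + 7}"

lemma K_image: "K j = (\<lambda>i. 10 * j + i) ` {..<7}"
proof -
  have "x \<in> (\<lambda>i. 10 * j + i) ` {..<7}" if "10 * j \<le> x" "x < 10 * j + 7" for x
    using that by (intro image_eqI[of _ _ "x - 10 * j"]) auto
  then show ?thesis unfolding K_def by auto
qed

lemma mval_K: "i < 7 \<Longrightarrow> mval m (10 * j + i) = 10 * j + blk (label m j) ! i"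
  unfolding mval_def by simp

lemma pat_K: "pat (mval m) (K j) (blk (label m j))"
  unfolding pat_def
  by (intro exI[of _ "\<lambda>i. 10 * j + i"]) (auto simp: strict_mono_on_def mval_K K_image)

lemma K_mem: "10 * j \<in> K j" "10 * j + 6 \<in> K j"
  unfolding K_def by auto

lemma K_values: "z \<in> K j \<Longrightarrow> 10 * j + 1 \<le> mval m z \<and> mval m z \<le> 10 * j + 7"
  unfolding K_image using mval_K blk_range by auto

lemma K_value_ex: "\<exists>z\<in>K j. mval m z = 10 * j + 7" "\<exists>z\<in>K j. mval m z = 10 * j + 1"
proof -
  have "\<exists>i<7. blk (label m j) ! i = k" if "k \<in> {1..7}" for k
    using that unfolding set_blk[symmetric, of "label m j"] in_set_conv_nth by simp
  from this[of 7] this[of 1] show "\<exists>z\<in>K j. mval m z = 10 * j + 7" "\<exists>z\<in>K j. mval m z = 10 * j + 1"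
    unfolding K_image using mval_K by force+
qed

lemma K_rel:
  "(\<forall>a\<in>K j. a < z) \<longleftrightarrow> 10 * j + 6 < z" "(\<forall>a\<in>K j. z < a) \<longleftrightarrow> z < 10 * j"
  "(\<forall>a\<in>K j. mval m a < y) \<longleftrightarrow> 10 * j + 7 < y" "(\<forall>a\<in>K j. y < mval m a) \<longleftrightarrow> y < 10 * j + 1"
proof -
  show "(\<forall>a\<in>K j. a < z) \<longleftrightarrow> 10 * j + 6 < z" unfolding K_def by auto
  show "(\<forall>a\<in>K j. z < a) \<longleftrightarrow> z < 10 * j" unfolding K_def by auto
  show "(\<forall>a\<in>K j. mval m a < y) \<longleftrightarrow> 10 * j + 7 < y"
    using K_values[of _ j m] K_value_ex(1)[of j m] by force
  show "(\<forall>a\<in>K j. y < mval m a) \<longleftrightarrow> y < 10 * j + 1"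
    using K_values[of _ j m] K_value_ex(2)[of j m] by force
qed

definition "in_block z \<longleftrightarrow> z mod 10 < (7::nat)"
definition "col z = z div (10::nat)"
definition "row m z = mval m z div 10"

text \<open>The three disjuncts are the points of letters on the diagonal, the linkers two rows
  below it, and the pointers at least two rows above it, as \<open>lap\<close> is at least 1 in
  every column.\<close>

lemma point_facts:
  assumes "z \<in> model m"
  shows "1 \<le> col z" "col z \<le> tri m"
    "in_block z \<and> row m z = col z \<and> z \<le> 10 * col z + 6 \<and> 10 * row m z + 1 \<le> mval m z \<and> mval m z \<le> 10 * row m z + 7 \<or>
     \<not> in_block z \<and> z = 10 * col z + 8 \<and> row m z + 2 = col z \<and> mval m z = 10 * row m z + 8 \<or>
     \<not> in_block z \<and> z = 10 * col z + 9 \<and> col z + 2 \<le> row m z \<and> row m z = target (col z) \<and> mval m z = 10 * row m z + 9 \<and> col z < tri m"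
    "10 * col z \<le> z" "z \<le> 10 * col z + 9" "10 * row m z \<le> mval m z" "mval m z \<le> 10 * row m z + 9"
proof -
  show "1 \<le> col z" "col z \<le> tri m" using assms unfolding model_def col_def by auto
  show "10 * col z \<le> z" "z \<le> 10 * col z + 9" "10 * row m z \<le> mval m z" "mval m z \<le> 10 * row m z + 9"
    unfolding col_def row_def by presburger+
  from assms show "in_block z \<and> row m z = col z \<and> z \<le> 10 * col z + 6 \<and> 10 * row m z + 1 \<le> mval m z \<and> mval m z \<le> 10 * row m z + 7 \<or>
     \<not> in_block z \<and> z = 10 * col z + 8 \<and> row m z + 2 = col z \<and> mval m z = 10 * row m z + 8 \<or>
     \<not> in_block z \<and> z = 10 * col z + 9 \<and> col z + 2 \<le> row m z \<and> row m z = target (col z) \<and> mval m z = 10 * row m z + 9 \<and> col z < tri m"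
  proof (cases rule: model_cases)
    case (letter j i)
    have b: "1 \<le> blk (label m j) ! i" "blk (label m j) ! i \<le> 7" using blk_range[OF letter(4)] by auto
    have "col z = j" "in_block z" using letter(1,4) unfolding col_def in_block_def by auto
    moreover have "row m z = j" using letter(5) b unfolding row_def by auto
    ultimately show ?thesis using letter(1,4,5) b by simp
  next
    case (link j)
    have "col z = j" "\<not> in_block z" using link(1) unfolding col_def in_block_def by auto
    moreover have "row m z = j - 2" using link(4) unfolding row_def by auto
    ultimately show ?thesis using link by simp
  next
    case (point j)
    have "lap 1 \<le> lap j" using lap_mono[of 1 "j - 1"] point(2) by simp
    moreover have "lap 1 = 1" using lap_offset[of 0 1] by simp
    ultimately have "j + 2 \<le> target j" unfolding target_def by simp
    moreover have "col z = j" "\<not> in_block z" using point(1) unfolding col_def in_block_def by auto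
    moreover have "row m z = target j" using point(4) unfolding row_def by auto
    ultimately show ?thesis using point by simp
  qed
qed

text \<open>The digits 8 and 9 exceed those of a block, so linkers and pointers in column or row
  \<open>j\<close> come after block \<open>j\<close>.\<close>

lemma K_point:
  assumes "z \<in> model m"
  shows "(\<forall>a\<in>K j. a < z) \<longleftrightarrow> j < col z \<or> j = col z \<and> \<not> in_block z" "(\<forall>a\<in>K j. z < a) \<longleftrightarrow> col z < j"
    "(\<forall>a\<in>K j. mval m a < mval m z) \<longleftrightarrow> j < row m z \<or> j = row m z \<and> \<not> in_block z" "(\<forall>a\<in>K j. mval m z < mval m a) \<longleftrightarrow> row m z < j"
  unfolding K_rel using point_facts(3)[OF assms] point_facts(4-)[OF assms] by auto

lemma K_K: "(\<forall>a\<in>K i. \<forall>c\<in>K j. a < c) \<longleftrightarrow> i < j" "(\<forall>a\<in>K i. \<forall>c\<in>K j. mval m a < mval m c) \<longleftrightarrow> i < j"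
proof -
  show "(\<forall>a\<in>K i. \<forall>c\<in>K j. a < c) \<longleftrightarrow> i < j" unfolding K_rel by (auto simp: K_def)
  show "(\<forall>a\<in>K i. \<forall>c\<in>K j. mval m a < mval m c) \<longleftrightarrow> i < j"
    unfolding K_rel using K_values[of _ i m] K_value_ex(1)[of i m] by force
qed

lemma K_sub: "1 \<le> j \<Longrightarrow> j \<le> tri m \<Longrightarrow> K j \<subseteq> model m"
  unfolding K_image using in_model(1) by auto

lemma K_convx: "convx (mval m) (K j) (model m)"
  unfolding convx_def
proof (intro ballI impI)
  fix x y z assume x: "x \<in> K j" and y: "y \<in> K j" and z: "z \<in> model m"
    and c: "x < z \<and> z < y \<or> mval m x < mval m z \<and> mval m z < mval m y"
  from c show "z \<in> K j"
  proof
    assume "x < z \<and> z < y" then show ?thesis using x y unfolding K_def by auto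
  next
    assume "mval m x < mval m z \<and> mval m z < mval m y"
    then have b: "10 * j + 1 \<le> mval m z" "mval m z \<le> 10 * j + 7" using K_values[OF x, of m] K_values[OF y, of m] by auto
    then have r: "row m z = j" unfolding row_def by auto
    then have "mval m z \<le> 10 * row m z + 7" using b by simp
    with r have "col z = j" "z \<le> 10 * col z + 6" using point_facts(3)[OF z] by auto
    then show ?thesis using point_facts(4)[OF z] unfolding K_def by auto
  qed
qed

lemma blk_decreasing4:
  assumes "\<beta> = blk x \<or> \<beta> = rev (blk x)"
  shows "\<exists>i1 i2 i3 i4. i1 < i2 \<and> i2 < i3 \<and> i3 < i4 \<and> i4 < 7 \<and> \<beta> ! i2 < \<beta> ! i1 \<and> \<beta> ! i3 < \<beta> ! i2 \<and> \<beta> ! i4 < \<beta> ! i3"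
    (is "\<exists>i1 i2 i3 i4. ?D i1 i2 i3 i4")
proof -
  have w: ?thesis if "?D a b c d" for a b c d using that by blast
  from assms show ?thesis
  proof
    assume b: "\<beta> = blk x"
    show ?thesis
    proof (cases x)
      case LP show ?thesis by (rule w[of 2 3 4 5]) (simp_all add: b LP)
    next
      case LN show ?thesis by (rule w[of 1 3 4 5]) (simp_all add: b LN)
    next
      case LS show ?thesis by (rule w[of 1 2 3 4]) (simp_all add: b LS)
    next
      case LQ show ?thesis by (rule w[of 1 2 3 5]) (simp_all add: b LQ)
    qed
  next
    assume b: "\<beta> = rev (blk x)"
    show ?thesis
    proof (cases x)
      case LP show ?thesis by (rule w[of 0 3 5 6]) (simp_all add: b LP)
    next
      case LN show ?thesis by (rule w[of 0 2 4 6]) (simp_all add: b LN)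
    next
      case LS show ?thesis by (rule w[of 0 1 3 6]) (simp_all add: b LS)
    next
      case LQ show ?thesis by (rule w[of 0 2 4 6]) (simp_all add: b LQ)
    qed
  qed
qed

text \<open>Every letter contains 4321, while away from the blocks the model is a union of three increasing sequences.\<close>

definition "kind z = (if in_block z then 0 else if z mod 10 = 8 then 1 else 2 :: nat)"

lemma same_kind_increasing:
  assumes "x \<in> model m" "y \<in> model m" "kind x = kind y" "x < y" "mval m y < mval m x"
  shows "\<exists>j. x \<in> K j \<and> y \<in> K j"
proof -
  have kk: "z mod 10 = 8 \<longleftrightarrow> z = 10 * col z + 8" for z unfolding col_def by presburger
  note px = point_facts[OF assms(1)] and py = point_facts[OF assms(2)]
  have cc: "col x \<le> col y" using assms(4) unfolding col_def by (simp add: div_le_mono)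
  show ?thesis
  proof (cases "in_block x")
    case True
    then have iy: "in_block y" using assms(3) unfolding kind_def by (auto split: if_splits)
    then have "row m x = col x" "row m y = col y" "x \<le> 10 * col x + 6" "y \<le> 10 * col y + 6"
      "10 * row m y + 1 \<le> mval m y" "mval m x \<le> 10 * row m x + 7" using px(3) py(3) True by auto
    then have "col x = col y" using assms(5) cc by simp
    then show ?thesis using px(4) py(4) \<open>x \<le> 10 * col x + 6\<close> \<open>y \<le> 10 * col y + 6\<close>
      by (intro exI[of _ "col x"]) (auto simp: K_def)
  next
    case False
    then have iy: "\<not> in_block y" using assms(3) unfolding kind_def by (auto split: if_splits)
    show ?thesis
    proof (cases "x mod 10 = 8")
      case True
      then have "y mod 10 = 8" using assms(3) iy False unfolding kind_def by (auto split: if_splits)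
      then have "x = 10 * col x + 8" "y = 10 * col y + 8" using True kk by auto
      then show ?thesis using px(3) py(3) False iy assms(4,5) by auto
    next
      case n: False
      then have "y mod 10 \<noteq> 8" using assms(3) iy False unfolding kind_def by (auto split: if_splits)
      then have "x = 10 * col x + 9 \<and> mval m x = 10 * target (col x) + 9" "y = 10 * col y + 9 \<and> mval m y = 10 * target (col y) + 9"
        using px(3) py(3) False iy n kk by auto
      then show ?thesis using target_mono[of "col x" "col y"] assms(4,5) by auto
    qed
  qed
qed

text \<open>Blocks are intervals, so by simplicity a letter is a block or meets every block in at
  most one point. In the latter case the four points of a 4321 would be of pairwise different kinds,
  but there are only three.\<close>

lemma letters_of_model:
  assumes "A \<subseteq> model m" "letter (mval m) A x"
  obtains j where "1 \<le> j" "j \<le> tri m" "A = K j" "x = label m j"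
proof -
  have card: "card A = 7" "finite A" using letter_card[OF assms(2)] by auto
  have dich: "card (A \<inter> K j) \<le> 1 \<or> A = K j" for j
  proof -
    have "convx (mval m) (A \<inter> K j) A" using K_convx[of m j] assms(1) unfolding convx_def by blast
    then have "card (A \<inter> K j) \<le> 1 \<or> A \<inter> K j = A" using letter_simple[OF assms(2)] by blast
    moreover have "A = K j" if "A \<inter> K j = A"
      using that card card_subset_eq[of "K j" A] by (simp add: K_def inf.absorb_iff1)
    ultimately show ?thesis by blast
  qed
  have "\<exists>j. A = K j"
  proof (rule ccontr)
    assume "\<not> ?thesis"
    then have one: "card (A \<inter> K j) \<le> 1" for j using dich by blast
    have no2: False if "p \<in> A" "q \<in> A" "p \<in> K j" "q \<in> K j" "p \<noteq> q" for p q j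
      using one[of j] card_le_Suc0_iff_eq[of "A \<inter> K j"] card(2) that by auto
    obtain \<beta> where \<beta>: "pat (mval m) A \<beta>" "\<beta> = blk x \<or> \<beta> = rev (blk x)" using assms(2) unfolding letter_def by blast
    then have len: "length \<beta> = 7" by auto
    obtain f where f: "strict_mono_on {..<7} f" "A = f ` {..<7}"
      "\<forall>i<7. \<forall>j<7. mval m (f i) < mval m (f j) \<longleftrightarrow> \<beta> ! i < \<beta> ! j"
      using \<beta>(1) unfolding pat_def len by blast
    obtain i1 i2 i3 i4 where i: "i1 < i2" "i2 < i3" "i3 < i4" "i4 < 7" "\<beta> ! i2 < \<beta> ! i1" "\<beta> ! i3 < \<beta> ! i2" "\<beta> ! i4 < \<beta> ! i3"
      using blk_decreasing4[OF \<beta>(2)] by blast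
    have no: "kind (f i) \<noteq> kind (f j)" if "i < j" "j < 7" "\<beta> ! j < \<beta> ! i" for i j
    proof
      assume k: "kind (f i) = kind (f j)"
      have A: "f i \<in> A" "f j \<in> A" using f(2) that by auto
      have lt: "f i < f j" using strict_mono_onD[OF f(1), of i j] that by simp
      have "mval m (f j) < mval m (f i)" using f(3) that by simp
      then obtain k where "f i \<in> K k" "f j \<in> K k" using same_kind_increasing[OF _ _ k lt] A assms(1) by blast
      then show False using no2[of "f i" "f j" k] A lt by simp
    qed
    have k3: "kind z < 3" for z unfolding kind_def by simp
    have "kind (f i1) \<noteq> kind (f i2)" "kind (f i1) \<noteq> kind (f i3)" "kind (f i1) \<noteq> kind (f i4)"
      "kind (f i2) \<noteq> kind (f i3)" "kind (f i2) \<noteq> kind (f i4)" "kind (f i3) \<noteq> kind (f i4)"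
      using no[of i1 i2] no[of i1 i3] no[of i1 i4] no[of i2 i3] no[of i2 i4] no[of i3 i4] i by auto
    then show False
      using k3[of "f i1"] k3[of "f i2"] k3[of "f i3"] k3[of "f i4"] by linarith
  qed
  then obtain j where j: "A = K j" by blast
  have "10 * j \<in> model m" using j assms(1) K_mem(1) by blast
  then have "1 \<le> j" "j \<le> tri m" unfolding model_def by auto
  moreover have "letter (mval m) (K j) (label m j)" using pat_K unfolding letter_def by blast
  then have "x = label m j" using letter_label assms(2) j by blast
  ultimately show thesis using that j by blast
qed

lemma model_Lt: "item_ok (model m) (mval m) (Lt S) B \<longleftrightarrow> (\<exists>j. 1 \<le> j \<and> j \<le> tri m \<and> label m j \<in> S \<and> B = K j)"
proof
  assume "item_ok (model m) (mval m) (Lt S) B"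
  then obtain x where x: "B \<subseteq> model m" "x \<in> S" "letter (mval m) B x" by auto
  then show "\<exists>j. 1 \<le> j \<and> j \<le> tri m \<and> label m j \<in> S \<and> B = K j" using letters_of_model[OF x(1,3)] by metis
next
  assume "\<exists>j. 1 \<le> j \<and> j \<le> tri m \<and> label m j \<in> S \<and> B = K j"
  then obtain j where j: "1 \<le> j" "j \<le> tri m" "label m j \<in> S" "B = K j" by blast
  have "letter (mval m) B (label m j)" using pat_K j(4) unfolding letter_def by blast
  then show "item_ok (model m) (mval m) (Lt S) B" using K_sub[OF j(1,2)] j by auto
qed

section \<open>The model avoids every forbidden configuration\<close>

lemma model_items:
  "list_all2 (item_ok (model m) (mval m)) (Lt S # its) Bs \<longleftrightarrow>
     (\<exists>j Bs'. Bs = K j # Bs' \<and> 1 \<le> j \<and> j \<le> tri m \<and> label m j \<in> S \<and> list_all2 (item_ok (model m) (mval m)) its Bs')"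
  "list_all2 (item_ok (model m) (mval m)) (Pt # its) Bs \<longleftrightarrow>
     (\<exists>z Bs'. Bs = {z} # Bs' \<and> z \<in> model m \<and> list_all2 (item_ok (model m) (mval m)) its Bs')"
  "list_all2 (item_ok (model m) (mval m)) [] Bs \<longleftrightarrow> Bs = []"
  unfolding list_all2_Cons1 model_Lt by auto

lemma model_adj:
  assumes "x \<in> model m" "i < j" "j < col x \<or> j = col x \<and> \<not> in_block x" "row m x < i"
  shows "j = i + 1" "col x = i + 1"
  using point_facts(3)[OF assms(1)] assms(2-) by auto

lemma model_upper:
  assumes "x \<in> model m" "col x < row m x"
  shows "row m x = target (col x)" "x = 10 * col x + 9" "mval m x = 10 * row m x + 9"
  using point_facts(3)[OF assms(1)] assms(2) by auto

lemma label_LP: "label m j = LP \<Longrightarrow> j = 1" and label_LQ: "label m j = LQ \<Longrightarrow> j = tri m"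
  and label_LS: "label m j = LS \<Longrightarrow> triangular j" and label_LN: "label m j = LN \<Longrightarrow> \<not> triangular j"
  by (auto simp: label_def triangular_def split: if_splits)

lemma triangular_1: "triangular 1" and triangular_tri: "triangular (tri m)"
  using triangular_offset[of 0 1] by (auto simp: triangular_def)

text \<open>In this and the following lemmas \<open>h\<close> is the assumed match, rewritten as
  inequalities between block indices and the coordinates \<open>col\<close> and
  \<open>row\<close>.\<close>

lemma model_no_inverted_letters: "\<not> matches (model m) (mval m) ([Any, Any], [H 0 1, V 1 0]) Bs"
  (is "\<not> ?M")
proof
  assume a: ?M
  then obtain e0 e1 where B: "Bs = [K e0, K e1]"
    and L: "1 \<le> e0" "e0 \<le> tri m" "1 \<le> e1" "e1 \<le> tri m"
    unfolding matches_def fst_conv model_items by blast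
  note h = conjunct2[OF a[unfolded B matches_def], unfolded adj_def snd_conv, simplified, simplified K_K ]
  show False using h L  by auto
qed

lemma model_no_triple_inversion: "\<not> matches (model m) (mval m) ([Any, Any, Any, Pt], [H 0 1, H 1 2, H 2 3, V 3 0]) Bs"
  (is "\<not> ?M")
proof
  assume a: ?M
  then obtain e0 e1 e2 e3 where B: "Bs = [K e0, K e1, K e2, {e3}]"
    and L: "1 \<le> e0" "e0 \<le> tri m" "1 \<le> e1" "e1 \<le> tri m" "1 \<le> e2" "e2 \<le> tri m"
    and X: "e3 \<in> model m"
    unfolding matches_def fst_conv model_items by blast
  note h = conjunct2[OF a[unfolded B matches_def], unfolded adj_def snd_conv, simplified, simplified K_K K_point[OF X(1)]]
  show False using h L point_facts(1-3)[OF X(1)] by auto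
qed

lemma model_nothing_before_LP: "\<not> matches (model m) (mval m) ([Any, Lt {LP}], [H 0 1]) Bs"
  (is "\<not> ?M")
proof
  assume a: ?M
  then obtain e0 e1 where B: "Bs = [K e0, K e1]"
    and L: "1 \<le> e0" "e0 \<le> tri m" "1 \<le> e1" "e1 \<le> tri m" "label m e1 \<in> {LP}"
    unfolding matches_def fst_conv model_items by blast
  note h = conjunct2[OF a[unfolded B matches_def], unfolded adj_def snd_conv, simplified, simplified K_K ]
  show False using h L  by (auto dest: label_LP)
qed

lemma model_nothing_after_LQ: "\<not> matches (model m) (mval m) ([Lt {LQ}, Any], [H 0 1]) Bs"
  (is "\<not> ?M")
proof
  assume a: ?M
  then obtain e0 e1 where B: "Bs = [K e0, K e1]"
    and L: "1 \<le> e0" "e0 \<le> tri m" "label m e0 \<in> {LQ}" "1 \<le> e1" "e1 \<le> tri m"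
    unfolding matches_def fst_conv model_items by blast
  note h = conjunct2[OF a[unfolded B matches_def], unfolded adj_def snd_conv, simplified, simplified K_K ]
  show False using h L  by (auto dest: label_LQ)
qed

lemma model_no_adjacent_special: "\<not> matches (model m) (mval m) ([Lt {LP, LS}, Lt {LS, LQ}, Pt], adj 0 1 2) Bs"
  (is "\<not> ?M")
proof
  assume a: ?M
  then obtain e0 e1 e2 where B: "Bs = [K e0, K e1, {e2}]"
    and L: "1 \<le> e0" "e0 \<le> tri m" "label m e0 \<in> {LP, LS}" "1 \<le> e1" "e1 \<le> tri m" "label m e1 \<in> {LS, LQ}"
    and X: "e2 \<in> model m"
    unfolding matches_def fst_conv model_items by blast
  note h = conjunct2[OF a[unfolded B matches_def], unfolded adj_def snd_conv, simplified, simplified K_K K_point[OF X(1)]]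
  have adj0: "e1 = e0 + 1" by (rule model_adj(1)[OF X(1)]) (use h in auto)
  have i: "triangular e0" "triangular e1" using L(3,6) triangular_1 triangular_tri by (auto dest: label_LP label_LS label_LQ)
  show False using h L adj0  i triangular_Suc[of e0] by simp
qed

lemma model_lower_unique: "\<not> matches (model m) (mval m) ([Any, Any, Pt, Pt, Pt], adj 0 1 2 @ [H 0 3, H 3 1, V 3 0, H 0 4, H 4 1, V 4 0, D 3 4]) Bs"
  (is "\<not> ?M")
proof
  assume a: ?M
  then obtain e0 e1 e2 e3 e4 where B: "Bs = [K e0, K e1, {e2}, {e3}, {e4}]"
    and L: "1 \<le> e0" "e0 \<le> tri m" "1 \<le> e1" "e1 \<le> tri m"
    and X: "e2 \<in> model m" "e3 \<in> model m" "e4 \<in> model m"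
    unfolding matches_def fst_conv model_items by blast
  note h = conjunct2[OF a[unfolded B matches_def], unfolded adj_def snd_conv, simplified, simplified K_K K_point[OF X(1)] K_point[OF X(2)] K_point[OF X(3)]]
  have adj0: "e1 = e0 + 1" by (rule model_adj(1)[OF X(1)]) (use h in auto)
  have "e3 = 10 * e0 + 8" using h adj0 point_facts(3)[OF X(2)] by auto
  moreover have "e4 = 10 * e0 + 8" using h adj0 point_facts(3)[OF X(3)] by auto
  ultimately  show False using h L adj0  by auto
qed

lemma model_bottom_unique: "\<not> matches (model m) (mval m) ([Lt {LP}, Pt, Pt], [V 1 0, V 2 0, D 1 2]) Bs"
  (is "\<not> ?M")
proof
  assume a: ?M
  then obtain e0 e1 e2 where B: "Bs = [K e0, {e1}, {e2}]"
    and L: "1 \<le> e0" "e0 \<le> tri m" "label m e0 \<in> {LP}"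
    and X: "e1 \<in> model m" "e2 \<in> model m"
    unfolding matches_def fst_conv model_items by blast
  note h = conjunct2[OF a[unfolded B matches_def], unfolded adj_def snd_conv, simplified, simplified K_K K_point[OF X(1)] K_point[OF X(2)]]
  have e0: "e0 = 1" using L(3) by (auto dest: label_LP)
  \<comment> \<open>Position 28 is the linker of column 2, the only point in row 0.\<close>
  have "e1 = 28" using h e0 point_facts(1,3)[OF X(1)] by auto
  moreover have "e2 = 28" using h e0 point_facts(1,3)[OF X(2)] by auto
  ultimately  show False using h L  by auto
qed

lemma model_right_unique: "\<not> matches (model m) (mval m) ([Lt {LQ}, Pt, Pt], [H 0 1, H 0 2, D 1 2]) Bs"
  (is "\<not> ?M")
proof
  assume a: ?M
  then obtain e0 e1 e2 where B: "Bs = [K e0, {e1}, {e2}]"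
    and L: "1 \<le> e0" "e0 \<le> tri m" "label m e0 \<in> {LQ}"
    and X: "e1 \<in> model m" "e2 \<in> model m"
    unfolding matches_def fst_conv model_items by blast
  note h = conjunct2[OF a[unfolded B matches_def], unfolded adj_def snd_conv, simplified, simplified K_K K_point[OF X(1)] K_point[OF X(2)]]
  have e0: "e0 = tri m" using L(3) by (auto dest: label_LQ)
  have "e1 = 10 * tri m + 8" using h e0 point_facts(2,3)[OF X(1)] by auto
  moreover have "e2 = 10 * tri m + 8" using h e0 point_facts(2,3)[OF X(2)] by auto
  ultimately  show False using h L  by auto
qed

lemma model_no_central: "\<not> matches (model m) (mval m) ([Any, Any, Pt, Pt], adj 0 1 2 @ [H 0 3, H 3 1, V 0 3, V 3 1]) Bs"
  (is "\<not> ?M")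
proof
  assume a: ?M
  then obtain e0 e1 e2 e3 where B: "Bs = [K e0, K e1, {e2}, {e3}]"
    and L: "1 \<le> e0" "e0 \<le> tri m" "1 \<le> e1" "e1 \<le> tri m"
    and X: "e2 \<in> model m" "e3 \<in> model m"
    unfolding matches_def fst_conv model_items by blast
  note h = conjunct2[OF a[unfolded B matches_def], unfolded adj_def snd_conv, simplified, simplified K_K K_point[OF X(1)] K_point[OF X(2)]]
  have adj0: "e1 = e0 + 1" by (rule model_adj(1)[OF X(1)]) (use h in auto)
  have "e0 \<le> col e3" "col e3 < e0 + 1" "e0 \<le> row m e3" "row m e3 < e0 + 1" using h adj0 by auto
  then have "col e3 = e0" "row m e3 = e0" by simp_all
  moreover have "\<not> in_block e3" using h calculation by auto
  ultimately have False using point_facts(3)[OF X(2)] by auto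
  then  show False using h L adj0  by simp
qed

lemma model_left_empty: "\<not> matches (model m) (mval m) ([Lt {LP}, Pt], [H 1 0]) Bs"
  (is "\<not> ?M")
proof
  assume a: ?M
  then obtain e0 e1 where B: "Bs = [K e0, {e1}]"
    and L: "1 \<le> e0" "e0 \<le> tri m" "label m e0 \<in> {LP}"
    and X: "e1 \<in> model m"
    unfolding matches_def fst_conv model_items by blast
  note h = conjunct2[OF a[unfolded B matches_def], unfolded adj_def snd_conv, simplified, simplified K_K K_point[OF X(1)]]
  show False using h L point_facts(1-3)[OF X(1)] by (auto dest: label_LP)
qed

lemma model_upper_unique: "\<not> matches (model m) (mval m) ([Any, Any, Pt, Pt, Pt], adj 0 1 2 @ [H 0 3, H 3 1, V 1 3, H 0 4, H 4 1, V 1 4, D 3 4]) Bs"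
  (is "\<not> ?M")
proof
  assume a: ?M
  then obtain e0 e1 e2 e3 e4 where B: "Bs = [K e0, K e1, {e2}, {e3}, {e4}]"
    and L: "1 \<le> e0" "e0 \<le> tri m" "1 \<le> e1" "e1 \<le> tri m"
    and X: "e2 \<in> model m" "e3 \<in> model m" "e4 \<in> model m"
    unfolding matches_def fst_conv model_items by blast
  note h = conjunct2[OF a[unfolded B matches_def], unfolded adj_def snd_conv, simplified, simplified K_K K_point[OF X(1)] K_point[OF X(2)] K_point[OF X(3)]]
  have adj0: "e1 = e0 + 1" by (rule model_adj(1)[OF X(1)]) (use h in auto)
  have "e3 = 10 * e0 + 9" using h adj0 point_facts(3)[OF X(2)] by auto
  moreover have "e4 = 10 * e0 + 9" using h adj0 point_facts(3)[OF X(3)] by auto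
  ultimately  show False using h L adj0  by auto
qed

lemma model_pointers_increasing: "\<not> matches (model m) (mval m) ([Pt, Any, Pt, Any], [H 0 1, H 1 2, H 2 3, V 2 0, V 3 2]) Bs"
  (is "\<not> ?M")
proof
  assume a: ?M
  then obtain e0 e1 e2 e3 where B: "Bs = [{e0}, K e1, {e2}, K e3]"
    and L: "1 \<le> e1" "e1 \<le> tri m" "1 \<le> e3" "e3 \<le> tri m"
    and X: "e0 \<in> model m" "e2 \<in> model m"
    unfolding matches_def fst_conv model_items by blast
  note h = conjunct2[OF a[unfolded B matches_def], unfolded adj_def snd_conv, simplified, simplified K_K K_point[OF X(1)] K_point[OF X(2)]]
  have p: "row m e2 = target (col e2)" "mval m e2 = 10 * row m e2 + 9" "col e2 + 2 \<le> row m e2"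
    using h point_facts(3)[OF X(2)] by auto
  have c: "col e0 < col e2" using h by auto
  have "row m e2 \<le> row m e0" using h point_facts(6,7)[OF X(1)] p by linarith
  then have q: "row m e0 = target (col e0)" using point_facts(3)[OF X(1)] p(3) c by auto
  have "target (col e0) < target (col e2)" using target_mono[OF c] .
  with q p(1) \<open>row m e2 \<le> row m e0\<close>  show False using h L  by simp
qed

lemma model_row_empty: "\<not> matches (model m) (mval m) ([Any, Lt {LS, LQ}, Pt, Pt], adj 0 1 2 @ [H 3 0, V 0 3, V 3 1]) Bs"
  (is "\<not> ?M")
proof
  assume a: ?M
  then obtain e0 e1 e2 e3 where B: "Bs = [K e0, K e1, {e2}, {e3}]"
    and L: "1 \<le> e0" "e0 \<le> tri m" "1 \<le> e1" "e1 \<le> tri m" "label m e1 \<in> {LS, LQ}"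
    and X: "e2 \<in> model m" "e3 \<in> model m"
    unfolding matches_def fst_conv model_items by blast
  note h = conjunct2[OF a[unfolded B matches_def], unfolded adj_def snd_conv, simplified, simplified K_K K_point[OF X(1)] K_point[OF X(2)]]
  have adj0: "e1 = e0 + 1" by (rule model_adj(1)[OF X(1)]) (use h in auto)
  have "target (col e3) = e0" using h adj0 point_facts(3)[OF X(2)] by auto
  moreover have "triangular e1" using L(5) triangular_tri by (auto dest: label_LS label_LQ)
  ultimately  show False using h L adj0  adj0 not_triangular_target_Suc[of "col e3"] by auto
qed

lemma model_row_unique: "\<not> matches (model m) (mval m) ([Any, Any, Pt, Pt, Pt], adj 0 1 2 @ [H 3 0, V 0 3, V 3 1, H 4 0, V 0 4, V 4 1, D 3 4]) Bs"
  (is "\<not> ?M")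
proof
  assume a: ?M
  then obtain e0 e1 e2 e3 e4 where B: "Bs = [K e0, K e1, {e2}, {e3}, {e4}]"
    and L: "1 \<le> e0" "e0 \<le> tri m" "1 \<le> e1" "e1 \<le> tri m"
    and X: "e2 \<in> model m" "e3 \<in> model m" "e4 \<in> model m"
    unfolding matches_def fst_conv model_items by blast
  note h = conjunct2[OF a[unfolded B matches_def], unfolded adj_def snd_conv, simplified, simplified K_K K_point[OF X(1)] K_point[OF X(2)] K_point[OF X(3)]]
  have adj0: "e1 = e0 + 1" by (rule model_adj(1)[OF X(1)]) (use h in auto)
  have p: "target (col e3) = e0" "e3 = 10 * col e3 + 9" using h adj0 point_facts(3)[OF X(2)] by auto
  have q: "target (col e4) = e0" "e4 = 10 * col e4 + 9" using h adj0 point_facts(3)[OF X(3)] by auto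
  have "col e3 = col e4"
    using target_mono[of "col e3" "col e4"] target_mono[of "col e4" "col e3"] p q
    by (cases "col e3" "col e4" rule: linorder_cases) auto
  with p q  show False using h L adj0  by auto
qed

text \<open>\<open>target\<close> preserves and reflects triangularity, so a pointer never relates a
  special letter to an \<open>LN\<close>; the next lemma is the opposite case.\<close>

lemma model_special_row_label: "\<not> matches (model m) (mval m) ([Lt {LP, LS}, Any, Pt, Lt {LN}, Any, Pt, Pt], adj 0 1 2 @ adj 3 4 5 @ [H 0 6, H 6 1, V 3 6, V 6 4, H 6 3]) Bs"
  (is "\<not> ?M")
proof
  assume a: ?M
  then obtain e0 e1 e2 e3 e4 e5 e6 where B: "Bs = [K e0, K e1, {e2}, K e3, K e4, {e5}, {e6}]"
    and L: "1 \<le> e0" "e0 \<le> tri m" "label m e0 \<in> {LP, LS}" "1 \<le> e1" "e1 \<le> tri m" "1 \<le> e3" "e3 \<le> tri m" "label m e3 \<in> {LN}" "1 \<le> e4" "e4 \<le> tri m"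
    and X: "e2 \<in> model m" "e5 \<in> model m" "e6 \<in> model m"
    unfolding matches_def fst_conv model_items by blast
  note h = conjunct2[OF a[unfolded B matches_def], unfolded adj_def snd_conv, simplified, simplified K_K K_point[OF X(1)] K_point[OF X(2)] K_point[OF X(3)]]
  have adj0: "e1 = e0 + 1" by (rule model_adj(1)[OF X(1)]) (use h in auto)
  have adj1: "e4 = e3 + 1" by (rule model_adj(1)[OF X(2)]) (use h in auto)
  have "target e0 = e3" using h adj0 adj1 point_facts(3)[OF X(3)] by auto
  moreover have "triangular e0" using L(3) triangular_1 by (auto dest: label_LP label_LS)
  moreover have "\<not> triangular e3" using L(8) by (auto dest: label_LN)
  ultimately  show False using h L adj0 adj1  triangular_target[of e0] by auto
qed

lemma model_normal_row_label: "\<not> matches (model m) (mval m) ([Lt {LN}, Any, Pt, Lt {LS}, Any, Pt, Pt], adj 0 1 2 @ adj 3 4 5 @ [H 0 6, H 6 1, V 3 6, V 6 4, H 6 3]) Bs"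
  (is "\<not> ?M")
proof
  assume a: ?M
  then obtain e0 e1 e2 e3 e4 e5 e6 where B: "Bs = [K e0, K e1, {e2}, K e3, K e4, {e5}, {e6}]"
    and L: "1 \<le> e0" "e0 \<le> tri m" "label m e0 \<in> {LN}" "1 \<le> e1" "e1 \<le> tri m" "1 \<le> e3" "e3 \<le> tri m" "label m e3 \<in> {LS}" "1 \<le> e4" "e4 \<le> tri m"
    and X: "e2 \<in> model m" "e5 \<in> model m" "e6 \<in> model m"
    unfolding matches_def fst_conv model_items by blast
  note h = conjunct2[OF a[unfolded B matches_def], unfolded adj_def snd_conv, simplified, simplified K_K K_point[OF X(1)] K_point[OF X(2)] K_point[OF X(3)]]
  have adj0: "e1 = e0 + 1" by (rule model_adj(1)[OF X(1)]) (use h in auto)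
  have adj1: "e4 = e3 + 1" by (rule model_adj(1)[OF X(2)]) (use h in auto)
  have "target e0 = e3" using h adj0 adj1 point_facts(3)[OF X(3)] by auto
  moreover have "\<not> triangular e0" using L(3) by (auto dest: label_LN)
  moreover have "triangular e3" using L(8) by (auto dest: label_LS)
  ultimately  show False using h L adj0 adj1  triangular_target[of e0] by auto
qed

text \<open>As \<open>e1\<close> does not begin a lap, the targets of \<open>e0\<close> and
  \<open>e1\<close> are consecutive, so \<open>tri m\<close> would have to be
  \<open>target e0 + 1\<close>, which is never triangular.\<close>

lemma model_exit: "\<not> matches (model m) (mval m) ([Any, Lt {LN}, Pt, Any, Pt, Pt, Pt, Lt {LQ}], adj 0 1 2 @ adj 1 3 4 @ [H 0 5, H 5 1, V 1 5, V 5 7, H 1 6, H 6 3, V 7 6]) Bs"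
  (is "\<not> ?M")
proof
  assume a: ?M
  then obtain e0 e1 e2 e3 e4 e5 e6 e7 where B: "Bs = [K e0, K e1, {e2}, K e3, {e4}, {e5}, {e6}, K e7]"
    and L: "1 \<le> e0" "e0 \<le> tri m" "1 \<le> e1" "e1 \<le> tri m" "label m e1 \<in> {LN}" "1 \<le> e3" "e3 \<le> tri m" "1 \<le> e7" "e7 \<le> tri m" "label m e7 \<in> {LQ}"
    and X: "e2 \<in> model m" "e4 \<in> model m" "e5 \<in> model m" "e6 \<in> model m"
    unfolding matches_def fst_conv model_items by blast
  note h = conjunct2[OF a[unfolded B matches_def], unfolded adj_def snd_conv, simplified, simplified K_K K_point[OF X(1)] K_point[OF X(2)] K_point[OF X(3)] K_point[OF X(4)]]
  have adj0: "e1 = e0 + 1" by (rule model_adj(1)[OF X(1)]) (use h in auto)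
  have adj1: "e3 = e1 + 1" by (rule model_adj(1)[OF X(2)]) (use h in auto)
  have e7: "e7 = tri m" using L(10) by (auto dest: label_LQ)
  have d: "e0 < col e5 \<or> e0 = col e5 \<and> \<not> in_block e5" "col e5 < e1"
    "e1 < row m e5 \<or> e1 = row m e5 \<and> \<not> in_block e5" "row m e5 < e7"
    "e1 < col e6 \<or> e1 = col e6 \<and> \<not> in_block e6" "col e6 < e3" "e7 < row m e6 \<or> e7 = row m e6 \<and> \<not> in_block e6"
    using h by blast+
  have "col e5 = e0" "e0 < row m e5" using d(1-3) adj0 by auto
  then have p: "target e0 < tri m" using model_upper[OF X(3)] d(4) e7 by simp
  have "col e6 = e1" "e1 < row m e6" using d(5-7) adj1 e7 L(7) by auto
  then have q: "tri m \<le> target e1" using model_upper[OF X(4)] d(7) e7 by auto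
  have "\<not> triangular e1" using L(5) by (auto dest: label_LN)
  then have "target e1 = target e0 + 1" using target_step(2)[OF L(1)] adj0 by simp
  with p q have "tri m = target e0 + 1" by simp
  with not_triangular_target_Suc[of e0] triangular_tri[of m] have False by simp
  then  show False using h L adj0 adj1  by simp
qed

text \<open>Within a column the linker has the digit 8 and the pointer the digit 9. The same digits
  in the values settle the next lemma.\<close>

lemma model_linker_left_of_pointer: "\<not> matches (model m) (mval m) ([Any, Any, Pt, Pt, Pt], adj 0 1 2 @ [H 0 4, H 4 3, H 3 1, V 3 0, V 0 4, V 1 4]) Bs"
  (is "\<not> ?M")
proof
  assume a: ?M
  then obtain e0 e1 e2 e3 e4 where B: "Bs = [K e0, K e1, {e2}, {e3}, {e4}]"
    and L: "1 \<le> e0" "e0 \<le> tri m" "1 \<le> e1" "e1 \<le> tri m"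
    and X: "e2 \<in> model m" "e3 \<in> model m" "e4 \<in> model m"
    unfolding matches_def fst_conv model_items by blast
  note h = conjunct2[OF a[unfolded B matches_def], unfolded adj_def snd_conv, simplified, simplified K_K K_point[OF X(1)] K_point[OF X(2)] K_point[OF X(3)]]
  have adj0: "e1 = e0 + 1" by (rule model_adj(1)[OF X(1)]) (use h in auto)
  have d: "e0 < col e4 \<or> e0 = col e4 \<and> \<not> in_block e4" "e4 < e3" "col e3 < e1"
    "e1 < row m e4 \<or> e1 = row m e4 \<and> \<not> in_block e4"
    using h by blast+
  have c: "col e4 \<le> col e3" using d(2) point_facts(5)[OF X(2)] point_facts(4)[OF X(3)] by linarith
  then have "col e4 = e0" "e0 < row m e4" using d adj0 by auto
  then have "e4 = 10 * e0 + 9" using model_upper(2)[OF X(3)] by simp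
  then have False using d(2,3) adj0 point_facts(5)[OF X(2)] by simp
  then  show False using h L adj0  by simp
qed

lemma model_linker_below_pointer: "\<not> matches (model m) (mval m) ([Any, Any, Pt, Pt, Pt], adj 0 1 2 @ [H 3 0, V 0 3, V 3 1, H 1 4, V 0 4, V 4 1, V 3 4]) Bs"
  (is "\<not> ?M")
proof
  assume a: ?M
  then obtain e0 e1 e2 e3 e4 where B: "Bs = [K e0, K e1, {e2}, {e3}, {e4}]"
    and L: "1 \<le> e0" "e0 \<le> tri m" "1 \<le> e1" "e1 \<le> tri m"
    and X: "e2 \<in> model m" "e3 \<in> model m" "e4 \<in> model m"
    unfolding matches_def fst_conv model_items by blast
  note h = conjunct2[OF a[unfolded B matches_def], unfolded adj_def snd_conv, simplified, simplified K_K K_point[OF X(1)] K_point[OF X(2)] K_point[OF X(3)]]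
  have adj0: "e1 = e0 + 1" by (rule model_adj(1)[OF X(1)]) (use h in auto)
  have "mval m e3 = 10 * e0 + 9" using h adj0 point_facts(3)[OF X(2)] by auto
  moreover have "mval m e4 \<le> 10 * e0 + 9" using h adj0 point_facts(7)[OF X(3)] by auto
  ultimately  show False using h L adj0  by auto
qed

lemma model_no_rule: "R \<in> set rules \<Longrightarrow> \<not> matches (model m) (mval m) R Bs"
  unfolding rules_def set_simps
  by (elim insertE emptyE; hypsubst; rule
    model_no_inverted_letters model_no_triple_inversion model_nothing_before_LP model_nothing_after_LQ model_no_adjacent_special model_lower_unique model_bottom_unique model_right_unique
    model_no_central model_left_empty model_upper_unique model_pointers_increasing model_row_empty model_row_unique model_special_row_label
    model_normal_row_label model_exit model_linker_left_of_pointer model_linker_below_pointer)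

section \<open>All needs are met in the model\<close>

lemma link_simps: "2 \<le> c \<Longrightarrow> col (10 * c + 8) = c" "\<not> in_block (10 * c + 8)" "row m (10 * c + 8) = c - 2"
  and point_simps: "col (10 * c + 9) = c" "\<not> in_block (10 * c + 9)" "row m (10 * c + 9) = target c"
  unfolding col_def in_block_def row_def mval_def by simp_all

lemma model_adj_holds:
  assumes "1 \<le> j" "j < tri m"
  shows "\<forall>a\<in>K j. \<forall>b\<in>K (j + 1). a < b" "\<forall>b\<in>K (j + 1). b < 10 * (j + 1) + 8"
    "\<forall>a\<in>K j. mval m (10 * (j + 1) + 8) < mval m a" "10 * (j + 1) + 8 \<in> model m"
proof -
  show x: "10 * (j + 1) + 8 \<in> model m" using in_model(2)[of "j + 1" m] assms by simp
  show "\<forall>a\<in>K j. \<forall>b\<in>K (j + 1). a < b" unfolding K_K by simp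
  show "\<forall>b\<in>K (j + 1). b < 10 * (j + 1) + 8" unfolding K_def by simp
  show "\<forall>a\<in>K j. mval m (10 * (j + 1) + 8) < mval m a"
    unfolding K_point(4)[OF x] link_simps(3) using assms by simp
qed

lemma model_point_holds:
  assumes "1 \<le> j" "j < tri m"
  shows "\<forall>a\<in>K j. a < 10 * j + 9" "\<forall>b\<in>K (j + 1). 10 * j + 9 < b" "\<forall>b\<in>K (j + 1). mval m b < mval m (10 * j + 9)" "10 * j + 9 \<in> model m"
proof -
  show x: "10 * j + 9 \<in> model m" using in_model(3) assms by simp
  show "\<forall>a\<in>K j. a < 10 * j + 9" unfolding K_def by simp
  show "\<forall>b\<in>K (j + 1). 10 * j + 9 < b" unfolding K_def by simp
  have "j + 2 \<le> target j" using point_facts(3)[OF x] point_simps by auto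
  then show "\<forall>b\<in>K (j + 1). mval m b < mval m (10 * j + 9)" unfolding K_point(3)[OF x] by (simp add: point_simps)
qed

lemma model_row_holds:
  assumes "2 \<le> j" "j < tri m" "\<not> triangular (j + 1)"
  obtains c where "10 * c + 9 \<in> model m" "\<forall>a\<in>K j. 10 * c + 9 < a" "\<forall>a\<in>K j. mval m a < mval m (10 * c + 9)"
    "\<forall>b\<in>K (j + 1). mval m (10 * c + 9) < mval m b"
proof -
  obtain c where c: "1 \<le> c" "target c = j" using target_hit assms by blast
  have cj: "c < j" using c(2) unfolding target_def by simp
  have x: "10 * c + 9 \<in> model m" using in_model(3) c cj assms(2) by simp
  show thesis
  proof (rule that[OF x])
    show "\<forall>a\<in>K j. 10 * c + 9 < a" unfolding K_point(2)[OF x] point_simps using cj .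
    show "\<forall>a\<in>K j. mval m a < mval m (10 * c + 9)" unfolding K_point(3)[OF x] using c by (simp add: point_simps)
    show "\<forall>b\<in>K (j + 1). mval m (10 * c + 9) < mval m b" unfolding K_point(4)[OF x] point_simps using c by simp
  qed
qed

lemma item_K: "1 \<le> j \<Longrightarrow> j \<le> tri m \<Longrightarrow> label m j \<in> S \<Longrightarrow> item_ok (model m) (mval m) (Lt S) (K j)"
  using model_Lt by blast

text \<open>If \<open>j + 1\<close> is triangular, no pointer lies in row \<open>j\<close>, but then
  the next letter is special and the exempting alternative of \<open>LN\<close> applies. In all
  other inner cases \<open>target_hit\<close> provides the pointer.\<close>

lemma model_met:
  assumes m: "2 \<le> m" and j: "1 \<le> j" "j \<le> tri m"
  shows "met (model m) (mval m) (label m j) (K j)"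
proof -
  have N3: "3 \<le> tri m" using tri_mono[OF m] by (simp add: numeral_2_eq_2)
  show ?thesis
  proof (cases "j = tri m")
    case True
    then have label: "label m j = LQ" using N3 unfolding label_def by simp
    let ?Bs = "[K j, K (j - 1), {10 * j + 8}]"
    have r: "1 \<le> j - 1" "j - 1 < tri m" "j - 1 + 1 = j" "j - 1 \<le> tri m" using True N3 by auto
    note a = model_adj_holds[OF r(1,2), unfolded r(3)]
    have "matches (model m) (mval m) ([Lt {LQ}, Any, Pt], adj 1 0 2) ?Bs"
      unfolding matches_def adj_def using a item_K[OF j] item_K[OF r(1,4)] label by (simp del: item_ok.simps(2))
    then show ?thesis unfolding met_def label by (intro bexI[of _ "([Lt {LQ}, Any, Pt], adj 1 0 2)"] exI[of _ ?Bs]) auto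
  next
    case False
    then have jN: "j < tri m" "j + 1 \<le> tri m" "1 \<le> j + 1" using j by auto
    note a = model_adj_holds[OF j(1) jN(1)] and p = model_point_holds[OF j(1) jN(1)]
    show ?thesis
    proof (cases "j = 1")
      case True
      then have label: "label m j = LP" unfolding label_def by simp
      let ?R = "([Lt {LP}, Any, Pt, Pt], adj 0 1 2 @ [H 0 3, H 3 1, V 1 3])"
      let ?Bs = "[K j, K (j + 1), {10 * (j + 1) + 8}, {10 * j + 9}]"
      have "matches (model m) (mval m) ?R ?Bs"
        unfolding matches_def adj_def using a p item_K[OF j] item_K[OF jN(3,2)] label by (simp del: item_ok.simps(2))
      then show ?thesis unfolding met_def label by (intro bexI[of _ ?R] exI[of _ ?Bs]) auto
    next
      case n1: False
      then have j2: "2 \<le> j" using j by simp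
      then have r: "1 \<le> j - 1" "j - 1 < tri m" "j - 1 + 1 = j" "j - 1 \<le> tri m" using jN by auto
      note q = model_adj_holds[OF r(1,2), unfolded r(3)]
      have l2: "label m j = LS \<or> label m j = LN" using False n1 unfolding label_def by simp
      let ?Bs = "[K j, K (j + 1), {10 * (j + 1) + 8}, {10 * j + 9}, K (j - 1), {10 * j + 8}]"
      show ?thesis
      proof (cases "triangular (j + 1)")
        case True
        then have nx: "label m (j + 1) \<in> {LS, LQ}" using j unfolding label_def by simp
        have "\<not> triangular j" using triangular_Suc[of j] True j by blast
        then have label: "label m j = LN" using l2 label_LS by blast
        let ?R = "([Lt {LN}, Lt {LS, LQ}, Pt, Pt, Any, Pt], adj 0 1 2 @ [H 0 3, H 3 1, V 1 3] @ adj 4 0 5)"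
        have "matches (model m) (mval m) ?R ?Bs"
          unfolding matches_def adj_def using a p q item_K[OF j] item_K[OF jN(3,2) nx] item_K[OF r(1,4)] label
          by (simp del: item_ok.simps(2))
        then show ?thesis unfolding met_def label by (intro bexI[of _ ?R] exI[of _ ?Bs]) auto
      next
        case nt: False
        obtain c where c: "10 * c + 9 \<in> model m" "\<forall>a\<in>K j. 10 * c + 9 < a" "\<forall>a\<in>K j. mval m a < mval m (10 * c + 9)"
          "\<forall>b\<in>K (j + 1). mval m (10 * c + 9) < mval m b" by (rule model_row_holds[OF j2 jN(1) nt])
        let ?Bs' = "?Bs @ [{10 * c + 9}]"
        let ?R = "([Lt {label m j}, Any, Pt, Pt, Any, Pt, Pt], adj 0 1 2 @ [H 0 3, H 3 1, V 1 3] @ adj 4 0 5 @ [H 6 0, V 0 6, V 6 1])"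
        have "matches (model m) (mval m) ?R ?Bs'"
          unfolding matches_def adj_def using a p q c item_K[OF j, of "{label m j}"] item_K[OF jN(3,2)] item_K[OF r(1,4)]
          by (simp del: item_ok.simps(2))
        moreover have "?R \<in> set (need (label m j))" using l2 by auto
        ultimately show ?thesis unfolding met_def by (intro bexI[of _ ?R] exI[of _ ?Bs']) auto
      qed
    qed
  qed
qed

lemma model_surv: assumes "2 \<le> m" shows "surv (model m) (mval m)"
proof -
  have "solid (model m) (mval m)"
    unfolding solid_def using letters_of_model K_convx by metis
  moreover have "\<not> pat (mval m) A (rev (blk x))" if A: "A \<subseteq> model m" for A x
  proof
    assume p: "pat (mval m) A (rev (blk x))"
    then have "letter (mval m) A x" unfolding letter_def by blast
    then obtain j where "A = K j" using letters_of_model[OF A] by metis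
    then show False using pat_blk_not_rev[OF pat_K] p by blast
  qed
  ultimately have "good (model m) (mval m)" unfolding good_def using model_no_rule by blast
  moreover have "unmet (model m) (mval m) = {}"
  proof -
    have "met (model m) (mval m) x A" if A: "A \<subseteq> model m" "letter (mval m) A x" for A x
    proof -
      obtain j where "1 \<le> j" "j \<le> tri m" "A = K j" "x = label m j" by (rule letters_of_model[OF A])
      then show ?thesis using model_met[OF assms] by simp
    qed
    then show ?thesis unfolding unmet_def by blast
  qed
  moreover have "\<not> letterless (model m) (mval m)"
  proof -
    have "1 \<le> tri m" using tri_mono[OF assms] by (simp add: numeral_2_eq_2)
    then have "K 1 \<subseteq> model m" using K_sub by simp
    moreover have "letter (mval m) (K 1) (label m 1)" using pat_K unfolding letter_def by blast
    ultimately show ?thesis unfolding letterless_def by blast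
  qed
  ultimately show ?thesis unfolding surv_def by blast
qed

section \<open>Counting the survivors of a given length\<close>

lemma card_model: assumes "1 \<le> tri m" shows "card (model m) = 9 * tri m - 2" "finite (model m)"
proof -
  let ?N = "tri m"
  let ?A = "(\<lambda>(j, i). 10 * j + i) ` ({1..?N} \<times> {..<7::nat})"
  let ?B = "(\<lambda>j. 10 * j + 8) ` {2..?N}" and ?C = "(\<lambda>j. 10 * j + 9) ` {1..<?N}"
  have e: "model m = ?A \<union> ?B \<union> ?C"
  proof (intro equalityI subsetI)
    fix x assume "x \<in> model m"
    then show "x \<in> ?A \<union> ?B \<union> ?C" by (cases rule: model_cases) auto
  next
    fix x assume "x \<in> ?A \<union> ?B \<union> ?C" then show "x \<in> model m" using in_model by auto
  qed
  have inj: "inj_on (\<lambda>(j, i). 10 * j + i) ({1..?N} \<times> {..<7::nat})"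
    by (rule inj_onI) (auto dest!: digit_eq)
  have cA: "card ?A = 7 * ?N" using card_image[OF inj] by (simp add: card_cartesian_product)
  have cB: "card ?B = ?N - 1" by (subst card_image) (auto simp: inj_on_def)
  have cC: "card ?C = ?N - 1" by (subst card_image) (auto simp: inj_on_def)
  have dig: False if "10 * a + i = 10 * b + k" "i < 10" "k < 10" "i \<noteq> k" for a b i k :: nat
    using digit_eq that by blast
  have "?A \<inter> ?B = {}" "(?A \<union> ?B) \<inter> ?C = {}" by (auto dest: dig)
  then show "card (model m) = 9 * ?N - 2" unfolding e using cA cB cC assms by (simp add: card_Un_disjoint)
  show "finite (model m)" unfolding e by simp
qed

lemma surv_iso:
  assumes e: "emb X v X' v' h" and im: "h ` X = X'" and s: "surv X' v'"
  shows "surv X v"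
proof -
  note e' = emb_inverse[OF e im]
  have inj: "inj_on h X" using emb_inj[OF e] .
  have g: "good X' v'" and f: "unmet X' v' = {}" and l: "\<not> letterless X' v'" using s unfolding surv_def by auto
  have "met X v x A" if A: "A \<subseteq> X" "letter v A x" for A x
  proof -
    have "h ` A \<subseteq> X'" using A im by blast
    then have "met X' v' x (h ` A)" using emb_letter[OF e A] f unfolding unmet_def by blast
    then have "met X v x (inv_into X h ` (h ` A))" by (rule emb_met[OF e'])
    then show ?thesis using inv_into_image_cancel[OF inj A(1)] by simp
  qed
  then have "unmet X v = {}" unfolding unmet_def by blast
  moreover have "\<not> letterless X v"
  proof -
    obtain A x where A: "A \<subseteq> X'" "letter v' A x" using l unfolding letterless_def by blast
    have "inv_into X h ` A \<subseteq> X" using e' A(1) unfolding emb_def by blast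
    then show ?thesis using emb_letter[OF e' A] unfolding letterless_def by blast
  qed
  ultimately show ?thesis using emb_good[OF e g] unfolding surv_def by blast
qed

text \<open>The values of a permutation of 1, ..., n are ranks, so its relative order determines it;
  this turns isomorphic survivors into equal ones.\<close>

lemma perm_rank:
  assumes "is_perm n \<sigma>" "i < n" shows "\<sigma> ! i = card {j. j < n \<and> \<not> \<sigma> ! i < \<sigma> ! j}"
proof -
  have len: "length \<sigma> = n" "distinct \<sigma>" "set \<sigma> = {1..n}" using assms unfolding is_perm_def by auto
  have "(!) \<sigma> ` {j. j < n \<and> \<not> \<sigma> ! i < \<sigma> ! j} = {1..\<sigma> ! i}"
  proof (intro equalityI subsetI)
    fix y assume "y \<in> (!) \<sigma> ` {j. j < n \<and> \<not> \<sigma> ! i < \<sigma> ! j}"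
    then obtain j where "j < n" "y = \<sigma> ! j" "\<sigma> ! j \<le> \<sigma> ! i" by auto
    moreover from this have "y \<in> {1..n}" using len nth_mem[of j \<sigma>] by simp
    ultimately show "y \<in> {1..\<sigma> ! i}" by simp
  next
    fix y assume y: "y \<in> {1..\<sigma> ! i}"
    have "\<sigma> ! i \<in> {1..n}" using len nth_mem[of i \<sigma>] assms(2) by simp
    then have "y \<in> set \<sigma>" using y len(3) by simp
    then obtain j where "j < n" "y = \<sigma> ! j" using len(1) by (metis in_set_conv_nth)
    then show "y \<in> (!) \<sigma> ` {j. j < n \<and> \<not> \<sigma> ! i < \<sigma> ! j}" using y by auto
  qed
  moreover have "inj_on ((!) \<sigma>) {j. j < n \<and> \<not> \<sigma> ! i < \<sigma> ! j}"
    using is_perm_inj[OF assms(1)] by (rule inj_on_subset) auto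
  ultimately show ?thesis using card_image by fastforce
qed

lemma perm_eqI:
  assumes "is_perm n \<sigma>" "is_perm n \<tau>" "\<And>i j. i < n \<Longrightarrow> j < n \<Longrightarrow> \<sigma> ! i < \<sigma> ! j \<longleftrightarrow> \<tau> ! i < \<tau> ! j"
  shows "\<sigma> = \<tau>"
proof (rule nth_equalityI)
  show "length \<sigma> = length \<tau>" using assms unfolding is_perm_def by simp
  fix i assume "i < length \<sigma>"
  then have i: "i < n" using assms unfolding is_perm_def by simp
  have "{j. j < n \<and> \<not> \<sigma> ! i < \<sigma> ! j} = {j. j < n \<and> \<not> \<tau> ! i < \<tau> ! j}" using assms(3)[OF i] by blast
  then show "\<sigma> ! i = \<tau> ! i" using perm_rank[OF assms(1) i] perm_rank[OF assms(2) i] by simp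
qed

lemma surv_perm_model:
  assumes "is_perm n \<sigma>" "surv {..<n} ((!) \<sigma>)"
  obtains m h where "2 \<le> m" "n = 9 * tri m - 2" "emb {..<n} ((!) \<sigma>) (model m) (mval m) h" "h ` {..<n} = model m"
proof -
  interpret survivor "{..<n}" "(!) \<sigma>"
    by unfold_locales (use assms is_perm_inj in auto)
  obtain m h where mh: "2 \<le> m" "emb (model m) (mval m) {..<n} ((!) \<sigma>) h" "h ` model m = {..<n}"
    using iso_model by blast
  have t: "1 \<le> tri m" using tri_mono[OF mh(1)] by (simp add: numeral_2_eq_2)
  have "card (model m) = n" using card_image[OF emb_inj[OF mh(2)]] mh(3) by simp
  then have "n = 9 * tri m - 2" using card_model(1)[OF t] by simp
  moreover have "inv_into (model m) h ` {..<n} = model m"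
    using inv_into_image_cancel[OF emb_inj[OF mh(2)] order_refl] mh(3) by simp
  ultimately show thesis using that mh(1) emb_inverse[OF mh(2,3)] by blast
qed

text \<open>The length of a survivor determines \<open>m\<close>, and its increasing bijection onto
  the model is then unique, so there is at most one. If the length fits, the standardized model is
  one.\<close>

lemma odd_survivors:
  "odd (card {\<sigma>. is_perm n \<sigma> \<and> surv {..<n} ((!) \<sigma>)}) \<longleftrightarrow> (\<exists>m\<ge>2. n = 9 * tri m - 2)"
proof -
  define S where "S = {\<sigma>. is_perm n \<sigma> \<and> surv {..<n} ((!) \<sigma>)}"
  have one: "\<sigma> = \<tau>" if st: "\<sigma> \<in> S" "\<tau> \<in> S" for \<sigma> \<tau>
  proof -
    have p: "is_perm n \<sigma>" "surv {..<n} ((!) \<sigma>)" "is_perm n \<tau>" "surv {..<n} ((!) \<tau>)" using st unfolding S_def by auto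
    obtain m h where s: "2 \<le> m" "n = 9 * tri m - 2" "emb {..<n} ((!) \<sigma>) (model m) (mval m) h" "h ` {..<n} = model m"
      by (rule surv_perm_model[OF p(1,2)])
    obtain m' h' where t: "2 \<le> m'" "n = 9 * tri m' - 2" "emb {..<n} ((!) \<tau>) (model m') (mval m') h'" "h' ` {..<n} = model m'"
      by (rule surv_perm_model[OF p(3,4)])
    have "3 \<le> tri m" "3 \<le> tri m'" using tri_mono[OF s(1)] tri_mono[OF t(1)] by (simp_all add: numeral_2_eq_2)
    then have "tri m = tri m'" using s(2) t(2) by simp
    then have "m = m'" using tri_gap[of m m'] tri_gap[of m' m] by (cases m m' rule: linorder_cases) auto
    then have hh: "h i = h' i" if "i < n" for i
      using strict_mono_image_unique[of n h h' i] s(3,4) t(3,4) that unfolding emb_def by simp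
    show ?thesis
    proof (rule perm_eqI[OF p(1,3)])
      fix i j assume ij: "i < n" "j < n"
      have "\<sigma> ! i < \<sigma> ! j \<longleftrightarrow> mval m (h i) < mval m (h j)" using s(3) ij unfolding emb_def by simp
      moreover have "\<tau> ! i < \<tau> ! j \<longleftrightarrow> mval m' (h' i) < mval m' (h' j)" using t(3) ij unfolding emb_def by simp
      ultimately show "\<sigma> ! i < \<sigma> ! j \<longleftrightarrow> \<tau> ! i < \<tau> ! j"
        using hh[OF ij(1)] hh[OF ij(2)] \<open>m = m'\<close> by simp
    qed
  qed
  have ne: "S \<noteq> {} \<longleftrightarrow> (\<exists>m\<ge>2. n = 9 * tri m - 2)"
  proof
    assume "S \<noteq> {}"
    then obtain \<sigma> where "is_perm n \<sigma>" "surv {..<n} ((!) \<sigma>)" unfolding S_def by blast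
    then show "\<exists>m\<ge>2. n = 9 * tri m - 2" using surv_perm_model by metis
  next
    assume "\<exists>m\<ge>2. n = 9 * tri m - 2"
    then obtain m where m: "2 \<le> m" "n = 9 * tri m - 2" by blast
    have t: "1 \<le> tri m" using tri_mono[OF m(1)] by (simp add: numeral_2_eq_2)
    have cn: "card (model m) = n" using card_model(1)[OF t] m(2) by simp
    obtain \<omega> idx where w: "is_perm n \<omega>" "strict_mono_on {..<n} idx" "idx ` {..<n} = model m"
      "\<forall>a<n. \<forall>b<n. \<omega> ! a < \<omega> ! b \<longleftrightarrow> mval m (idx a) < mval m (idx b)"
      using standardize[OF card_model(2)[OF t] mval_inj] unfolding cn by blast
    have "emb {..<n} ((!) \<omega>) (model m) (mval m) idx" unfolding emb_def using w by auto
    then have "surv {..<n} ((!) \<omega>)" using surv_iso w(3) model_surv[OF m(1)] by blast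
    then show "S \<noteq> {}" using w(1) unfolding S_def by blast
  qed
  have "odd (card S) \<longleftrightarrow> S \<noteq> {}"
  proof (cases "S = {}")
    case False
    then obtain \<sigma> where "\<sigma> \<in> S" by blast
    then have "S = {\<sigma>}" using one by blast
    then show ?thesis by simp
  qed simp
  then show ?thesis using ne unfolding S_def by simp
qed

theorem theorem1p2:
  shows "\<exists>F. (\<forall>\<omega>\<in>F. is_perm 80 \<omega>) \<and> \<not> P_recursive (\<lambda>n. int (C n F))"
proof (intro exI[of _ F80] conjI)
  show "\<forall>\<omega>\<in>F80. is_perm 80 \<omega>" unfolding F80_def by blast
  have "odd (int (C n F80)) \<longleftrightarrow> (\<exists>m\<ge>2. n = 9 * tri m - 2)" if "80 \<le> n" for n
    using C_parity[OF that] odd_survivors[of n] by simp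
  then show "\<not> P_recursive (\<lambda>n. int (C n F80))" by (rule not_P_recursive)
qed

end
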